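(* Let $D\in\mathscr{D}(S^1,* )$ be a based chord diagram. Let $S=(S_o,S_u,S_\emptyset)$ be a partial state of $D$ with $S_u=\emptyset$. Let $\vec{G}_\emptyset$ be the canonical linearly ordered graph of $D_\emptyset$. Then $$\#_D(S)=\operatorname{nullity}_{\mathbb{Q}}(\vec{A}_{\vec{G}_\emptyset}^{\,t})+1=\operatorname{nullity}_{\mathbb{Q}}(\vec{A}_{\vec{G}_\emptyset})+1=\dim_{\mathbb{Q}}H_1(\partial\Sigma_D(S);\mathbb{Q}).$$
   Context: $\mathscr{D}(S^1,* )$ is the collection of chord diagrams: a circle $S^1$ (traversed counter-clockwise) with a basepoint $*$ and finitely many chords whose endpoints are pairwise distinct points of $S^1\setminus\{*\}$. The chords have a canonical ordering: travelling counter-clockwise from $*$, chords are labelled $1,2,\ldots$ in the order in which their first endpoints are encountered. The canonical linearly ordered (intersection) graph of a chord diagram has vertices corresponding to the chords, labelled by the canonical ordering; two vertices are adjacent iff the chords cross (their endpoints interleave on $S^1$); an edge is directed from the smaller label to the larger label. The skew-adjacency matrix $\vec{A}_{\vec{G}}$ has $(i,j)$ entry $1$ if $i,j$ are adjacent and $i<j$, $-1$ if $i,j$ are adjacent and $i>j$, and $0$ otherwise. A partial state $S=(S_o,S_u,S_\emptyset)$ is a partition of the chords of $D$ into three (possibly empty) sets (oriented smoothing, unoriented smoothing, no smoothing). $D_\emptyset$ is the diagram obtained from $D$ by deleting all chords in $S_\emptyset$. The surface $\Sigma_D(S)$ is obtained from a disk with boundary the circle of $D$ by attaching, for each $i\in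 S_o$, an untwisted band at the endpoints of $i$ and, for each $i\in S_u$, a band with a half-twist at the endpoints of $i$. $\#_D(S)$ is the number of boundary components of $\Sigma_D(S)$. *)

theory Defs
  imports
    "HOL-Analysis.Analysis"
    "HOL-Homology.Homology"
    "Graph_Theory.Pair_Digraph"
    "Jordan_Normal_Form.Matrix_Kernel"
begin

section \<open>Based chord diagrams\<close>

text \<open>
  The circle is the unit circle of \<open>\<complex>\<close>, with an arbitrary base point \<open>b\<close> on it. A chord is
  the unordered pair (two-element set) of its endpoints.
\<close>

definition chord_diagram :: "complex \<Rightarrow> complex set set \<Rightarrow> bool" where
  "chord_diagram b D \<longleftrightarrow>
     b \<in> sphere 0 1 \<and> finite D \<and>
     (\<forall>c\<in>D. c \<subseteq> sphere 0 1 - {b} \<and> card c = 2) \<and>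
     pairwise disjnt D"

text \<open>The angle, in \<open>[0, 2\<pi>)\<close>, travelled counter-clockwise from \<open>b\<close> until \<open>z\<close> is reached.\<close>

definition angle_from :: "complex \<Rightarrow> complex \<Rightarrow> real" where
  "angle_from b z = Arg2pi (z / b)"

definition first_end :: "complex \<Rightarrow> complex set \<Rightarrow> complex" where
  "first_end b c = (ARG_MIN (angle_from b) z. z \<in> c)"

definition last_end :: "complex \<Rightarrow> complex set \<Rightarrow> complex" where
  "last_end b c = (ARG_MAX (angle_from b) z. z \<in> c)"

definition chord_label :: "complex \<Rightarrow> complex set set \<Rightarrow> complex set \<Rightarrow> nat" where
  "chord_label b D c =
     card {d \<in> D. angle_from b (first_end b d) \<le> angle_from b (first_end b c)}"

definition chords_cross :: "complex \<Rightarrow> complex set \<Rightarrow> complex set \<Rightarrow> bool" where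
  "chords_cross b c d \<longleftrightarrow>
     (let a1 = angle_from b (first_end b c); a2 = angle_from b (last_end b c);
          d1 = angle_from b (first_end b d); d2 = angle_from b (last_end b d)
      in a1 < d1 \<and> d1 < a2 \<and> a2 < d2 \<or> d1 < a1 \<and> a1 < d2 \<and> d2 < a2)"


section \<open>The canonical linearly ordered graph and its skew-adjacency matrix\<close>

definition canonical_graph :: "complex \<Rightarrow> complex set set \<Rightarrow> nat pair_pre_digraph" where
  "canonical_graph b D =
     \<lparr> pverts = chord_label b D ` D,
       parcs = {(chord_label b D c, chord_label b D d) | c d.
                  c \<in> D \<and> d \<in> D \<and> chords_cross b c d \<and> chord_label b D c < chord_label b D d} \<rparr>"

text \<open>
  For a digraph with vertex set \<open>{1..n}\<close>. Matrix indices start at \<open>0\<close>, vertices at \<open>1\<close>, hence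
  the shift.
\<close>

definition skew_adjacency :: "nat pair_pre_digraph \<Rightarrow> 'a :: ring_1 mat" where
  "skew_adjacency G =
     (let n = card (pverts G);
          adj = (\<lambda>i j. (i, j) \<in> parcs G \<or> (j, i) \<in> parcs G)
      in mat n n (\<lambda>(i, j).
           if adj (i + 1) (j + 1) \<and> i < j then 1
           else if adj (i + 1) (j + 1) \<and> i > j then -1
           else 0))"


section \<open>Partial states\<close>

text \<open>Chords with oriented smoothing, with unoriented smoothing, and without smoothing.\<close>

type_synonym state = "complex set set \<times> complex set set \<times> complex set set"

definition partial_state :: "complex set set \<Rightarrow> state \<Rightarrow> bool" where
  "partial_state D = (\<lambda>(So, Su, Se).
     So \<union> Su \<union> Se = D \<and> So \<inter> Su = {} \<and> So \<inter> Se = {} \<and> Su \<inter> Se = {})"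


section \<open>The surface of a partial state\<close>

text \<open>Bands are attached along the arcs of angular radius \<open>w\<close> about the chord endpoints.\<close>

definition admissible_width :: "complex set set \<Rightarrow> real \<Rightarrow> bool" where
  "admissible_width D w \<longleftrightarrow>
     0 < w \<and>
     (\<forall>x\<in>\<Union>D. \<forall>y\<in>\<Union>D. x \<noteq> y \<longrightarrow>
        disjnt ((\<lambda>s. x * cis s) ` {-w..w}) ((\<lambda>s. y * cis s) ` {-w..w}))"

lemma admissible_width_exists:
  assumes "finite (\<Union>D)"
  shows "\<exists>w. admissible_width D w"
proof -
  obtain e where e: "e > 0" "\<And>x y. x \<in> \<Union>D \<Longrightarrow> y \<in> \<Union>D \<Longrightarrow> x \<noteq> y \<Longrightarrow> e \<le> dist x y"
  proof -
    define P where "P = {(x, y). x \<in> \<Union>D \<and> y \<in> \<Union>D \<and> x \<noteq> y}"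
    have fin: "finite P"
      by (rule finite_subset[of _ "\<Union>D \<times> \<Union>D"]) (use assms in \<open>auto simp: P_def\<close>)
    define e where "e = Min (insert 1 ((\<lambda>(x, y). dist x y) ` P))"
    have "e > 0" unfolding e_def using fin by (subst Min_gr_iff) (auto simp: P_def)
    moreover have "e \<le> dist x y" if "x \<in> \<Union>D" "y \<in> \<Union>D" "x \<noteq> y" for x y
    proof -
      have "(x, y) \<in> P" using that by (simp add: P_def)
      hence "dist x y \<in> insert 1 ((\<lambda>(x, y). dist x y) ` P)" by force
      thus ?thesis unfolding e_def by (rule Min_le[rotated]) (use fin in simp)
    qed
    ultimately show thesis using that by blast
  qed
  have "\<exists>w>0. \<forall>x\<in>\<Union>D. \<forall>s. \<bar>s\<bar> \<le> w \<longrightarrow> dist (x * cis s) x < e / 2"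
  proof -
    have "\<forall>x\<in>\<Union>D. \<exists>w>0. \<forall>s. \<bar>s\<bar> \<le> w \<longrightarrow> dist (x * cis s) x < e / 2"
    proof
      fix x
      have "isCont (\<lambda>s. x * cis s) 0" unfolding cis_conv_exp by (intro continuous_intros)
      then obtain d where "d > 0" "\<And>s. dist s 0 < d \<Longrightarrow> dist (x * cis s) (x * cis 0) < e / 2"
        using e(1) unfolding continuous_at_eps_delta by (meson half_gt_zero)
      thus "\<exists>w>0. \<forall>s. \<bar>s\<bar> \<le> w \<longrightarrow> dist (x * cis s) x < e / 2"
        by (intro exI[of _ "d / 2"]) auto
    qed
    then obtain w where w: "\<And>x. x \<in> \<Union>D \<Longrightarrow> w x > 0"
      "\<And>x s. x \<in> \<Union>D \<Longrightarrow> \<bar>s\<bar> \<le> w x \<Longrightarrow> dist (x * cis s) x < e / 2"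
      by metis
    define v where "v = Min (insert 1 (w ` \<Union>D))"
    have "v > 0" unfolding v_def using w(1) assms by (subst Min_gr_iff) auto
    moreover have "v \<le> w x" if "x \<in> \<Union>D" for x
      unfolding v_def using that assms by (intro Min_le) auto
    ultimately show ?thesis using w(2) by (intro exI[of _ v]) force
  qed
  then obtain w where w: "w > 0" "\<And>x s. x \<in> \<Union>D \<Longrightarrow> \<bar>s\<bar> \<le> w \<Longrightarrow> dist (x * cis s) x < e / 2"
    by blast
  have "x * cis s \<noteq> y * cis t"
    if "x \<in> \<Union>D" "y \<in> \<Union>D" "x \<noteq> y" "\<bar>s\<bar> \<le> w" "\<bar>t\<bar> \<le> w" for x y s t
  proof
    assume eq: "x * cis s = y * cis t"
    have "dist x y \<le> dist (x * cis s) x + dist (y * cis t) y"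
      using dist_triangle2[of x y "x * cis s"] eq by (simp add: dist_commute)
    also have "\<dots> < e" using w(2)[of x s] w(2)[of y t] that by simp
    finally show False using e(2)[of x y] that by simp
  qed
  hence "admissible_width D w"
    unfolding admissible_width_def disjnt_iff using w(1) by (force simp: abs_le_iff)
  thus ?thesis ..
qed

definition quotient_topology :: "'a topology \<Rightarrow> ('a \<Rightarrow> 'b) \<Rightarrow> 'b topology" where
  "quotient_topology X q =
     topology (\<lambda>U. U \<subseteq> q ` topspace X \<and> openin X {x \<in> topspace X. q x \<in> U})"

lemma openin_quotient_topology:
  "openin (quotient_topology X q) U \<longleftrightarrow>
     U \<subseteq> q ` topspace X \<and> openin X {x \<in> topspace X. q x \<in> U}"
proof -
  have "istopology (\<lambda>U. U \<subseteq> q ` topspace X \<and> openin X {x \<in> topspace X. q x \<in> U})"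
    unfolding istopology_def
  proof (intro conjI allI impI)
    fix S T assume *: "S \<subseteq> q ` topspace X \<and> openin X {x \<in> topspace X. q x \<in> S}"
      "T \<subseteq> q ` topspace X \<and> openin X {x \<in> topspace X. q x \<in> T}"
    show "S \<inter> T \<subseteq> q ` topspace X" using * by blast
    have "{x \<in> topspace X. q x \<in> S \<inter> T} = {x \<in> topspace X. q x \<in> S} \<inter> {x \<in> topspace X. q x \<in> T}"
      by blast
    thus "openin X {x \<in> topspace X. q x \<in> S \<inter> T}" using * by auto
  next
    fix K assume *: "\<forall>S\<in>K. S \<subseteq> q ` topspace X \<and> openin X {x \<in> topspace X. q x \<in> S}"
    show "\<Union>K \<subseteq> q ` topspace X" using * by blast
    have "{x \<in> topspace X. q x \<in> \<Union>K} = (\<Union>S\<in>K. {x \<in> topspace X. q x \<in> S})"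
      by blast
    thus "openin X {x \<in> topspace X. q x \<in> \<Union>K}" using * by auto
  qed
  thus ?thesis by (simp add: quotient_topology_def)
qed

lemma topspace_quotient_topology [simp]: "topspace (quotient_topology X q) = q ` topspace X"
proof
  show "topspace (quotient_topology X q) \<subseteq> q ` topspace X"
    using openin_quotient_topology[of X q] openin_topspace by blast
  have "{x \<in> topspace X. q x \<in> q ` topspace X} = topspace X" by blast
  hence "openin (quotient_topology X q) (q ` topspace X)"
    by (simp add: openin_quotient_topology)
  thus "q ` topspace X \<subseteq> topspace (quotient_topology X q)" by (rule openin_subset)
qed

lemma quotient_map_quotient_topology: "quotient_map X (quotient_topology X q) q"
  by (auto simp: quotient_map_def openin_quotient_topology)

text \<open>
  The disjoint union of the closed disk (index \<^term>\<open>None\<close>) and one band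
  \<open>[-1, 1] \<times> [0, 1]\<close>, drawn in \<open>\<complex>\<close>, for each chord in \<open>B\<close>.
\<close>

definition disk_and_bands :: "complex set set \<Rightarrow> (complex set option \<times> complex) topology" where
  "disk_and_bands B =
     sum_topology
       (\<lambda>i. case i of None \<Rightarrow> top_of_set (cball 0 1)
                    | Some c \<Rightarrow> top_of_set (cbox (Complex (-1) 0) (Complex 1 1)))
       (insert None (Some ` B))"

text \<open>
  The ends \<open>Im z = 0\<close> and \<open>Im z = 1\<close> of the band of a chord are attached to the arcs about its
  first and its last endpoint; every point is sent to the representative of its class, which is
  the point of the disk if there is one. Since the first end runs counter-clockwise, the band is
  untwisted iff the other end runs clockwise (giving an annulus rather than a Moebius band when
  it is the only band).
\<close>

fun glue :: "complex \<Rightarrow> real \<Rightarrow> complex set set \<Rightarrow> complex set option \<times> complex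
    \<Rightarrow> complex set option \<times> complex" where
  "glue b w So (None, z) = (None, z)"
| "glue b w So (Some c, z) =
     (if Im z = 0 then (None, first_end b c * cis (w * Re z))
      else if Im z = 1 then
        (None, last_end b c * cis (if c \<in> So then - (w * Re z) else w * Re z))
      else (Some c, z))"

definition state_surface :: "complex \<Rightarrow> real \<Rightarrow> state \<Rightarrow> (complex set option \<times> complex) topology" where
  "state_surface b w = (\<lambda>(So, Su, Se).
     quotient_topology (disk_and_bands (So \<union> Su)) (glue b w So))"

text \<open>The boundary of a topological surface: the points without a planar open neighbourhood.\<close>

definition surface_boundary :: "'a topology \<Rightarrow> 'a topology" where
  "surface_boundary X = subtopology X
     {x \<in> topspace X.
        \<not> (\<exists>U. openin X U \<and> x \<in> U \<and>
              subtopology X U homeomorphic_space (euclidean :: complex topology))}"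

definition num_boundary_components :: "'a topology \<Rightarrow> nat" where
  "num_boundary_components X = card (connected_components_of (surface_boundary X))"


section \<open>Singular homology with rational coefficients\<close>

type_synonym 'a rat_chain = "((nat \<Rightarrow> real) \<Rightarrow> 'a) \<Rightarrow>\<^sub>0 rat"

definition rat_boundary :: "nat \<Rightarrow> 'a rat_chain \<Rightarrow> 'a rat_chain" where
  "rat_boundary p x =
     (if p = 0 then 0
      else \<Sum>f\<in>Poly_Mapping.keys x. \<Sum>k\<le>p.
             Poly_Mapping.single (singular_face p k f) ((-1) ^ k * Poly_Mapping.lookup x f))"

definition rat_chains :: "nat \<Rightarrow> 'a topology \<Rightarrow> 'a rat_chain set" where
  "rat_chains p X = {x. Poly_Mapping.keys x \<subseteq> singular_simplex_set p X}"

definition rat_cycles :: "nat \<Rightarrow> 'a topology \<Rightarrow> 'a rat_chain set" where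
  "rat_cycles p X = {x \<in> rat_chains p X. rat_boundary p x = 0}"

definition rat_boundaries :: "nat \<Rightarrow> 'a topology \<Rightarrow> 'a rat_chain set" where
  "rat_boundaries p X = rat_boundary (Suc p) ` rat_chains (Suc p) X"

definition homology_class :: "nat \<Rightarrow> 'a topology \<Rightarrow> 'a rat_chain \<Rightarrow> 'a rat_chain set" where
  "homology_class p X x = (\<lambda>y. x + y) ` rat_boundaries p X"

text \<open>
  The quotient vector space of cycles modulo boundaries; the ring multiplication fields of the
  module record carry no meaning.
\<close>

definition rat_homology :: "nat \<Rightarrow> 'a topology \<Rightarrow> (rat, 'a rat_chain set) module" where
  "rat_homology p X =
     \<lparr> carrier = homology_class p X ` rat_cycles p X,
       mult = undefined,
       one = undefined,
       zero = homology_class p X 0,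
       add = (\<lambda>S T. \<Union>x\<in>S. \<Union>y\<in>T. homology_class p X (x + y)),
       smult = (\<lambda>q S. \<Union>x\<in>S. homology_class p X (Poly_Mapping.map ((*) q) x)) \<rparr>"


lemma lookup_rat_smult [simp]:
  "Poly_Mapping.lookup (Poly_Mapping.map ((*) q) x) f = q * Poly_Mapping.lookup x f" for q :: rat
  by (simp add: Poly_Mapping.map.rep_eq when_def)

lemma rat_boundary_superset:
  assumes "finite F" "Poly_Mapping.keys x \<subseteq> F"
  shows "rat_boundary p x =
     (if p = 0 then 0
      else \<Sum>f\<in>F. \<Sum>k\<le>p.
             Poly_Mapping.single (singular_face p k f) ((-1) ^ k * Poly_Mapping.lookup x f))"
proof -
  have "(\<Sum>f\<in>Poly_Mapping.keys x. \<Sum>k\<le>p.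
             Poly_Mapping.single (singular_face p k f) ((-1) ^ k * Poly_Mapping.lookup x f))
      = (\<Sum>f\<in>F. \<Sum>k\<le>p.
             Poly_Mapping.single (singular_face p k f) ((-1) ^ k * Poly_Mapping.lookup x f))"
    by (rule sum.mono_neutral_left) (use assms in \<open>auto simp: in_keys_iff\<close>)
  thus ?thesis by (simp add: rat_boundary_def)
qed

lemma rat_boundary_add: "rat_boundary p (x + y) = rat_boundary p x + rat_boundary p y"
proof -
  define F where "F = Poly_Mapping.keys x \<union> Poly_Mapping.keys y"
  have F: "finite F" "Poly_Mapping.keys x \<subseteq> F" "Poly_Mapping.keys y \<subseteq> F"
    "Poly_Mapping.keys (x + y) \<subseteq> F"
    using keys_add[of x y] by (auto simp: F_def)
  show ?thesis
    using F by (simp add: rat_boundary_superset[of F] lookup_add distrib_left single_add sum.distrib)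
qed

lemma map_mult_single:
  "Poly_Mapping.map ((*) q) (Poly_Mapping.single f r) = Poly_Mapping.single f (q * r)" for q r :: rat
  by (rule poly_mapping_eqI) (auto simp: lookup_single when_def)

lemma map_mult_add:
  "Poly_Mapping.map ((*) q) (x + y) = Poly_Mapping.map ((*) q) x + Poly_Mapping.map ((*) q) y"
  for q :: rat
  by (rule poly_mapping_eqI) (simp add: lookup_add distrib_left)

lemma map_mult_zero [simp]: "Poly_Mapping.map ((*) q) 0 = (0 :: _ \<Rightarrow>\<^sub>0 rat)"
  by (rule poly_mapping_eqI) simp

lemma map_mult_sum:
  "Poly_Mapping.map ((*) q) (sum g A) = (\<Sum>a\<in>A. Poly_Mapping.map ((*) q) (g a))" for q :: rat
  by (induction A rule: infinite_finite_induct) (simp_all add: map_mult_add)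

lemma rat_boundary_smult:
  "rat_boundary p (Poly_Mapping.map ((*) q) x) = Poly_Mapping.map ((*) q) (rat_boundary p x)"
proof -
  have "Poly_Mapping.keys (Poly_Mapping.map ((*) q) x) \<subseteq> Poly_Mapping.keys x"
    by (auto simp: in_keys_iff)
  thus ?thesis
    by (simp add: rat_boundary_superset[of "Poly_Mapping.keys x"] map_mult_sum map_mult_single
        algebra_simps)
qed

lemma vectorspace_rat_homology: "vectorspace class_ring (rat_homology p X)"
proof -
  let ?C = "homology_class p X" and ?B = "rat_boundaries p X" and ?Z = "rat_cycles p X"
  let ?m = "\<lambda>q x. Poly_Mapping.map ((*) (q :: rat)) x"
  have chains: "0 \<in> rat_chains n X" "x \<in> rat_chains n X \<Longrightarrow> ?m q x \<in> rat_chains n X"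
    "x \<in> rat_chains n X \<Longrightarrow> y \<in> rat_chains n X \<Longrightarrow> x + y \<in> rat_chains n X" for n x y q
    using keys_add[of x y] by (auto simp: rat_chains_def in_keys_iff subset_iff)
  have zero: "rat_boundary n 0 = (0 :: 'a rat_chain)" for n
    by (simp add: rat_boundary_def)
  have Z: "0 \<in> ?Z" "x \<in> ?Z \<Longrightarrow> ?m q x \<in> ?Z" "x \<in> ?Z \<Longrightarrow> y \<in> ?Z \<Longrightarrow> x + y \<in> ?Z" for x y q
    using chains by (auto simp: rat_cycles_def rat_boundary_add rat_boundary_smult zero)
  have B: "0 \<in> ?B" "x \<in> ?B \<Longrightarrow> ?m q x \<in> ?B" "x \<in> ?B \<Longrightarrow> y \<in> ?B \<Longrightarrow> x + y \<in> ?B" for x y q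
  proof -
    show "0 \<in> ?B" unfolding rat_boundaries_def
      by (rule image_eqI[of _ _ 0]) (use chains in \<open>auto simp: rat_boundary_def\<close>)
    show "?m q x \<in> ?B" if x: "x \<in> ?B"
    proof -
      obtain u where u: "u \<in> rat_chains (Suc p) X" "x = rat_boundary (Suc p) u"
        using x by (auto simp: rat_boundaries_def)
      have "?m q x = rat_boundary (Suc p) (?m q u)" by (simp add: u rat_boundary_smult)
      thus ?thesis using chains(2)[OF u(1)] by (simp add: rat_boundaries_def)
    qed
    show "x + y \<in> ?B" if xy: "x \<in> ?B" "y \<in> ?B"
    proof -
      obtain u v where u: "u \<in> rat_chains (Suc p) X" "x = rat_boundary (Suc p) u"
          "v \<in> rat_chains (Suc p) X" "y = rat_boundary (Suc p) v"
        using xy by (auto simp: rat_boundaries_def)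
      have "x + y = rat_boundary (Suc p) (u + v)" by (simp add: u rat_boundary_add)
      thus ?thesis using chains(3)[OF u(1,3)] by (simp add: rat_boundaries_def)
    qed
  qed
  have neg: "?m (-1) x = - x" for x :: "'a rat_chain"
    by (rule poly_mapping_eqI) simp
  have B': "- x \<in> ?B" if "x \<in> ?B" for x using B(2)[OF that, of "-1"] by (simp add: neg)
  have mem: "y \<in> ?C x \<longleftrightarrow> y - x \<in> ?B" for x y
    unfolding homology_class_def by (auto intro: image_eqI[of _ _ "y - x"])
  have eq: "?C x = ?C y" if "x - y \<in> ?B" for x y
  proof (rule Set.set_eqI)
    fix z
    have 1: "z - y = (z - x) + (x - y)" and 2: "z - x = (z - y) + - (x - y)" by simp_all
    have "z - y \<in> ?B" if "z - x \<in> ?B"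
      unfolding 1 by (rule B(3)[OF that \<open>x - y \<in> ?B\<close>])
    moreover have "z - x \<in> ?B" if "z - y \<in> ?B"
      unfolding 2 by (rule B(3)[OF that B'[OF \<open>x - y \<in> ?B\<close>]])
    ultimately show "z \<in> ?C x \<longleftrightarrow> z \<in> ?C y" unfolding mem by blast
  qed
  have self: "x \<in> ?C x" for x by (simp add: mem B)
  have add: "(\<Union>x'\<in>?C x. \<Union>y'\<in>?C y. ?C (x' + y')) = ?C (x + y)" for x y
  proof -
    have "?C (x' + y') = ?C (x + y)" if "x' \<in> ?C x" "y' \<in> ?C y" for x' y'
    proof (rule eq)
      have "(x' + y') - (x + y) = (x' - x) + (y' - y)" by simp
      also have "\<dots> \<in> ?B" by (rule B(3)) (use that in \<open>simp_all add: mem\<close>)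
      finally show "(x' + y') - (x + y) \<in> ?B" .
    qed
    thus ?thesis using self by blast
  qed
  have smult: "(\<Union>x'\<in>?C x. ?C (?m q x')) = ?C (?m q x)" for q x
  proof -
    have "?C (?m q x') = ?C (?m q x)" if "x' \<in> ?C x" for x'
    proof (rule eq)
      have "?m q x' - ?m q x = ?m q (x' - x)"
        by (rule poly_mapping_eqI) (simp add: lookup_minus algebra_simps)
      also have "\<dots> \<in> ?B" by (rule B(2)) (use that in \<open>simp add: mem\<close>)
      finally show "?m q x' - ?m q x \<in> ?B" .
    qed
    thus ?thesis using self by blast
  qed
  have m1: "?m (q + r) x = ?m q x + ?m r x" "?m (q * r) x = ?m q (?m r x)" "?m 1 x = x"
    for q r and x :: "'a rat_chain"
    by (rule poly_mapping_eqI, simp add: lookup_add algebra_simps)+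
  let ?M = "rat_homology p X"
  have M: "carrier ?M = ?C ` ?Z" "?C x \<oplus>\<^bsub>?M\<^esub> ?C y = ?C (x + y)" "\<zero>\<^bsub>?M\<^esub> = ?C 0"
    "q \<odot>\<^bsub>?M\<^esub> ?C x = ?C (?m q x)" for x y q
    using add smult by (simp_all add: rat_homology_def)
  have "module (class_ring :: rat ring) ?M"
  proof (rule moduleI)
    show "cring (class_ring :: rat ring)" by (rule class_cring.cring_axioms)
    show "abelian_group ?M"
    proof (rule abelian_groupI)
      fix S assume "S \<in> carrier ?M"
      then obtain x where x: "x \<in> ?Z" "S = ?C x" by (auto simp: M(1))
      show "\<exists>T\<in>carrier ?M. T \<oplus>\<^bsub>?M\<^esub> S = \<zero>\<^bsub>?M\<^esub>"
        by (rule bexI[of _ "?C (- x)"])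
          (use x Z(2)[OF x(1), of "-1"] in \<open>simp_all add: M neg\<close>)
    qed (elim imageE[of _ ?C ?Z] | simp add: M Z add_ac)+
  qed (elim imageE[of _ ?C ?Z] | simp add: M Z class_ring_simps map_mult_add m1)+
  thus ?thesis by (simp add: vectorspace_def class_field.field_axioms)
qed

end

theory Submission
  imports Defs
begin

text \<open>
  The boundary of the surface is a disjoint union of circles. So the number of its components and
  the dimension of its first rational homology are both the dimension of the space of locally
  constant rational functions on the boundary, and it remains to compare that space with the kernel
  of the skew-adjacency matrix \<open>A\<close>.

  A locally constant function has one value on each gap of the circle, a gap being what is left
  between two consecutive attaching arcs. An untwisted band joins the gap before its first end to
  the gap after its last end, and the gap after its first end to the gap before its last end.
  Hence the function jumps by opposite amounts at the two ends of a chord \<open>c\<close>, say by \<open>x c\<close> at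
  the first end and by \<open>- x c\<close> at the last. The function is determined, up to a constant, by
  the vector \<open>x\<close>. Walking from the gap after the first end of \<open>c\<close> to the gap before its
  last end, the value must return to itself, so the jumps met on the way sum to \<open>0\<close>. A chord
  with both ends or no end on this stretch contributes nothing, and a chord that crosses \<open>c\<close>
  contributes \<open>\<plusminus> x d\<close> with the sign given by the order of the first ends. The condition is
  therefore exactly that the row of \<open>c\<close> in \<open>A\<close> annihilates \<open>x\<close>. Conversely, every
  vector in the kernel integrates to a locally constant function. The kernel of \<open>A\<close> is thus the
  space of locally constant functions modulo the constants, which gives nullity plus one; this is
  \<open>gauss_diagram.kernel_dim_crossing_matrix\<close>. Transposition changes nothing, as
  \<open>A\<close> is skew-symmetric.

  The topological part has three steps. Points of the boundary are recognized in two kinds of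
  planar charts by invariance of domain (\<open>surface_boundary_iff_chart\<close>), which identifies the
  boundary as the circle without the open attaching arcs together with the long sides of the bands
  (\<open>band_diagram.topspace_surface_boundary\<close>). This set is cut into gaps and sides, each ending
  where the next one begins, and such a space is a disjoint union of circles, one for each cycle of
  the successor permutation (\<open>closed_chain_of_arcs\<close>). Finally, the rational homology of
  finitely many circles follows from the integral homology of the circle by clearing denominators
  and by cutting chains along the components (\<open>rat_homology_of_circles\<close>).
\<close>

section \<open>Dimension from coordinates\<close>

text \<open>
  Linear coordinates avoid choosing bases: both the kernel of a matrix and the homology of a union
  of circles are parametrized below by coordinate vectors.
\<close>

lemma bijective_coordinates_dim:
  fixes V :: "('a :: field, 'b) module"
  assumes V: "vectorspace class_ring V"
    and bij: "bij_betw T (carrier_vec m) (carrier V)"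
    and add: "\<And>u v. u \<in> carrier_vec m \<Longrightarrow> v \<in> carrier_vec m \<Longrightarrow> T (u + v) = T u \<oplus>\<^bsub>V\<^esub> T v"
    and smult: "\<And>r v. v \<in> carrier_vec m \<Longrightarrow> T (r \<cdot>\<^sub>v v) = r \<odot>\<^bsub>V\<^esub> T v"
  shows "vectorspace.fin_dim class_ring V" "vectorspace.dim class_ring V = m"
proof -
  interpret U: vec_space "TYPE('a)" m .
  interpret VV: vectorspace class_ring V by (rule V)
  have "T \<in> module_hom class_ring U.V V"
    using bij add smult by (auto simp: module_hom_def bij_betw_def module_vec_simps)
  then interpret linear_map class_ring U.V V T
    by (intro linear_map.intro mod_hom.intro mod_hom_axioms.intro V vec_vs)
       (use V vec_vs[of m] in \<open>auto simp: vectorspace_def\<close>)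
  have inj: "inj_on T (carrier U.V)" and surj: "T ` carrier U.V = carrier V"
    using bij by (auto simp: bij_betw_def module_vec_simps)
  show "VV.fin_dim" by (rule surj_fin_dim[OF U.fin_dim surj])
  show "VV.dim = m" using dim_eq[OF U.fin_dim inj surj] U.dim_is_n by simp
qed

section \<open>Rational homology of a disjoint union of circles\<close>

lemma homologous_rel_set_add:
  "(\<Union>r\<in>homologous_rel_set p X S a. \<Union>s\<in>homologous_rel_set p X S b. {r + s})
      = homologous_rel_set p X S (a + b)"
proof -
  have "\<exists>r s. homologous_rel p X S a r \<and> homologous_rel p X S b s \<and> x = r + s"
    if "homologous_rel p X S (a + b) x" for x
    by (rule exI[of _ a], rule exI[of _ "x - a"]) (use that
        in \<open>auto simp: homologous_rel_def algebra_simps\<close>)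
  then show ?thesis by (auto intro: homologous_rel_add)
qed

text \<open>
  The homology group is infinite cyclic. Spelling out a generator on the level of chains makes it
  possible to compare it with rational chains.
\<close>

lemma integral_homology_of_circle:
  assumes "Y homeomorphic_space nsphere 1"
  obtains z where "singular_relcycle 1 Y {} z"
    "\<And>c. singular_relcycle 1 Y {} c \<Longrightarrow> \<exists>k. homologous_rel 1 Y {} c (frag_cmul k z)"
    "\<And>k. singular_relboundary 1 Y {} (frag_cmul k z) \<Longrightarrow> k = 0"
proof -
  let ?G = "homology_group (int 1) Y"
  have "homology_group (int 1) (nsphere 1) \<cong> integer_group"
    using reduced_homology_group_nsphere(1)[of 1] by (simp add: un_reduced_homology_group)
  moreover have "?G \<cong> homology_group (int 1) (nsphere 1)"
    using homeomorphic_space_imp_isomorphic_homology_groups[OF assms] .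
  ultimately have "?G \<cong> integer_group" using iso_trans by blast
  then have "integer_group \<cong> ?G" by (rule group.iso_sym[rotated]) simp
  then obtain h where h: "h \<in> iso integer_group ?G" by (auto simp: is_iso_def)
  have car: "carrier ?G = homologous_rel_set 1 Y {} ` singular_relcycle_set 1 Y {}"
    by (rule carrier_relative_homology_group)
  have one: "\<one>\<^bsub>?G\<^esub> = singular_relboundary_set 1 Y {}" by (rule one_relative_homology_group)
  have mult: "\<And>a b. homologous_rel_set 1 Y {} a \<otimes>\<^bsub>?G\<^esub> homologous_rel_set 1 Y {} b
      = homologous_rel_set 1 Y {} (a + b)"
    using homologous_rel_set_add unfolding mult_relative_homology_group by blast
  interpret G: group ?G by simp
  interpret H: group_hom integer_group ?G h
    by (intro group_hom.intro group_hom_axioms.intro) (use h in \<open>auto simp: iso_def\<close>)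
  have bij: "bij_betw h UNIV (carrier ?G)" using h by (auto simp: iso_def)
  obtain z where z: "singular_relcycle 1 Y {} z" "h 1 = homologous_rel_set 1 Y {} z"
    using H.hom_closed[of 1] car by auto
  \<comment> \<open>A homomorphism from the integers is determined by its value at 1.\<close>
  have hk: "h k = homologous_rel_set 1 Y {} (frag_cmul k z)" for k
  proof (induction k rule: int_induct[where k = 0])
    case base
    have "homologous_rel_set 1 Y {} 0 = singular_relboundary_set 1 Y {}"
      by (subst homologous_rel_set_eq_relboundary) simp
    then show ?case using H.hom_one one by simp
  next
    case (step1 i)
    have "h (i + 1) = h i \<otimes>\<^bsub>?G\<^esub> h 1" using H.hom_mult[of i 1] by simp
    then show ?case by (simp only: step1.IH z(2) mult) (simp add: frag_cmul_distrib)
  next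
    case (step2 i)
    have "h (i - 1) \<otimes>\<^bsub>?G\<^esub> h 1 = h i" using H.hom_mult[of "i - 1" 1] by simp
    also have "\<dots> = homologous_rel_set 1 Y {} (frag_cmul (i - 1) z) \<otimes>\<^bsub>?G\<^esub> h 1"
      by (simp only: step2.IH z(2) mult) (simp add: frag_cmul_diff_distrib)
    finally show ?case
      by (subst (asm) G.right_cancel) (use H.hom_closed car z
          in \<open>auto simp: singular_relcycle_cmul\<close>)
  qed
  show thesis
  proof
    show "singular_relcycle 1 Y {} z" by (rule z)
    show "\<exists>k. homologous_rel 1 Y {} c (frag_cmul k z)" if c: "singular_relcycle 1 Y {} c" for c
    proof -
      have "homologous_rel_set 1 Y {} c \<in> carrier ?G" using c car by auto
      then obtain k where "h k = homologous_rel_set 1 Y {} c" using bij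
          by (metis bij_betw_def imageE)
      then show ?thesis unfolding hk homologous_rel_set_eq by (metis homologous_rel_sym)
    qed
    show "k = 0" if k: "singular_relboundary 1 Y {} (frag_cmul k z)" for k
    proof -
      have "h k = singular_relboundary_set 1 Y {}" using k
          by (simp only: hk homologous_rel_set_eq_relboundary)
      then have "h k = h 0" using H.hom_one one by simp
      then show ?thesis using bij by (auto simp: bij_betw_def inj_on_def)
    qed
  qed
qed

abbreviation rat_scale :: "rat \<Rightarrow> 'a rat_chain \<Rightarrow> 'a rat_chain" where
  "rat_scale q \<equiv> Poly_Mapping.map ((*) q)"

definition rat_of_chain :: "'a chain \<Rightarrow> 'a rat_chain" where
  "rat_of_chain = Poly_Mapping.map rat_of_int"

lemma lookup_rat_of_chain [simp]:
  "Poly_Mapping.lookup (rat_of_chain c) f = rat_of_int (Poly_Mapping.lookup c f)"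
  by (simp add: rat_of_chain_def Poly_Mapping.map.rep_eq when_def)

lemma keys_rat_of_chain [simp]: "Poly_Mapping.keys (rat_of_chain c) = Poly_Mapping.keys c"
  by (auto simp: in_keys_iff)

lemma rat_of_chain_0 [simp]: "rat_of_chain 0 = 0"
  by (rule poly_mapping_eqI) simp

lemma rat_of_chain_add: "rat_of_chain (c + d) = rat_of_chain c + rat_of_chain d"
  by (rule poly_mapping_eqI) (simp add: lookup_add)

lemma rat_of_chain_diff: "rat_of_chain (c - d) = rat_of_chain c - rat_of_chain d"
  by (rule poly_mapping_eqI) (simp add: lookup_minus)

lemma rat_of_chain_sum: "rat_of_chain (sum g A) = (\<Sum>a\<in>A. rat_of_chain (g a))"
  by (induction A rule: infinite_finite_induct) (simp_all add: rat_of_chain_add)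

lemma rat_of_chain_cmul: "rat_of_chain (frag_cmul k c) = rat_scale (of_int k) (rat_of_chain c)"
  by (rule poly_mapping_eqI) simp

lemma rat_of_chain_inject: "rat_of_chain c = rat_of_chain d \<longleftrightarrow> c = d"
  by (metis lookup_rat_of_chain of_int_eq_iff poly_mapping_eqI)

lemma rat_of_chain_mem: "rat_of_chain c \<in> rat_chains p X \<longleftrightarrow> singular_chain p X c"
  by (simp add: rat_chains_def singular_chain_def)

lemma rat_boundary_of_chain: "rat_boundary p (rat_of_chain c) = rat_of_chain (chain_boundary p c)"
proof -
  have "rat_of_chain (frag_cmul a (frag_cmul b (frag_of s)))
      = Poly_Mapping.single s (of_int b * of_int a)"
    for a b and s :: "(nat \<Rightarrow> real) \<Rightarrow> 'a"
    by (rule poly_mapping_eqI) (simp add: lookup_single when_def)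
  then show ?thesis
    by (simp add: rat_boundary_def chain_boundary_def frag_extend_def rat_of_chain_sum frag_cmul_sum
        o_def)
qed

lemma rat_scale_diff: "rat_scale q (x - y) = rat_scale q x - rat_scale q y"
  by (rule poly_mapping_eqI) (simp add: lookup_minus algebra_simps)

lemma rat_scale_scale: "rat_scale q (rat_scale r x) = rat_scale (q * r) x"
  by (rule poly_mapping_eqI) simp

lemma rat_scale_1: "rat_scale 1 x = x"
  by (rule poly_mapping_eqI) simp

lemma rat_boundary_0 [simp]: "rat_boundary p 0 = 0"
  by (simp add: rat_boundary_def)

lemma rat_boundary_sum: "rat_boundary p (sum g A) = (\<Sum>a\<in>A. rat_boundary p (g a))"
  by (induction A rule: infinite_finite_induct) (simp_all add: rat_boundary_add)

lemma rat_chains_add: "x \<in> rat_chains p X \<Longrightarrow> y \<in> rat_chains p X \<Longrightarrow> x + y \<in> rat_chains p X"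
  using keys_add[of x y] by (auto simp: rat_chains_def)

lemma rat_chains_scale: "x \<in> rat_chains p X \<Longrightarrow> rat_scale q x \<in> rat_chains p X"
  by (auto simp: rat_chains_def in_keys_iff subset_iff)

lemma rat_chains_0: "0 \<in> rat_chains p X"
  by (simp add: rat_chains_def)

lemma rat_chains_sum: "(\<And>a. a \<in> A \<Longrightarrow> g a \<in> rat_chains p X) \<Longrightarrow> sum g A \<in> rat_chains p X"
  by (induction A rule: infinite_finite_induct) (simp_all add: rat_chains_add rat_chains_0)

lemma rat_boundaries_add: "x \<in> rat_boundaries p X \<Longrightarrow> y \<in> rat_boundaries p X
    \<Longrightarrow> x + y \<in> rat_boundaries p X"
  unfolding rat_boundaries_def by (auto simp: rat_boundary_add[symmetric] intro!: imageI
      rat_chains_add)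

lemma rat_boundaries_scale: "x \<in> rat_boundaries p X \<Longrightarrow> rat_scale q x \<in> rat_boundaries p X"
  unfolding rat_boundaries_def by (auto simp: rat_boundary_smult[symmetric] intro!: imageI
      rat_chains_scale)

lemma rat_boundaries_0: "0 \<in> rat_boundaries p X"
  unfolding rat_boundaries_def by (rule image_eqI[of _ _ 0]) (simp_all add: rat_chains_0)

lemma rat_boundaries_sum: "(\<And>a. a \<in> A \<Longrightarrow> g a \<in> rat_boundaries p X) \<Longrightarrow> sum g A \<in> rat_boundaries p X"
  by (induction A rule: infinite_finite_induct) (simp_all add: rat_boundaries_add rat_boundaries_0)

text \<open>
  A chain has finitely many coefficients, so the product of their denominators clears them all. The
  keys are kept because it is they that tell in which space a chain lives.
\<close>

lemma rat_chain_clear_denominators: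
  obtains N c where "N > 0" "rat_scale (of_int N) x = rat_of_chain c" "Poly_Mapping.keys c
      = Poly_Mapping.keys x"
proof -
  define den where "den = (\<lambda>f. snd (quotient_of (Poly_Mapping.lookup x f)))"
  define N where "N = (\<Prod>f\<in>Poly_Mapping.keys x. den f)"
  have N: "N > 0" unfolding N_def den_def by (intro prod_pos) (simp add: quotient_of_denom_pos')
  have int: "of_int N * Poly_Mapping.lookup x f \<in> \<int>" for f
  proof (cases "f \<in> Poly_Mapping.keys x")
    case True
    obtain a d where ad: "quotient_of (Poly_Mapping.lookup x f) = (a, d)" by fastforce
    then have l: "Poly_Mapping.lookup x f = of_int a / of_int d" "d > 0"
      using quotient_of_div quotient_of_denom_pos by blast+
    have "d dvd N" unfolding N_def by (rule dvd_prodI[of _ f den, THEN dvd_trans[rotated]])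
        (use True ad in \<open>auto simp: den_def\<close>)
    then obtain e where "N = d * e" by auto
    then have "of_int N * Poly_Mapping.lookup x f = of_int (e * a)" using l by simp
    then show ?thesis by (metis Ints_of_int)
  qed (auto simp: in_keys_iff)
  define c :: "'a chain" where "c = Poly_Mapping.map floor (rat_scale (of_int N) x)"
  have c: "rat_of_int (Poly_Mapping.lookup c f) = of_int N * Poly_Mapping.lookup x f" for f
    using int[of f] by (auto simp: c_def Poly_Mapping.map.rep_eq when_def elim: Ints_cases)
  have "rat_scale (of_int N) x = rat_of_chain c" by (rule poly_mapping_eqI) (simp add: c)
  moreover have "Poly_Mapping.keys c = Poly_Mapping.keys x"
    using c N by (auto simp: in_keys_iff) (metis mult_eq_0_iff of_int_0 of_int_eq_0_iff
        order_less_irrefl)+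
  ultimately show thesis using N that by blast
qed

text \<open>
  A rational cycle or bounding chain becomes integral after multiplication by some \<open>N > 0\<close>,
  and \<open>N\<close> can be divided out again afterwards. So the integral generator also generates
  rationally, and no nonzero multiple of it becomes a boundary.
\<close>

lemma rational_homology_of_circle:
  assumes "Y homeomorphic_space nsphere 1"
  obtains z where "z \<in> rat_cycles 1 Y"
    "\<And>x. x \<in> rat_cycles 1 Y \<Longrightarrow> \<exists>q. x - rat_scale q z \<in> rat_boundaries 1 Y"
    "\<And>q. rat_scale q z \<in> rat_boundaries 1 Y \<Longrightarrow> q = 0"
proof -
  obtain z where z: "singular_relcycle 1 Y {} z"
    "\<And>c. singular_relcycle 1 Y {} c \<Longrightarrow> \<exists>k. homologous_rel 1 Y {} c (frag_cmul k z)"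
    "\<And>k. singular_relboundary 1 Y {} (frag_cmul k z) \<Longrightarrow> k = 0"
    using integral_homology_of_circle[OF assms] by metis
  show thesis
  proof
    show "rat_of_chain z \<in> rat_cycles 1 Y"
      using z(1) by (simp add: rat_cycles_def rat_of_chain_mem rat_boundary_of_chain singular_cycle)
    show "\<exists>q. x - rat_scale q (rat_of_chain z) \<in> rat_boundaries 1 Y" if x: "x \<in> rat_cycles 1 Y"
        for x
    proof -
      obtain N c where N: "N > 0" and c: "rat_scale (of_int N) x = rat_of_chain c"
        and k: "Poly_Mapping.keys c = Poly_Mapping.keys x"
        by (rule rat_chain_clear_denominators)
      have "rat_of_chain (chain_boundary 1 c) = rat_of_chain 0"
        unfolding rat_boundary_of_chain[symmetric] c[symmetric]
        using x by (simp add: rat_boundary_smult rat_cycles_def)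
      then have "chain_boundary 1 c = 0" by (simp only: rat_of_chain_inject)
      then have "singular_relcycle 1 Y {} c"
        using x k by (simp add: singular_cycle rat_of_chain_inject rat_cycles_def rat_chains_def
            singular_chain_def)
      then obtain m where "singular_relboundary 1 Y {} (c - frag_cmul m z)"
        using z(2) by (auto simp: homologous_rel_def)
      then obtain d where d: "singular_chain 2 Y d" "chain_boundary 2 d = c - frag_cmul m z"
        by (auto simp: singular_boundary numeral_2_eq_2)
      have "rat_scale (1 / of_int N) (rat_of_chain (chain_boundary 2 d))
          = x - rat_scale (of_int m / of_int N) (rat_of_chain z)"
        using N by (simp add: d(2) rat_of_chain_diff rat_of_chain_cmul c[symmetric] rat_scale_diff
            rat_scale_scale rat_scale_1)
      moreover have "rat_of_chain (chain_boundary 2 d) \<in> rat_boundaries 1 Y"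
        using d(1) by (auto simp: rat_boundaries_def rat_boundary_of_chain[symmetric]
            rat_of_chain_mem numeral_2_eq_2)
      ultimately show ?thesis by (metis rat_boundaries_scale)
    qed
    show "q = 0" if q: "rat_scale q (rat_of_chain z) \<in> rat_boundaries 1 Y" for q
    proof -
      obtain u where u: "u \<in> rat_chains 2 Y" "rat_boundary 2 u = rat_scale q (rat_of_chain z)"
        using q by (auto simp: rat_boundaries_def numeral_2_eq_2)
      obtain N c where N: "N > 0" and c: "rat_scale (of_int N) u = rat_of_chain c"
        and k: "Poly_Mapping.keys c = Poly_Mapping.keys u"
        by (rule rat_chain_clear_denominators)
      obtain a d where ad: "quotient_of q = (a, d)" by fastforce
      then have l: "q = of_int a / of_int d" "d > 0"
        using quotient_of_div quotient_of_denom_pos by blast+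
      have "rat_of_chain (chain_boundary 2 (frag_cmul d c)) = rat_of_chain (frag_cmul (N * a) z)"
        using l by (simp add: rat_boundary_of_chain[symmetric] rat_of_chain_cmul c[symmetric]
            rat_boundary_smult u(2) rat_scale_scale)
      then have "chain_boundary 2 (frag_cmul d c) = frag_cmul (N * a) z"
          by (simp only: rat_of_chain_inject)
      moreover have "singular_chain 2 Y (frag_cmul d c)"
        using u(1) k by (intro singular_chain_cmul) (simp add: singular_chain_def rat_chains_def)
      ultimately have "N * a = 0" by (intro z(3)) (auto simp: singular_boundary numeral_2_eq_2)
      then show ?thesis using N l by simp
    qed
  qed
qed

text \<open>
  The part of a chain that consists of the simplices inside \<open>C\<close>. This commutes with the
  boundary operator provided that no simplex lies partly inside \<open>C\<close>, as is the case when
  \<open>C\<close> is a connected component.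
\<close>

definition restrict_chain :: "nat \<Rightarrow> 'a set \<Rightarrow> 'a rat_chain \<Rightarrow> 'a rat_chain" where
  "restrict_chain p C x = Poly_Mapping.mapp (\<lambda>f r. if f ` standard_simplex p \<subseteq> C then r else 0) x"

lemma lookup_restrict_chain [simp]:
  "Poly_Mapping.lookup (restrict_chain p C x) f =
     (if f ` standard_simplex p \<subseteq> C then Poly_Mapping.lookup x f else 0)"
  by (simp add: restrict_chain_def lookup_mapp when_def in_keys_iff)

lemma restrict_chain_add: "restrict_chain p C (x + y) = restrict_chain p C x + restrict_chain p C y"
  by (rule poly_mapping_eqI) (simp add: lookup_add)

lemma restrict_chain_0: "restrict_chain p C 0 = 0"
  by (rule poly_mapping_eqI) simp

lemma restrict_chain_sum: "restrict_chain p C (sum g A) = (\<Sum>a\<in>A. restrict_chain p C (g a))"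
  by (induction A rule: infinite_finite_induct) (simp_all add: restrict_chain_add restrict_chain_0)

lemma restrict_chain_single:
  "restrict_chain p C (Poly_Mapping.single f r)
      = (if f ` standard_simplex p \<subseteq> C then Poly_Mapping.single f r else 0)"
  by (rule poly_mapping_eqI) (auto simp: lookup_single when_def)

lemma restrict_chain_in: "x \<in> rat_chains p X \<Longrightarrow> restrict_chain p C x \<in> rat_chains p (subtopology X
    C)"
  by (auto simp: rat_chains_def in_keys_iff singular_simplex_subtopology subset_iff split:
      if_splits)

lemma rat_chains_subtopology: "x \<in> rat_chains p (subtopology X C) \<Longrightarrow> x \<in> rat_chains p X"
  by (auto simp: rat_chains_def singular_simplex_subtopology)

lemma rat_boundaries_subtopology: "x \<in> rat_boundaries p (subtopology X C) \<Longrightarrow> x \<in> rat_boundaries p X"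
  by (auto simp: rat_boundaries_def rat_chains_subtopology)

lemma rat_cycles_subtopology: "x \<in> rat_cycles p (subtopology X C) \<Longrightarrow> x \<in> rat_cycles p X"
  by (auto simp: rat_cycles_def rat_chains_subtopology)

lemma singular_simplex_in_component:
  assumes "singular_simplex p X f"
  shows "\<exists>C\<in>connected_components_of X. f ` standard_simplex p \<subseteq> C"
proof -
  have "connectedin X (f ` standard_simplex p)"
    by (rule connectedin_continuous_map_image[of "subtopology (powertop_real UNIV) (standard_simplex
        p)"])
       (use assms connectedin_standard_simplex[of p]
           in \<open>auto simp: singular_simplex_def connectedin_subtopology\<close>)
  moreover have "f ` standard_simplex p \<noteq> {}" using nonempty_standard_simplex by simp
  moreover have "topspace X \<noteq> {}" using assms singular_simplex_empty by blast
  ultimately show ?thesis using exists_connected_component_of_superset[of X "f ` standard_simplex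
      p"]
    by (metis connected_component_in_connected_components_of null_topspace_iff_trivial)
qed

lemma components_eq:
  assumes "C \<in> connected_components_of X" "C' \<in> connected_components_of X" "x \<in> C" "x \<in> C'"
  shows "C = C'"
  using assms pairwise_disjoint_connected_components_of[of X] unfolding pairwise_def disjnt_def
      by blast

text \<open>
  A simplex is connected, hence lies in the component of any of its points, in particular in that
  of any of its faces.
\<close>

lemma face_in_component_iff:
  assumes f: "singular_simplex (Suc p) X f" and k: "k \<le> Suc p"
      and C: "C \<in> connected_components_of X"
  shows "singular_face (Suc p) k f ` standard_simplex p \<subseteq> C \<longleftrightarrow> f ` standard_simplex (Suc p) \<subseteq> C"
proof -
  have sub: "singular_face (Suc p) k f ` standard_simplex p \<subseteq> f ` standard_simplex (Suc p)"
    using simplical_face_in_standard_simplex[of "Suc p" k] k by (auto simp: singular_face_def)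
  obtain C' where C': "C' \<in> connected_components_of X" "f ` standard_simplex (Suc p) \<subseteq> C'"
    using singular_simplex_in_component[OF f] by blast
  obtain x where x: "x \<in> singular_face (Suc p) k f ` standard_simplex p"
      using nonempty_standard_simplex by blast
  show ?thesis using components_eq[OF C C'(1), of x] sub C' x by blast
qed

text \<open>
  Every simplex is either kept together with all its faces or dropped together with all of them.
\<close>

lemma restrict_chain_boundary:
  assumes x: "x \<in> rat_chains (Suc p) X" and C: "C \<in> connected_components_of X"
  shows "restrict_chain p C (rat_boundary (Suc p) x)
      = rat_boundary (Suc p) (restrict_chain (Suc p) C x)"
proof -
  have k: "Poly_Mapping.keys (restrict_chain (Suc p) C x) \<subseteq> Poly_Mapping.keys x"
    by (auto simp: in_keys_iff split: if_splits)
  have B: "rat_boundary (Suc p) y = (\<Sum>f\<in>Poly_Mapping.keys x. \<Sum>k\<le>Suc p.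
      Poly_Mapping.single (singular_face (Suc p) k f) ((-1) ^ k * Poly_Mapping.lookup y f))"
    if "Poly_Mapping.keys y \<subseteq> Poly_Mapping.keys x" for y
    using rat_boundary_superset[OF finite_keys that, of "Suc p"] by (simp del: sum.atMost_Suc)
  have "restrict_chain p C (Poly_Mapping.single (singular_face (Suc p) k f) r)
      = (if f ` standard_simplex (Suc p) \<subseteq> C then Poly_Mapping.single (singular_face (Suc p) k f) r
          else 0)"
    if "f \<in> Poly_Mapping.keys x" "k \<le> Suc p" for f k r
    using face_in_component_iff[OF _ that(2) C, of f] that x
        by (auto simp: restrict_chain_single rat_chains_def)
  then show ?thesis
    unfolding B[OF order_refl] B[OF k] restrict_chain_sum by (intro sum.cong refl) simp
qed

lemma sum_restrict_chain:
  assumes x: "x \<in> rat_chains p X" and fin: "finite (connected_components_of X)"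
  shows "(\<Sum>C\<in>connected_components_of X. restrict_chain p C x) = x"
proof (rule poly_mapping_eqI)
  fix f
  show "Poly_Mapping.lookup (\<Sum>C\<in>connected_components_of X. restrict_chain p C x) f
      = Poly_Mapping.lookup x f"
  proof (cases "singular_simplex p X f")
    case True
    obtain C where C: "C \<in> connected_components_of X" "f ` standard_simplex p \<subseteq> C"
      using singular_simplex_in_component[OF True] by blast
    obtain y where y: "y \<in> f ` standard_simplex p" using nonempty_standard_simplex by blast
    have "(f ` standard_simplex p \<subseteq> C') = (C' = C)" if "C' \<in> connected_components_of X" for C'
      using components_eq[OF C(1) that, of y] y C by blast
    then have "(\<Sum>C\<in>connected_components_of X. Poly_Mapping.lookup (restrict_chain p C x) f)
      = (\<Sum>C'\<in>connected_components_of X. if C' = C then Poly_Mapping.lookup x f else 0)"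
      by (intro sum.cong) auto
    then show ?thesis using C(1) fin by (simp add: lookup_sum)
  next
    case False
    then have "Poly_Mapping.lookup x f = 0" using x by (auto simp: rat_chains_def in_keys_iff)
    then show ?thesis by (simp add: lookup_sum)
  qed
qed

lemma homology_class_eq_iff:
  "homology_class p X x = homology_class p X y \<longleftrightarrow> x - y \<in> rat_boundaries p X"
proof
  assume "homology_class p X x = homology_class p X y"
  moreover have "x \<in> homology_class p X x"
    unfolding homology_class_def by (rule image_eqI[of _ _ 0]) (simp_all add: rat_boundaries_0)
  ultimately obtain b where "b \<in> rat_boundaries p X" "x = y + b" unfolding homology_class_def
      by blast
  then show "x - y \<in> rat_boundaries p X" by simp
next
  have *: "homology_class p X x \<subseteq> homology_class p X y" if "x - y \<in> rat_boundaries p X" for x y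
  proof
    fix c assume "c \<in> homology_class p X x"
    then obtain b where b: "b \<in> rat_boundaries p X" "c = x + b" by (auto simp: homology_class_def)
    then have "c = y + ((x - y) + b)" by simp
    then show "c \<in> homology_class p X y"
      unfolding homology_class_def using rat_boundaries_add[OF that b(1)] by (rule image_eqI)
  qed
  assume a: "x - y \<in> rat_boundaries p X"
  moreover have "y - x = rat_scale (-1) (x - y)" by (rule poly_mapping_eqI) (simp add: lookup_minus)
  ultimately show "homology_class p X x = homology_class p X y"
    using * rat_boundaries_scale by (metis subset_antisym)
qed

lemma homology_class_mem: "y \<in> homology_class p X x \<longleftrightarrow> y - x \<in> rat_boundaries p X"
  unfolding homology_class_def by (auto intro: image_eqI[of _ _ "y - x"])

lemma rat_homology_add:
  "homology_class p X x \<oplus>\<^bsub>rat_homology p X\<^esub> homology_class p X y = homology_class p X (x + y)"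
proof -
  have "homology_class p X (x' + y') = homology_class p X (x + y)"
    if "x' \<in> homology_class p X x" "y' \<in> homology_class p X y" for x' y'
  proof -
    have "x' + y' - (x + y) = (x' - x) + (y' - y)" by simp
    then show ?thesis using rat_boundaries_add[of "x' - x" p X "y' - y"] that
      by (simp only: homology_class_eq_iff homology_class_mem)
  qed
  moreover have "x \<in> homology_class p X x" for x by (simp add: homology_class_mem rat_boundaries_0)
  ultimately have "(\<Union>x'\<in>homology_class p X x. \<Union>y'\<in>homology_class p X y. homology_class p X (x' +
      y')) = homology_class p X (x + y)"
    by blast
  then show ?thesis by (simp add: rat_homology_def)
qed

lemma rat_homology_smult:
  "q \<odot>\<^bsub>rat_homology p X\<^esub> homology_class p X x = homology_class p X (rat_scale q x)"
proof -
  have "homology_class p X (rat_scale q x') = homology_class p X (rat_scale q x)"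
    if "x' \<in> homology_class p X x" for x'
    using rat_boundaries_scale[of "x' - x" p X q] that
    by (simp only: homology_class_eq_iff homology_class_mem rat_scale_diff)
  moreover have "x \<in> homology_class p X x" for x by (simp add: homology_class_mem rat_boundaries_0)
  ultimately have "(\<Union>x'\<in>homology_class p X x. homology_class p X (rat_scale q x'))
      = homology_class p X (rat_scale q x)"
    by blast
  then show ?thesis by (simp add: rat_homology_def)
qed

lemma rat_cycles_scale: "x \<in> rat_cycles p X \<Longrightarrow> rat_scale q x \<in> rat_cycles p X"
  by (simp add: rat_cycles_def rat_chains_scale rat_boundary_smult)

lemma rat_cycles_sum: "(\<And>a. a \<in> A \<Longrightarrow> g a \<in> rat_cycles p X) \<Longrightarrow> sum g A \<in> rat_cycles p X"
  by (simp add: rat_cycles_def rat_chains_sum rat_boundary_sum)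

text \<open>
  Every chain is the sum of its parts in the components, and taking parts commutes with the boundary
  operator. So a combination of the generators of the circles bounds only if each of its
  terms does, and every cycle is homologous to such a combination.
\<close>

theorem rat_homology_of_circles:
  assumes fin: "finite (connected_components_of X)"
    and circ: "\<And>C. C \<in> connected_components_of X \<Longrightarrow> subtopology X C homeomorphic_space nsphere 1"
  shows "vectorspace.fin_dim class_ring (rat_homology 1 X)"
    "vectorspace.dim class_ring (rat_homology 1 X) = card (connected_components_of X)"
proof -
  let ?K = "connected_components_of X"
  have "\<forall>C\<in>?K. \<exists>z. z \<in> rat_cycles 1 (subtopology X C) \<and>
      (\<forall>x\<in>rat_cycles 1 (subtopology X C). \<exists>q. x - rat_scale q z \<in> rat_boundaries 1 (subtopology X
          C)) \<and>
      (\<forall>q. rat_scale q z \<in> rat_boundaries 1 (subtopology X C) \<longrightarrow> q = 0)"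
    using rational_homology_of_circle[OF circ] by metis
  then obtain z where z: "\<And>C. C \<in> ?K \<Longrightarrow> z C \<in> rat_cycles 1 (subtopology X C)"
     "\<And>C x. C \<in> ?K \<Longrightarrow> x \<in> rat_cycles 1 (subtopology X C)
         \<Longrightarrow> \<exists>q. x - rat_scale q (z C) \<in> rat_boundaries 1 (subtopology X C)"
     "\<And>C q. C \<in> ?K \<Longrightarrow> rat_scale q (z C) \<in> rat_boundaries 1 (subtopology X C) \<Longrightarrow> q = 0"
    by metis
  define m where "m = card ?K"
  obtain e where e: "bij_betw e {..<m} ?K" using ex_bij_betw_nat_finite[OF fin]
      by (auto simp: m_def atLeast0LessThan)
  then have eK: "e i \<in> ?K" if "i < m" for i using that by (auto simp: bij_betw_def)
  define s where "s = (\<lambda>v :: rat vec. \<Sum>i<m. rat_scale (v $ i) (z (e i)))"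
  have sZ: "s v \<in> rat_cycles 1 X" for v unfolding s_def
    by (intro rat_cycles_sum rat_cycles_scale) (rule rat_cycles_subtopology[OF z(1)[OF eK]], simp)
  have s_diff: "s u - s v = s (u - v)" if "u \<in> carrier_vec m" "v \<in> carrier_vec m" for u v
    unfolding s_def sum_subtractf[symmetric] using that
    by (intro sum.cong refl poly_mapping_eqI) (simp add: lookup_minus algebra_simps)
  have res: "restrict_chain 1 (e i) (s v) = rat_scale (v $ i) (z (e i))" if i: "i < m" for v i
  proof -
    have "restrict_chain 1 (e i) (rat_scale (v $ j) (z (e j))) = (if j
        = i then rat_scale (v $ i) (z (e i)) else 0)"
      if j: "j < m" for j
    proof (rule poly_mapping_eqI)
      fix f
      show "Poly_Mapping.lookup (restrict_chain 1 (e i) (rat_scale (v $ j) (z (e j)))) f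
         = Poly_Mapping.lookup (if j = i then rat_scale (v $ i) (z (e i)) else 0) f"
      proof (cases "Poly_Mapping.lookup (z (e j)) f = 0")
        case False
        then have "f \<in> Poly_Mapping.keys (z (e j))" by (simp add: in_keys_iff)
        then have "singular_simplex 1 (subtopology X (e j)) f"
          using z(1)[OF eK[OF j]] unfolding rat_cycles_def rat_chains_def by blast
        then have "f ` standard_simplex 1 \<subseteq> e j" unfolding singular_simplex_subtopology by blast
        moreover obtain y where y: "y \<in> f ` standard_simplex 1" using nonempty_standard_simplex
            by blast
        ultimately have "f ` standard_simplex 1 \<subseteq> e i \<longleftrightarrow> j = i"
          using components_eq[OF eK[OF i] eK[OF j], of y] e i j unfolding bij_betw_def inj_on_def
              by blast
        then show ?thesis by simp
      qed auto
    qed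
    then show ?thesis using i by (simp add: s_def restrict_chain_sum)
  qed
  have bdry: "v = 0\<^sub>v m" if v: "v \<in> carrier_vec m" and b: "s v \<in> rat_boundaries 1 X" for v
  proof (rule eq_vecI)
    fix i assume "i < dim_vec (0\<^sub>v m :: rat vec)"
    then have i: "i < m" by simp
    obtain u where u: "u \<in> rat_chains 2 X" "s v = rat_boundary 2 u" using b
        by (auto simp: rat_boundaries_def numeral_2_eq_2)
    have "rat_scale (v $ i) (z (e i)) = rat_boundary 2 (restrict_chain 2 (e i) u)"
      using restrict_chain_boundary[of u 1 X "e i"] u eK[OF i]
          by (simp add: res[OF i, symmetric] numeral_2_eq_2)
    moreover have "restrict_chain 2 (e i) u \<in> rat_chains 2 (subtopology X (e i))"
        by (rule restrict_chain_in[OF u(1)])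
    ultimately have "v $ i = 0" by (intro z(3)[OF eK[OF i]]) (auto simp: rat_boundaries_def
        numeral_2_eq_2)
    then show "v $ i = 0\<^sub>v m $ i" using i by simp
  qed (use v in auto)
  let ?T = "\<lambda>v. homology_class 1 X (s v)"
  have "bij_betw ?T (carrier_vec m) (carrier (rat_homology 1 X))"
    unfolding bij_betw_def
  proof (intro conjI)
    show "inj_on ?T (carrier_vec m)"
    proof (rule inj_onI)
      fix u v :: "rat vec" assume uv: "u \<in> carrier_vec m" "v \<in> carrier_vec m" and "?T u = ?T v"
      then have "u - v = 0\<^sub>v m" by (intro bdry) (simp_all add: homology_class_eq_iff s_diff)
      then have "u $ i - v $ i = 0" if "i < m" for i
        using that uv by (metis carrier_vecD index_minus_vec(1) index_zero_vec(1))
      then show "u = v" using uv by (intro eq_vecI) auto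
    qed
    have "\<exists>v\<in>carrier_vec m. homology_class 1 X x = ?T v" if x: "x \<in> rat_cycles 1 X" for x
    proof -
      have "\<exists>q. restrict_chain 1 C x - rat_scale q (z C) \<in> rat_boundaries 1 (subtopology X C)"
          if C: "C \<in> ?K" for C
      proof (rule z(2)[OF C])
        have "rat_boundary 1 (restrict_chain 1 C x) = restrict_chain 0 C (rat_boundary 1 x)"
          using restrict_chain_boundary[of x 0 X C] x C by (simp add: rat_cycles_def)
        then show "restrict_chain 1 C x \<in> rat_cycles 1 (subtopology X C)"
          using x by (simp add: rat_cycles_def restrict_chain_in restrict_chain_0)
      qed
      then obtain q where q: "\<And>C. C \<in> ?K \<Longrightarrow> restrict_chain 1 C x - rat_scale (q C) (z C) \<in>
          rat_boundaries 1 (subtopology X C)"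
        by metis
      have "x - s (vec m (\<lambda>i. q (e i))) = x - (\<Sum>C\<in>?K. rat_scale (q C) (z C))"
        by (simp add: s_def sum.reindex_bij_betw[OF e, of "\<lambda>C. rat_scale (q C) (z C)"])
      also have "\<dots> = (\<Sum>C\<in>?K. restrict_chain 1 C x - rat_scale (q C) (z C))"
        using sum_restrict_chain[OF _ fin, of x 1] x by (simp add: sum_subtractf rat_cycles_def)
      also have "\<dots> \<in> rat_boundaries 1 X" by (intro rat_boundaries_sum rat_boundaries_subtopology[OF
          q])
      finally show ?thesis by (intro bexI[of _ "vec m (\<lambda>i. q (e i))"]) (simp_all add:
          homology_class_eq_iff)
    qed
    then have "?T ` carrier_vec m = homology_class 1 X ` rat_cycles 1 X"
      using sZ unfolding image_def by blast
    then show "?T ` carrier_vec m = carrier (rat_homology 1 X)" by (simp add: rat_homology_def)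
  qed
  moreover have "?T (u + v) = ?T u \<oplus>\<^bsub>rat_homology 1 X\<^esub> ?T v"
      if "u \<in> carrier_vec m" "v \<in> carrier_vec m" for u v
  proof -
    have "s (u + v) = s u + s v" unfolding s_def sum.distrib[symmetric] using that
      by (intro sum.cong refl poly_mapping_eqI) (simp add: lookup_add algebra_simps)
    then show ?thesis by (simp add: rat_homology_add)
  qed
  moreover have "?T (r \<cdot>\<^sub>v v) = r \<odot>\<^bsub>rat_homology 1 X\<^esub> ?T v" if "v \<in> carrier_vec m" for r v
  proof -
    have "s (r \<cdot>\<^sub>v v) = rat_scale r (s v)" unfolding s_def map_mult_sum using that
      by (intro sum.cong refl poly_mapping_eqI) (simp add: algebra_simps)
    then show ?thesis by (simp add: rat_homology_smult)
  qed
  ultimately show "vectorspace.fin_dim class_ring (rat_homology 1 X)"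
    "vectorspace.dim class_ring (rat_homology 1 X) = card (connected_components_of X)"
    using bijective_coordinates_dim[OF vectorspace_rat_homology, of ?T m 1 X] by (auto simp: m_def)
qed

section \<open>Arcs joined end to end\<close>

lemma quotient_maps_same_fibres_homeomorphic:
  assumes f: "quotient_map X Y f" and g: "quotient_map X Z g"
    and eq: "\<And>x y. x \<in> topspace X \<Longrightarrow> y \<in> topspace X \<Longrightarrow> f x = f y \<longleftrightarrow> g x = g y"
  shows "Y homeomorphic_space Z"
proof -
  obtain h where h: "continuous_map Y Z h" "\<And>x. x \<in> topspace X \<Longrightarrow> h (f x) = g x"
    using quotient_map_lift_exists[OF f quotient_imp_continuous_map[OF g]] eq by metis
  obtain k where k: "continuous_map Z Y k" "\<And>x. x \<in> topspace X \<Longrightarrow> k (g x) = f x"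
    using quotient_map_lift_exists[OF g quotient_imp_continuous_map[OF f]] eq by metis
  have "homeomorphic_maps Y Z h k"
    unfolding homeomorphic_maps_def
    using h k quotient_imp_surjective_map[OF f, symmetric] quotient_imp_surjective_map[OF g,
        symmetric] by auto
  then show ?thesis by (auto simp: homeomorphic_space_def)
qed

lemma compact_Hausdorff_quotient_map:
  assumes "compact_space X" "Hausdorff_space Y" "continuous_map X Y f" "f ` topspace X = topspace Y"
  shows "quotient_map X Y f"
  using assms by (intro continuous_closed_imp_quotient_map continuous_imp_closed_map_gen)
     (auto simp: Hausdorff_imp_kc_space)

lemma cos_sin_eq_iff:
  fixes a b :: real
  assumes "0 \<le> a" "a \<le> 2 * pi" "0 \<le> b" "b \<le> 2 * pi"
  shows "cos a = cos b \<and> sin a = sin b \<longleftrightarrow> a = b \<or> a = 0 \<and> b = 2 * pi \<or> a = 2 * pi \<and> b = 0"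
proof
  assume "cos a = cos b \<and> sin a = sin b"
  then obtain n :: int where n: "a = b + 2 * pi * n" by (metis sin_cos_eq_iff)
  then have "pi * of_int n \<le> pi * 1" "pi * (- 1) \<le> pi * of_int n" using assms by linarith+
  then have "real_of_int n \<le> 1" "- 1 \<le> real_of_int n"
    using mult_le_cancel_left_pos[OF pi_gt_zero] by blast+
  then have "n = -1 \<or> n = 0 \<or> n = 1" by arith
  then show "a = b \<or> a = 0 \<and> b = 2 * pi \<or> a = 2 * pi \<and> b = 0" using n assms by auto
qed auto

lemma Hausdorff_nsphere: "Hausdorff_space (nsphere n)"
  unfolding nsphere_def by (intro Hausdorff_space_subtopology Hausdorff_Euclidean_space)

text \<open>
  Wrapping an interval once around the circle identifies its two end points and nothing else.
\<close>

lemma quotient_map_interval_circle: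
  fixes k :: real
  assumes k: "k > 0"
  defines "q \<equiv> \<lambda>t i. if i = 0 then cos (2 * pi * t / k) else if i
      = Suc 0 then sin (2 * pi * t / k) else 0"
  shows "quotient_map (top_of_set {0..k}) (nsphere 1) q"
    "\<And>s t. s \<in> {0..k} \<Longrightarrow> t \<in> {0..k} \<Longrightarrow> q s = q t \<longleftrightarrow> s = t \<or> s = 0 \<and> t = k \<or> s = k \<and> t = 0"
proof -
  have cont: "continuous_map (top_of_set {0..k}) (nsphere 1) q"
    unfolding nsphere continuous_map_in_subtopology continuous_map_componentwise_UNIV
  proof (intro conjI allI)
    fix i show "continuous_map (top_of_set {0..k}) euclideanreal (\<lambda>t. q t i)"
      using k unfolding q_def by (cases "i = 0"; cases "i = Suc 0") (auto intro!: continuous_intros)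
  qed (auto simp: q_def)
  have surj: "x \<in> q ` {0..k}" if x: "x \<in> topspace (nsphere 1)" for x
  proof -
    have "(x 0)\<^sup>2 + (x (Suc 0))\<^sup>2 = 1" and z: "\<And>i. i > 1 \<Longrightarrow> x i = 0" using x by (auto simp: nsphere)
    then obtain t where t: "0 \<le> t" "t \<le> 2 * pi" "x 0 = cos t" "x (Suc 0) = sin t"
      using sincos_total_2pi_le[of "x 0" "x (Suc 0)"] by auto
    show ?thesis
      by (rule image_eqI[of _ _ "k * t / (2 * pi)"])
        (use t k z in \<open>auto simp: q_def fun_eq_iff divide_simps\<close>)
  qed
  show "quotient_map (top_of_set {0..k}) (nsphere 1) q"
  proof (rule compact_Hausdorff_quotient_map[OF _ _ cont])
    show "q ` topspace (top_of_set {0..k}) = topspace (nsphere 1)"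
      using surj continuous_map_image_subset_topspace[OF cont] by auto
  qed (auto simp: compact_space_subtopology Hausdorff_nsphere)
  fix s t assume st: "s \<in> {0..k}" "t \<in> {0..k}"
  have "q s = q t \<longleftrightarrow> cos (2 * pi * s / k) = cos (2 * pi * t / k) \<and> sin (2 * pi * s / k)
      = sin (2 * pi * t / k)"
    unfolding q_def fun_eq_iff by (auto split: if_splits dest: spec[of _ 0] spec[of _ "Suc 0"])
  also have "\<dots> \<longleftrightarrow> s = t \<or> s = 0 \<and> t = k \<or> s = k \<and> t = 0"
    by (subst cos_sin_eq_iff) (use st k in \<open>auto simp: divide_simps mult_le_cancel_left\<close>)
  finally show "q s = q t \<longleftrightarrow> s = t \<or> s = 0 \<and> t = k \<or> s = k \<and> t = 0" .
qed

text \<open>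
  A space cut into finitely many arcs, where each arc \<open>i\<close> ends at the starting point of the arc
  \<open>\<pi> i\<close>. The half-open arcs, without their end points, partition the space. Following
  \<open>\<pi>\<close> runs around circles, one for each cycle of the permutation.
\<close>

locale closed_chain_of_arcs =
  fixes X :: "'a topology" and I :: "'i set" and \<pi> :: "'i \<Rightarrow> 'i" and \<gamma> :: "'i \<Rightarrow> real \<Rightarrow> 'a"
  assumes Hausdorff: "Hausdorff_space X" and fin: "finite I"
    and perm: "bij_betw \<pi> I I"
    and cont: "\<And>i. i \<in> I \<Longrightarrow> continuous_map (top_of_set {0..1}) X (\<gamma> i)"
    and join: "\<And>i. i \<in> I \<Longrightarrow> \<gamma> i 1 = \<gamma> (\<pi> i) 0"
    and inj: "\<And>i j s t. i \<in> I \<Longrightarrow> j \<in> I \<Longrightarrow> s \<in> {0..<1} \<Longrightarrow> t \<in> {0..<1} \<Longrightarrow> \<gamma> i s = \<gamma> j t \<Longrightarrow> i = j \<and> s = t"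
    and cover: "\<And>x. x \<in> topspace X \<Longrightarrow> \<exists>i\<in>I. \<exists>t\<in>{0..<1}. x = \<gamma> i t"
begin

definition cycle :: "'i \<Rightarrow> 'a set" where
  "cycle i = (\<Union>n. \<gamma> ((\<pi> ^^ n) i) ` {0..<1})"

lemma iter_in: "i \<in> I \<Longrightarrow> (\<pi> ^^ n) i \<in> I"
  by (induction n) (use perm in \<open>auto simp: bij_betw_def\<close>)

lemma iter_inj: "i \<in> I \<Longrightarrow> j \<in> I \<Longrightarrow> (\<pi> ^^ n) i = (\<pi> ^^ n) j \<Longrightarrow> i = j"
proof (induction n)
  case (Suc n)
  then show ?case using perm iter_in by (auto simp: bij_betw_def inj_on_def)
qed auto

lemma ex_period:
  assumes "i \<in> I" shows "\<exists>n>0. (\<pi> ^^ n) i = i"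
proof -
  have "\<not> inj (\<lambda>n. (\<pi> ^^ n) i)"
    using finite_subset[OF _ fin, of "range (\<lambda>n. (\<pi> ^^ n) i)"] iter_in[OF assms]
    by (meson finite_imageD image_subsetI infinite_UNIV_nat)
  then obtain a b where ab: "(\<pi> ^^ a) i = (\<pi> ^^ b) i" "a < b"
    unfolding inj_def by (metis linorder_neqE_nat)
  then have "(\<pi> ^^ a) ((\<pi> ^^ (b - a)) i) = (\<pi> ^^ a) i"
      by (simp flip: funpow_add[unfolded o_def fun_eq_iff, rule_format])
  then have "(\<pi> ^^ (b - a)) i = i" using iter_inj iter_in assms by blast
  then show ?thesis using ab(2) by (intro exI[of _ "b - a"]) auto
qed

definition period :: "'i \<Rightarrow> nat" where "period i = (LEAST n. n > 0 \<and> (\<pi> ^^ n) i = i)"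

lemma period: assumes "i \<in> I" shows "period i > 0" "(\<pi> ^^ period i) i = i"
  using LeastI_ex[OF ex_period[OF assms]] by (auto simp: period_def)

lemma iter_inj_less_period:
  assumes i: "i \<in> I" and ab: "a < period i" "b < period i" and eq: "(\<pi> ^^ a) i = (\<pi> ^^ b) i"
  shows "a = b"
proof -
  have False if "a < b" "b < period i" "(\<pi> ^^ a) i = (\<pi> ^^ b) i" for a b
  proof -
    have "(\<pi> ^^ a) ((\<pi> ^^ (b - a)) i) = (\<pi> ^^ a) i"
      using that by (simp flip: funpow_add[unfolded o_def fun_eq_iff, rule_format])
    then have "(\<pi> ^^ (b - a)) i = i" using iter_inj iter_in i by blast
    then have "period i \<le> b - a" unfolding period_def using that(1) by (intro Least_le) auto
    then show False using that by simp
  qed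
  then show ?thesis using ab eq by (metis linorder_neqE_nat)
qed

lemma iter_mod_period:
  assumes "i \<in> I" shows "(\<pi> ^^ (n mod period i)) i = (\<pi> ^^ n) i"
  using funpow_mod_eq[OF period(2)[OF assms]] .

text \<open>
  The arcs of a cycle of \<open>\<pi>\<close>, traversed one after the other in unit time each.
\<close>

definition loop :: "'i \<Rightarrow> real \<Rightarrow> 'a" where
  "loop i t = \<gamma> ((\<pi> ^^ nat \<lfloor>t\<rfloor>) i) (frac t)"

text \<open>
  On a closed unit interval a single arc describes the loop: at the right end the formula switches
  to the next arc, but the two arcs meet there.
\<close>

lemma loop_on_piece:
  assumes i: "i \<in> I" and t: "t \<in> {real j..real j + 1}"
  shows "loop i t = \<gamma> ((\<pi> ^^ j) i) (t - real j)"
proof (cases "t = real j + 1")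
  case True
  then have "nat \<lfloor>t\<rfloor> = Suc j" "frac t = 0" by (auto simp: frac_def nat_add_distrib)
  moreover have "t - real j = 1" using True by simp
  ultimately show ?thesis using join[OF iter_in[OF i, of j]]
      by (simp only: loop_def funpow.simps o_apply)
next
  case False
  then have "\<lfloor>t\<rfloor> = int j" using t by (intro floor_unique) auto
  then show ?thesis by (simp add: loop_def frac_def)
qed

lemma continuous_loop:
  assumes i: "i \<in> I"
  shows "continuous_map (top_of_set {0..real (period i)}) X (loop i)"
proof (rule pasting_lemma_closed[where I = "{..<period i}" and T = "\<lambda>j. {real j..real j + 1}" and f
    = "\<lambda>_. loop i"])
  fix j assume j: "j \<in> {..<period i}"
  then have sub: "{real j..real j + 1} \<subseteq> {0..real (period i)}" by auto
  show "closedin (top_of_set {0..real (period i)}) {real j..real j + 1}"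
    using sub by (intro closed_subset) auto
  have "continuous_map (top_of_set {real j..real j + 1}) (top_of_set {0..1}) (\<lambda>t. t - real j)"
    by (auto simp: continuous_map_in_subtopology intro!: continuous_intros)
  then have "continuous_map (top_of_set {real j..real j + 1}) X (\<gamma> ((\<pi> ^^ j) i) \<circ> (\<lambda>t. t - real j))"
    using cont[OF iter_in[OF i]] by (rule continuous_map_compose)
  then have "continuous_map (top_of_set {real j..real j + 1}) X (loop i)"
    by (rule continuous_map_eq) (simp add: loop_on_piece[OF i])
  then show "continuous_map (subtopology (top_of_set {0..real (period i)}) {real j..real j + 1}) X
      (loop i)"
    using sub by (simp add: subtopology_subtopology Int_absorb1)
next
  fix t assume t: "t \<in> topspace (top_of_set {0..real (period i)})"
  show "\<exists>j. j \<in> {..<period i} \<and> t \<in> {real j..real j + 1} \<and> loop i t = loop i t"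
  proof (cases "t = period i")
    case True
    then show ?thesis using period(1)[OF i] by (intro exI[of _ "period i - 1"]) (auto simp:
        of_nat_diff)
  next
    case False
    then have "0 \<le> t" "t < real (period i)" using t by auto
    then have "nat \<lfloor>t\<rfloor> < period i" "real (nat \<lfloor>t\<rfloor>) \<le> t" "t \<le> real (nat \<lfloor>t\<rfloor>) + 1"
      by (simp_all add: floor_less_iff nat_less_iff)
    then show ?thesis by (intro exI[of _ "nat \<lfloor>t\<rfloor>"]) auto
  qed
qed auto

lemma loop_eq_iff:
  assumes i: "i \<in> I" and st: "s \<in> {0..real (period i)}" "t \<in> {0..real (period i)}"
  shows "loop i s = loop i t \<longleftrightarrow> s = t \<or> s = 0 \<and> t = period i \<or> s = period i \<and> t = 0"
proof -
  have per: "loop i (real (period i)) = loop i 0" by (simp add: loop_def frac_def period(2)[OF i])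
  have inj: "s = t" if "loop i s = loop i t" "0 \<le> s" "s < period i" "0 \<le> t" "t < period i" for s t
  proof -
    have "(\<pi> ^^ nat \<lfloor>s\<rfloor>) i = (\<pi> ^^ nat \<lfloor>t\<rfloor>) i \<and> frac s = frac t"
      using that unfolding loop_def by (intro inj iter_in i) (auto simp: frac_lt_1)
    then have "nat \<lfloor>s\<rfloor> = nat \<lfloor>t\<rfloor>" "frac s = frac t"
      using iter_inj_less_period[OF i, of "nat \<lfloor>s\<rfloor>" "nat \<lfloor>t\<rfloor>"] that
          by (auto simp: floor_less_iff nat_less_iff)
    then show ?thesis using that unfolding frac_def
      by (metis add_diff_cancel_right' diff_add_cancel eq_nat_nat_iff zero_le_floor)
  qed
  have p: "0 < real (period i)" using period(1)[OF i] by simp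
  show ?thesis
  proof (cases "s = period i \<or> t = period i")
    case True
    then show ?thesis using inj[of s 0] inj[of 0 t] per st p by fastforce
  next
    case False
    then show ?thesis using inj[of s t] st by auto
  qed
qed

lemma loop_image:
  assumes i: "i \<in> I" shows "loop i ` {0..real (period i)} = cycle i"
proof
  show "loop i ` {0..real (period i)} \<subseteq> cycle i"
    unfolding loop_def cycle_def using frac_lt_1 frac_ge_0 by fastforce
  show "cycle i \<subseteq> loop i ` {0..real (period i)}"
  proof
    fix x assume "x \<in> cycle i"
    then obtain n t where x: "x = \<gamma> ((\<pi> ^^ n) i) t" "0 \<le> t" "t < 1" unfolding cycle_def by auto
    define m where "m = n mod period i"
    have m: "m < period i" unfolding m_def using period(1)[OF i] by simp
    have "x = loop i (real m + t)"
      using loop_on_piece[OF i, of "real m + t" m] x iter_mod_period[OF i, of n]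
          by (simp add: m_def)
    moreover have "real m + 1 \<le> real (period i)" using m by linarith
    ultimately show "x \<in> loop i ` {0..real (period i)}" using x
        by (intro image_eqI[of _ _ "real m + t"]) auto
  qed
qed

lemma cycle_subset: "i \<in> I \<Longrightarrow> cycle i \<subseteq> topspace X"
  using loop_image continuous_map_image_subset_topspace[OF continuous_loop] by fastforce

text \<open>
  The cycle, by the loop, and the standard circle, by wrapping, are quotients of the same interval,
  and both maps identify just its two ends.
\<close>

lemma cycle_homeomorphic_circle:
  assumes i: "i \<in> I" shows "subtopology X (cycle i) homeomorphic_space nsphere 1"
proof -
  have p: "0 < real (period i)" using period(1)[OF i] by simp
  have "quotient_map (top_of_set {0..real (period i)}) (subtopology X (cycle i)) (loop i)"
    by (rule compact_Hausdorff_quotient_map)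
      (use loop_image[OF i] cycle_subset[OF i] continuous_loop[OF i] Hausdorff in
        \<open>auto simp: compact_space_subtopology Hausdorff_space_subtopology
            continuous_map_in_subtopology\<close>)
  from quotient_maps_same_fibres_homeomorphic[OF this quotient_map_interval_circle(1)[OF p]]
  show ?thesis using loop_eq_iff[OF i] quotient_map_interval_circle(2)[OF p] by simp
qed

lemma cycle_step: assumes i: "i \<in> I" shows "cycle (\<pi> i) = cycle i"
proof -
  have 1: "(\<pi> ^^ n) (\<pi> i) = (\<pi> ^^ Suc n) i" for n by (simp add: funpow_swap1)
  have 2: "(\<pi> ^^ n) i = (\<pi> ^^ (n + period i - 1)) (\<pi> i)" for n
  proof -
    have "(\<pi> ^^ (n + period i - 1)) (\<pi> i) = (\<pi> ^^ (n + period i)) i"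
      unfolding 1 using period(1)[OF i] by simp
    then show ?thesis using period(2)[OF i] by (simp add: funpow_add)
  qed
  have "range (\<lambda>n. (\<pi> ^^ n) (\<pi> i)) = range (\<lambda>n. (\<pi> ^^ n) i)"
  proof
    show "range (\<lambda>n. (\<pi> ^^ n) (\<pi> i)) \<subseteq> range (\<lambda>n. (\<pi> ^^ n) i)" unfolding 1 by blast
    show "range (\<lambda>n. (\<pi> ^^ n) i) \<subseteq> range (\<lambda>n. (\<pi> ^^ n) (\<pi> i))" by (subst 2) blast
  qed
  moreover have "cycle i = (\<Union>j\<in>range (\<lambda>n. (\<pi> ^^ n) i). \<gamma> j ` {0..<1})" for i
    by (simp add: cycle_def)
  ultimately show ?thesis by (simp only:)
qed

lemma cycle_iter: assumes i: "i \<in> I" shows "cycle ((\<pi> ^^ n) i) = cycle i"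
  by (induction n) (use cycle_step iter_in[OF i] in auto)

lemma cycles_overlap:
  assumes ij: "i \<in> I" "j \<in> I" and x: "x \<in> cycle i" "x \<in> cycle j"
  obtains m n where "(\<pi> ^^ m) i = (\<pi> ^^ n) j"
proof -
  obtain m s where "x = \<gamma> ((\<pi> ^^ m) i) s" "s \<in> {0..<1}" using x(1) unfolding cycle_def by auto
  moreover obtain n t where "x = \<gamma> ((\<pi> ^^ n) j) t" "t \<in> {0..<1}" using x(2) unfolding cycle_def
      by auto
  ultimately have "(\<pi> ^^ m) i = (\<pi> ^^ n) j" using inj[of "(\<pi> ^^ m) i" "(\<pi> ^^ n) j"] ij iter_in
      by auto
  then show thesis by (rule that)
qed

lemma cycles_disjoint:
  assumes "i \<in> I" "j \<in> I" "x \<in> cycle i" "x \<in> cycle j" shows "cycle i = cycle j"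
  using cycles_overlap[OF assms] cycle_iter assms by metis

lemma cycle_nonempty: "i \<in> I \<Longrightarrow> \<gamma> i 0 \<in> cycle i"
  unfolding cycle_def by (auto intro!: exI[of _ 0])

text \<open>
  Arcs lie in the same cycle only if they are iterates of each other, so a function of arcs that is
  invariant under \<open>\<pi>\<close> is a function of cycles.
\<close>

lemma invariant_cycle:
  assumes f: "\<And>i. i \<in> I \<Longrightarrow> f (\<pi> i) = f i" and ij: "i \<in> I" "j \<in> I" and eq: "cycle i = cycle j"
  shows "f i = f j"
proof -
  have iter: "f ((\<pi> ^^ n) i) = f i" if "i \<in> I" for n i by (induction n)
      (use f iter_in[OF that] in auto)
  obtain m n where "(\<pi> ^^ m) i = (\<pi> ^^ n) j"
    using cycles_overlap[OF ij, of "\<gamma> i 0"] cycle_nonempty[OF ij(1)] eq by auto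
  then show ?thesis using iter ij by metis
qed

lemma topspace_cycles: "topspace X = (\<Union>i\<in>I. cycle i)"
proof -
  have "x \<in> (\<Union>i\<in>I. cycle i)" if x: "x \<in> topspace X" for x
  proof -
    obtain i t where "i \<in> I" "t \<in> {0..<1}" "x = \<gamma> i t" using cover[OF x] by blast
    then show ?thesis unfolding cycle_def by (auto intro!: bexI[of _ i] exI[of _ 0])
  qed
  then show ?thesis using cycle_subset by blast
qed

lemma closedin_cycle: "i \<in> I \<Longrightarrow> closedin X (cycle i)"
  using image_compactin[OF _ continuous_loop, of i "{0..real (period i)}"] loop_image[of i]
      Hausdorff
  by (auto simp: compactin_subtopology intro!: compactin_imp_closedin)

text \<open>
  The complement is the union of the finitely many other cycles, which are closed.
\<close>

lemma openin_cycle: assumes i: "i \<in> I" shows "openin X (cycle i)"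
proof -
  have "topspace X - cycle i = (\<Union>j\<in>{j \<in> I. cycle j \<noteq> cycle i}. cycle j)"
    using cycles_disjoint[OF _ i] by (auto simp: topspace_cycles)
  moreover have "closedin X (\<Union>j\<in>{j \<in> I. cycle j \<noteq> cycle i}. cycle j)"
    by (rule closedin_Union) (use fin closedin_cycle in auto)
  ultimately show ?thesis using cycle_subset[OF i] by (simp add: openin_closedin)
qed

lemma connectedin_cycle: "i \<in> I \<Longrightarrow> connectedin X (cycle i)"
  using connectedin_continuous_map_image[OF continuous_loop, of i "{0..real (period i)}"]
      loop_image[of i]
  by (auto simp: connectedin_subtopology)

lemma connected_component_eq_cycle:
  assumes i: "i \<in> I" and x: "x \<in> cycle i"
  shows "connected_component_of_set X x = cycle i"
proof
  show "cycle i \<subseteq> connected_component_of_set X x"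
    by (rule connected_component_of_maximal[OF connectedin_cycle[OF i] x])
  have "x \<in> connected_component_of_set X x"
    using x cycle_subset[OF i] by (auto simp: connected_component_of_refl)
  then show "connected_component_of_set X x \<subseteq> cycle i"
    using connectedin_clopen_cases[OF connectedin_connected_component_of closedin_cycle[OF i]
        openin_cycle[OF i], of x] x
    by (auto simp: disjnt_iff)
qed

text \<open>
  Cycles are connected, open and closed.
\<close>

theorem connected_components_eq_cycles: "connected_components_of X = cycle ` I"
proof -
  have "connected_components_of X = (\<lambda>x. connected_component_of_set X x) ` topspace X"
    by (simp add: connected_components_of_def)
  also have "\<dots> = cycle ` I"
    using connected_component_eq_cycle cycle_nonempty unfolding topspace_cycles
        by (auto simp: image_iff) blast+
  finally show ?thesis .
qed

end

section \<open>Recognizing the boundary of a surface\<close>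

text \<open>
  If the chart \<open>\<phi>\<close> covers a disk around \<open>\<phi> x\<close>, that disk is a planar neighbourhood
  of \<open>x\<close>. Conversely, a planar neighbourhood of \<open>x\<close> is mapped by \<open>\<phi>\<close> injectively and
  continuously into the plane, so by invariance of domain its image is open and \<open>\<phi> x\<close> is an
  interior point of the image of the chart.
\<close>

lemma surface_boundary_iff_chart:
  fixes \<phi> :: "'a \<Rightarrow> complex"
  assumes V: "openin X V" and x: "x \<in> V"
    and \<phi>: "homeomorphic_map (subtopology X V) (top_of_set (\<phi> ` V)) \<phi>"
  shows "x \<in> topspace (surface_boundary X) \<longleftrightarrow> \<phi> x \<notin> interior (\<phi> ` V)"
proof -
  have VX: "V \<subseteq> topspace X" using V by (rule openin_subset)
  have cont: "continuous_map (subtopology X V) euclidean \<phi>" and inj: "inj_on \<phi> V"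
    using \<phi> VX homeomorphic_imp_injective_map[OF \<phi>] homeomorphic_imp_continuous_map[OF \<phi>]
    by (auto simp: continuous_map_in_subtopology Int_absorb1 inj_on_def)
  have "(\<exists>U. openin X U \<and> x \<in> U \<and> subtopology X U homeomorphic_space (euclidean :: complex
      topology))
    \<longleftrightarrow> \<phi> x \<in> interior (\<phi> ` V)" (is "?L \<longleftrightarrow> ?R")
  proof
    assume ?R
    then obtain e where e: "e > 0" "ball (\<phi> x) e \<subseteq> \<phi> ` V" using mem_interior by blast
    define U where "U = {y \<in> V. \<phi> y \<in> ball (\<phi> x) e}"
    have "openin (subtopology X V) {y \<in> topspace (subtopology X V). \<phi> y \<in> ball (\<phi> x) e}"
      by (rule openin_continuous_map_preimage[OF cont]) auto
    moreover have "{y \<in> topspace (subtopology X V). \<phi> y \<in> ball (\<phi> x) e} = U" using VX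
        by (auto simp: U_def)
    ultimately have U: "openin X U" using openin_trans_full V by metis
    have im: "\<phi> ` U = ball (\<phi> x) e" using e(2) by (auto simp: U_def)
    have "homeomorphic_map (subtopology (subtopology X V) U) (subtopology (top_of_set (\<phi> ` V)) (ball
        (\<phi> x) e)) \<phi>"
      by (rule homeomorphic_map_subtopologies[OF \<phi>]) (use im VX e(2) in \<open>auto simp: U_def\<close>)
    moreover have "V \<inter> U = U" "\<phi> ` V \<inter> ball (\<phi> x) e = ball (\<phi> x) e" using e(2) by (auto simp: U_def)
    ultimately have "homeomorphic_map (subtopology X U) (top_of_set (ball (\<phi> x) e)) \<phi>"
      by (simp add: subtopology_subtopology)
    then have 1: "subtopology X U homeomorphic_space top_of_set (ball (\<phi> x) e)"
        by (rule homeomorphic_map_imp_homeomorphic_space)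
    have "ball (\<phi> x) e homeomorphic ball (0 :: complex) 1" by (rule homeomorphic_balls(1))
        (use e in auto)
    then have "ball (\<phi> x) e homeomorphic (UNIV :: complex set)"
      using homeomorphic_trans homeomorphic_ball01_UNIV by blast
    then obtain f g where fg: "homeomorphism (ball (\<phi> x) e) (UNIV :: complex set) f g"
      by (auto simp: homeomorphic_def)
    then have "g z \<in> ball (\<phi> x) e" for z unfolding homeomorphism_def by blast
    then have "homeomorphic_maps (top_of_set (ball (\<phi> x) e)) euclidean f g"
      using fg by (auto simp: homeomorphic_maps_def homeomorphism_def continuous_map_in_subtopology)
    then have "top_of_set (ball (\<phi> x) e) homeomorphic_space (euclidean :: complex topology)"
      by (auto simp: homeomorphic_space_def)
    with 1 have "subtopology X U homeomorphic_space (euclidean :: complex topology)"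
      by (rule homeomorphic_space_trans)
    then show ?L using U e(1) x by (intro exI[of _ U]) (auto simp: U_def)
  next
    assume ?L
    then obtain U where U: "openin X U" "x \<in> U"
        and hom: "subtopology X U homeomorphic_space (euclidean :: complex topology)" by blast
    then obtain h k where hk: "homeomorphic_maps (subtopology X U) (euclidean :: complex topology) h
        k" by (auto simp: homeomorphic_space_def)
    have UX: "U \<subseteq> topspace X" using U(1) by (rule openin_subset)
    have h: "homeomorphic_map (subtopology X U) euclidean h"
        and k: "continuous_map euclidean (subtopology X U) k"
      and kh: "\<And>y. y \<in> U \<Longrightarrow> k (h y) = y" and inj_k: "inj k"
      using hk UX homeomorphic_maps_map[of "subtopology X U" euclidean h k]
      by (auto simp: homeomorphic_maps_def Int_absorb1 inj_def) metis
    define W where "W = h ` (U \<inter> V)"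
    have "openin (subtopology X U) (U \<inter> V)" using V by (simp add: openin_subtopology_Int2)
    then have W: "open W" unfolding W_def
      using homeomorphic_imp_open_map[OF h] by (auto simp: open_map_def)
    have kW: "k ` W = U \<inter> V" using kh by (force simp: W_def)
    have "continuous_map (top_of_set W) (subtopology X V) k"
      using continuous_map_from_subtopology[OF k, of W] kW
          by (auto simp: continuous_map_in_subtopology)
    then have "continuous_map (top_of_set W) euclidean (\<phi> \<circ> k)" using cont
        by (rule continuous_map_compose)
    then have "continuous_on W (\<phi> \<circ> k)" by simp
    moreover have "inj_on (\<phi> \<circ> k) W"
      by (rule comp_inj_on) (use inj_k kW inj in \<open>auto intro: inj_on_subset\<close>)
    ultimately have "open ((\<phi> \<circ> k) ` W)" using W by (intro invariance_of_domain)
    moreover have "(\<phi> \<circ> k) ` W = \<phi> ` (U \<inter> V)" by (simp add: kW image_image[of \<phi> k, symmetric])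
    ultimately show ?R using x U(2) by (intro interiorI[of "\<phi> ` (U \<inter> V)"]) auto
  qed
  then show ?thesis using x VX by (auto simp: surface_boundary_def)
qed

text \<open>
  On a compact space a chart can be described by a map \<open>\<phi>\<close> that is defined everywhere, together
  with a height \<open>h\<close> below which it is injective: injectivity on the closed sublevel set, which
  is compact, makes \<open>\<phi>\<close> an embedding there, and so on the open sublevel set.
\<close>

lemma surface_boundary_iff_injective_below:
  fixes \<phi> :: "'a \<Rightarrow> complex" and h :: "'a \<Rightarrow> real"
  assumes X: "compact_space X" and \<phi>: "continuous_map X euclidean \<phi>"
      and h: "continuous_map X euclideanreal h"
    and inj: "inj_on \<phi> {x \<in> topspace X. h x \<le> r}"
    and x: "x \<in> topspace X" "h x < r"
  shows "x \<in> topspace (surface_boundary X) \<longleftrightarrow> \<phi> x \<notin> interior (\<phi> ` {x \<in> topspace X. h x < r})"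
proof (rule surface_boundary_iff_chart)
  let ?K = "{x \<in> topspace X. h x \<le> r}" and ?V = "{x \<in> topspace X. h x < r}"
  show "openin X ?V"
    using openin_continuous_map_preimage[OF h, of "{..<r}"] by simp
  have "closedin X ?K"
    using closedin_continuous_map_preimage[OF h, of "{..r}"] by simp
  then have "compact_space (subtopology X ?K)"
    using X closedin_compact_space compact_space_subtopology by blast
  then have "homeomorphic_map (subtopology X ?K) (top_of_set (\<phi> ` ?K)) \<phi>"
    by (intro continuous_imp_homeomorphic_map)
       (use \<phi> inj in \<open>auto simp: continuous_map_in_subtopology Hausdorff_space_subtopology
          intro!: continuous_map_from_subtopology elim: inj_on_subset\<close>)
  then have "homeomorphic_map (subtopology (subtopology X ?K) ?V) (subtopology (top_of_set (\<phi> ` ?K))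
      (\<phi> ` ?V)) \<phi>"
    by (rule homeomorphic_map_subtopologies) auto
  moreover have "?K \<inter> ?V = ?V" "\<phi> ` ?K \<inter> \<phi> ` ?V = \<phi> ` ?V" by auto
  ultimately show "homeomorphic_map (subtopology X ?V) (top_of_set (\<phi> ` ?V)) \<phi>"
    by (simp add: subtopology_subtopology)
qed (use x in auto)

section \<open>The disk with untwisted bands\<close>

lemma continuous_map_from_sum_topology:
  assumes "\<And>i. i \<in> I \<Longrightarrow> continuous_map (X i) Y (\<lambda>x. f (i, x))"
  shows "continuous_map (sum_topology X I) Y f"
  unfolding continuous_map_def
proof (intro conjI allI impI)
  show "f \<in> topspace (sum_topology X I) \<rightarrow> topspace Y"
    using assms by (auto simp: continuous_map_def Pi_iff)
  fix U assume U: "openin Y U"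
  have "{x. (i, x) \<in> {z \<in> topspace (sum_topology X I). f z \<in> U}}
      = {x \<in> topspace (X i). f (i, x) \<in> U}"
    if "i \<in> I" for i using that by auto
  then show "openin (sum_topology X I) {z \<in> topspace (sum_topology X I). f z \<in> U}"
    using assms U by (auto simp: openin_sum_topology continuous_map_def)
qed

lemma compact_space_sum_topology:
  assumes "finite I" "\<And>i. i \<in> I \<Longrightarrow> compact_space (X i)"
  shows "compact_space (sum_topology X I)"
proof -
  have "compactin (sum_topology X I) (Pair i ` topspace (X i))" if "i \<in> I" for i
    by (rule image_compactin[OF _ continuous_map_component_injection[OF that]])
       (use assms(2)[OF that] in \<open>simp add: compact_space_def\<close>)
  then have "compactin (sum_topology X I) (\<Union>i\<in>I. Pair i ` topspace (X i))"
    by (intro compactin_Union) (use assms(1) in auto)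
  moreover have "(\<Union>i\<in>I. Pair i ` topspace (X i)) = topspace (sum_topology X I)" by auto
  ultimately show ?thesis by (simp add: compact_space_def)
qed

locale band_diagram =
  fixes b :: complex and B :: "complex set set" and w :: real
  assumes diagram: "chord_diagram b B" and width: "admissible_width B w"
begin

abbreviation first :: "complex set \<Rightarrow> complex" where "first \<equiv> first_end b"
abbreviation last :: "complex set \<Rightarrow> complex" where "last \<equiv> last_end b"
abbreviation angle :: "complex \<Rightarrow> real" where "angle \<equiv> angle_from b"

lemma norm_b: "norm b = 1" and finite_B: "finite B"
  using diagram by (auto simp: chord_diagram_def)

lemma b_nonzero: "b \<noteq> 0" using norm_b by auto

lemma norm_endpoint: "p \<in> \<Union>B \<Longrightarrow> norm p = 1"
  using diagram by (fastforce simp: chord_diagram_def)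

lemma finite_endpoints: "finite (\<Union>B)"
proof -
  have "finite c" if "c \<in> B" for c
    using diagram that by (intro card_ge_0_finite) (simp add: chord_diagram_def)
  then show ?thesis using finite_B by blast
qed

lemma angle_range: "0 \<le> angle z" "angle z < 2 * pi"
  by (auto simp: angle_from_def Arg2pi)

lemma eq_cis_angle: "norm z = 1 \<Longrightarrow> z = b * cis (angle z)"
  using Arg2pi_eq[of "z / b"] norm_b b_nonzero
  by (simp add: angle_from_def cis_conv_exp norm_divide field_simps)

lemma angle_inj: "norm z = 1 \<Longrightarrow> norm z' = 1 \<Longrightarrow> angle z = angle z' \<Longrightarrow> z = z'"
  using eq_cis_angle by metis

lemma chord_disjoint: "c \<in> B \<Longrightarrow> d \<in> B \<Longrightarrow> p \<in> c \<Longrightarrow> p \<in> d \<Longrightarrow> c = d"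
  using diagram unfolding chord_diagram_def pairwise_def disjnt_def by blast

lemma chord_ends:
  assumes c: "c \<in> B"
  shows "c = {first c, last c}" "angle (first c) < angle (last c)"
proof -
  have "card c = 2" using diagram c by (simp add: chord_diagram_def)
  then obtain x y where xy: "c = {x, y}" "x \<noteq> y" by (auto simp: card_2_iff)
  have "norm x = 1" "norm y = 1" using norm_endpoint xy c by blast+
  then have ne: "angle x \<noteq> angle y" using xy(2) angle_inj by blast
  define p q where "p = (if angle x < angle y then x else y)" and "q
      = (if angle x < angle y then y else x)"
  have pq: "c = {p, q}" "angle p < angle q" using xy ne by (auto simp: p_def q_def)
  have "first c = p" unfolding first_end_def arg_min_def is_arg_min_def
    by (rule some_equality) (use pq in auto)
  moreover have "last c = q" unfolding last_end_def arg_max_def is_arg_max_def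
    by (rule some_equality) (use pq in auto)
  ultimately show "c = {first c, last c}" "angle (first c) < angle (last c)" using pq by auto
qed

lemma first_in: "c \<in> B \<Longrightarrow> first c \<in> \<Union>B" and last_in: "c \<in> B \<Longrightarrow> last c \<in> \<Union>B"
  using chord_ends(1) by blast+

lemma first_neq_last: "c \<in> B \<Longrightarrow> d \<in> B \<Longrightarrow> first c \<noteq> last d"
  using chord_ends chord_disjoint[of c d "first c"] by (metis insertI1 insertI2 less_irrefl)

lemma first_inj: "c \<in> B \<Longrightarrow> d \<in> B \<Longrightarrow> first c = first d \<Longrightarrow> c = d"
  using chord_ends(1) chord_disjoint by (metis insertI1)

lemma last_inj: "c \<in> B \<Longrightarrow> d \<in> B \<Longrightarrow> last c = last d \<Longrightarrow> c = d"
  using chord_ends(1) chord_disjoint by (metis insertI1 insertI2)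

lemma endpoint_cases:
  assumes "p \<in> \<Union>B" obtains c where "c \<in> B" "p = first c" | c where "c \<in> B" "p = last c"
  using assms chord_ends(1) by blast

lemma w_pos: "w > 0" using width by (simp add: admissible_width_def)

lemma arcs_disjoint:
  assumes "p \<in> \<Union>B" "p' \<in> \<Union>B" "\<bar>s\<bar> \<le> w" "\<bar>t\<bar> \<le> w" "p * cis s = p' * cis t"
  shows "p = p'"
proof (rule ccontr)
  assume "p \<noteq> p'"
  then have "disjnt ((\<lambda>s. p * cis s) ` {-w..w}) ((\<lambda>s. p' * cis s) ` {-w..w})"
    using width assms(1,2) unfolding admissible_width_def by blast
  moreover have "p * cis s \<in> (\<lambda>s. p * cis s) ` {-w..w}" "p' * cis t \<in> (\<lambda>s. p' * cis s) ` {-w..w}"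
    using assms(3,4) by (auto simp: abs_le_iff)
  ultimately show False using assms(5) by (auto simp: disjnt_iff)
qed

text \<open>
  Otherwise the attaching arc of \<open>p\<close> would be the whole circle and contain all other endpoints.
\<close>

lemma w_less_pi: assumes p: "p \<in> \<Union>B" shows "w < pi"
proof (rule ccontr)
  assume "\<not> w < pi"
  obtain c where c: "c \<in> B" "p \<in> c" using p by blast
  obtain p' where p': "p' \<in> \<Union>B" "p' \<noteq> p"
    using first_neq_last[OF c(1) c(1)] first_in[OF c(1)] last_in[OF c(1)] by metis
  have "p \<noteq> 0" "p' \<noteq> 0" using norm_endpoint[OF p] norm_endpoint[OF p'(1)] by auto
  then have "p * cis (Arg (p' / p)) = p' * cis 0"
    using norm_endpoint[OF p] norm_endpoint[OF p'(1)] cis_Arg[of "p' / p"]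
    by (simp add: sgn_div_norm norm_divide)
  moreover have "\<bar>Arg (p' / p)\<bar> \<le> w" using Arg_bounded[of "p' / p"] \<open>\<not> w < pi\<close> by auto
  ultimately show False using arcs_disjoint[OF p p'(1), of "Arg (p' / p)" 0] p'(2) w_pos by simp
qed

lemma cis_eq_imp_eq:
  assumes "cis s = cis t" "\<bar>s - t\<bar> < 2 * pi" shows "s = t"
proof -
  have "sin s = sin t \<and> cos s = cos t" using assms(1) by (simp add: complex_eq_iff)
  then obtain n :: int where n: "s = t + 2 * pi * n" by (metis sin_cos_eq_iff)
  then have "2 * pi * \<bar>of_int n\<bar> < 2 * pi * 1" using assms(2) by (simp add: abs_mult)
  then have "\<bar>real_of_int n\<bar> < 1" using mult_less_cancel_left_pos[of "2 * pi"] pi_gt_zero by simp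
  then have "n = 0" by linarith
  then show ?thesis using n by simp
qed

text \<open>
  The attaching arcs are disjoint, and each of them is parametrized injectively.
\<close>

lemma arc_inj:
  assumes p: "p \<in> \<Union>B" "p' \<in> \<Union>B" and st: "\<bar>s\<bar> \<le> w" "\<bar>t\<bar> \<le> w" and eq: "p * cis s = p' * cis t"
  shows "p = p' \<and> s = t"
proof -
  have "p = p'" by (rule arcs_disjoint[OF p st eq])
  then have "cis s = cis t" using eq norm_endpoint[OF p(1)] by auto
  then show ?thesis using \<open>p = p'\<close> cis_eq_imp_eq[of s t] st w_less_pi[OF p(1)] by auto
qed

definition surface :: "(complex set option \<times> complex) topology" where
  "surface = quotient_topology (disk_and_bands B) (glue b w B)"

lemma mem_disk_and_bands:
  "(i, z) \<in> topspace (disk_and_bands B) \<longleftrightarrow>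
     (case i of None \<Rightarrow> norm z \<le> 1 | Some c \<Rightarrow> c \<in> B \<and> \<bar>Re z\<bar> \<le> 1 \<and> 0 \<le> Im z \<and> Im z \<le> 1)"
  by (auto simp: disk_and_bands_def in_cbox_complex_iff abs_le_iff split: option.splits)

lemma surface_None [simp]: "(None, z) \<in> topspace surface \<longleftrightarrow> norm z \<le> 1"
proof
  assume "(None, z) \<in> topspace surface"
  then obtain i z' where "(i, z') \<in> topspace (disk_and_bands B)" "(None, z) = glue b w B (i, z')"
    by (auto simp: surface_def)
  then show "norm z \<le> 1"
    by (cases i) (auto simp: mem_disk_and_bands norm_mult norm_endpoint[OF first_in]
        norm_endpoint[OF last_in] split: if_splits)
next
  assume "norm z \<le> 1"
  then show "(None, z) \<in> topspace surface"
    unfolding surface_def by (simp, intro image_eqI[of _ _ "(None, z)"]) (auto simp: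
        mem_disk_and_bands)
qed

lemma surface_Some [simp]:
  "(Some c, z) \<in> topspace surface \<longleftrightarrow> c \<in> B \<and> \<bar>Re z\<bar> \<le> 1 \<and> 0 < Im z \<and> Im z < 1"
proof
  assume "(Some c, z) \<in> topspace surface"
  then obtain i z' where "(i, z') \<in> topspace (disk_and_bands B)" "(Some c, z) = glue b w B (i, z')"
    by (auto simp: surface_def)
  then show "c \<in> B \<and> \<bar>Re z\<bar> \<le> 1 \<and> 0 < Im z \<and> Im z < 1"
    by (cases i) (auto simp: mem_disk_and_bands split: if_splits)
next
  assume "c \<in> B \<and> \<bar>Re z\<bar> \<le> 1 \<and> 0 < Im z \<and> Im z < 1"
  then show "(Some c, z) \<in> topspace surface"
    unfolding surface_def by (simp, intro image_eqI[of _ _ "(Some c, z)"]) (auto simp: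
        mem_disk_and_bands)
qed

lemma continuous_map_glue: "continuous_map (disk_and_bands B) surface (glue b w B)"
  unfolding surface_def by (rule quotient_imp_continuous_map[OF quotient_map_quotient_topology])

lemma compact_surface: "compact_space surface"
proof -
  have "compact_space (disk_and_bands B)"
    unfolding disk_and_bands_def
    by (rule compact_space_sum_topology) (use finite_B
        in \<open>auto simp: compact_space_subtopology split: option.splits\<close>)
  then show ?thesis
    using image_compactin[OF _ continuous_map_glue] by (simp add: compact_space_def surface_def)
qed

text \<open>
  The surface carries the quotient topology, so a function on it is continuous if it is continuous
  on the disk and on each band and the two definitions agree where the bands are attached. The
  formula \<open>f c\<close> for the band of \<open>c\<close> extends over the attached ends, whose points belong to the
  disk in the surface.
\<close>

lemma continuous_map_from_surface:
  fixes F :: "complex set option \<times> complex \<Rightarrow> 'a :: topological_space"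
  assumes disk: "continuous_on (cball 0 1) (\<lambda>z. F (None, z))"
    and band: "\<And>c. c \<in> B \<Longrightarrow> continuous_on UNIV (f c)"
    and F: "\<And>c z. c \<in> B \<Longrightarrow> 0 < Im z \<Longrightarrow> Im z < 1 \<Longrightarrow> F (Some c, z) = f c z"
    and low: "\<And>c z. c \<in> B \<Longrightarrow> Im z = 0 \<Longrightarrow> \<bar>Re z\<bar> \<le> 1 \<Longrightarrow> f c z = F (None, first c * cis (w * Re z))"
    and high: "\<And>c z. c \<in> B \<Longrightarrow> Im z = 1 \<Longrightarrow> \<bar>Re z\<bar> \<le> 1 \<Longrightarrow> f c z = F (None, last c * cis (- (w * Re z)))"
  shows "continuous_map surface euclidean F"
  unfolding surface_def
proof (rule continuous_compose_quotient_map[OF quotient_map_quotient_topology])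
  show "continuous_map (disk_and_bands B) euclidean (F \<circ> glue b w B)"
    unfolding disk_and_bands_def
  proof (rule continuous_map_from_sum_topology)
    fix i assume i: "i \<in> insert None (Some ` B)"
    show "continuous_map (case i of None \<Rightarrow> top_of_set (cball 0 1)
        | Some c \<Rightarrow> top_of_set (cbox (Complex (- 1) 0) (Complex 1 1)))
        euclidean (\<lambda>z. (F \<circ> glue b w B) (i, z))"
    proof (cases i)
      case None
      then show ?thesis using disk by simp
    next
      case (Some c)
      then have c: "c \<in> B" using i by auto
      have "continuous_map (top_of_set (cbox (Complex (- 1) 0) (Complex 1 1))) euclidean (f c)"
        using band[OF c] by (auto intro: continuous_on_subset)
      then have "continuous_map (top_of_set (cbox (Complex (- 1) 0) (Complex 1 1))) euclidean (\<lambda>z.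
          (F \<circ> glue b w B) (i, z))"
        by (rule continuous_map_eq)
          (use c Some in \<open>auto simp: in_cbox_complex_iff abs_le_iff low high F\<close>)
      then show ?thesis using Some by simp
    qed
  qed
qed

text \<open>
  The distance from the disk, measured along a band. It is greatest on the middle lines of the
      bands.
\<close>

fun height :: "complex set option \<times> complex \<Rightarrow> real" where
  "height (None, z) = 0"
| "height (Some c, z) = min (Im z) (1 - Im z)"

fun band_height :: "complex set \<Rightarrow> complex set option \<times> complex \<Rightarrow> real" where
  "band_height c (None, z) = 0"
| "band_height c (Some d, z) = (if d = c then min (Im z) (1 - Im z) else 0)"

text \<open>
  The surface with the middles of the bands cut out lies flat in the plane: half a band points
  radially outwards from its attaching arc, at distance \<open>1 + Im z\<close> from the origin near the first
  end and \<open>2 - Im z\<close> near the last. The factors are cut off to vanish on the middle line,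
  which makes the map continuous on the entire surface; where the height is at most \<open>1/3\<close> the
  cut-off has no effect.
\<close>

fun flatten :: "complex set option \<times> complex \<Rightarrow> complex" where
  "flatten (None, z) = z"
| "flatten (Some c, z) =
     of_real (max 0 (min (1 + Im z) (4 - 8 * Im z))) * (first c * cis (w * Re z)) +
     of_real (max 0 (min (2 - Im z) (8 * Im z - 4))) * (last c * cis (- (w * Re z)))"

text \<open>
  The band itself as a chart. The factor is \<open>1\<close> on the middle half \<open>1/4 \<le> Im z \<le> 3/4\<close> and
  vanishes at the ends, so that the map extends by \<open>0\<close> to the rest of the surface.
\<close>

fun band_chart :: "complex set \<Rightarrow> complex set option \<times> complex \<Rightarrow> complex" where
  "band_chart c (None, z) = 0"
| "band_chart c (Some d, z) = (if d = c then of_real (min 1 (4 * min (Im z) (1 - Im z))) * z else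
    0)"

lemma continuous_cis [continuous_intros]: "continuous_on S f \<Longrightarrow> continuous_on S (\<lambda>x. cis (f x))"
  unfolding cis_conv_exp by (intro continuous_intros)

lemma continuous_height: "continuous_map surface euclideanreal height"
  by (rule continuous_map_from_surface[where f = "\<lambda>c z. min (Im z) (1 - Im z)"])
     (auto intro!: continuous_intros)

lemma continuous_band_height: "continuous_map surface euclideanreal (band_height c)"
  by (rule continuous_map_from_surface[where f = "\<lambda>d. if d
      = c then (\<lambda>z. min (Im z) (1 - Im z)) else (\<lambda>z. 0)"])
     (auto intro!: continuous_intros)

lemma continuous_flatten: "continuous_map surface euclidean flatten"
  by (rule continuous_map_from_surface[where f = "\<lambda>c z. flatten (Some c, z)"])
     (auto intro!: continuous_intros)

declare flatten.simps(2) [simp del]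

lemma continuous_band_chart: "continuous_map surface euclidean (band_chart c)"
  by (rule continuous_map_from_surface[where
        f = "\<lambda>d. if d = c then (\<lambda>z. of_real (min 1 (4 * min (Im z) (1 - Im z))) * z) else (\<lambda>z. 0)"])
     (auto intro!: continuous_intros)

end

section \<open>The boundary of the disk with bands\<close>

context band_diagram begin

definition open_arcs :: "complex set" where
  "open_arcs = {p * cis s | p s. p \<in> \<Union>B \<and> \<bar>s\<bar> < w}"

definition flattened :: "complex set" where
  "flattened = cball 0 1 \<union> {of_real r * (p * cis s) | r p s. 1 \<le> r \<and> r < 4/3 \<and> p \<in> \<Union>B \<and> \<bar>s\<bar> \<le> w}"

lemma flatten_band:
  assumes c: "c \<in> B" and z: "\<bar>Re z\<bar> \<le> 1" "0 < Im z" "Im z < 1" and h: "height (Some c, z) \<le> 1/3"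
  shows "Im z < 1/2 \<and> flatten (Some c, z) = of_real (1 + height (Some c, z)) * (first c * cis (w *
      Re z)) \<or>
    Im z > 1/2 \<and> flatten (Some c, z) = of_real (1 + height (Some c, z)) * (last c * cis (- (w * Re
        z)))"
proof (cases "Im z < 1/2")
  case True
  then have "Im z \<le> 1/3" using h by (auto simp: min_def split: if_splits)
  then show ?thesis using True z by (auto simp: min_def max_def flatten.simps(2))
next
  case False
  then have "Im z \<ge> 2/3" using h by (auto simp: min_def split: if_splits)
  then have "max 0 (min (1 + Im z) (4 - 8 * Im z)) = 0" "max 0 (min (2 - Im z) (8 * Im z - 4))
      = 2 - Im z"
    "height (Some c, z) = 1 - Im z" using z by (auto simp: min_def max_def)
  then show ?thesis using \<open>Im z \<ge> 2/3\<close> by (simp add: flatten.simps(2))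
qed

lemma flatten_cases:
  assumes x: "x \<in> topspace surface" "height x \<le> 1/3"
  obtains (disk) z where "x = (None, z)" "norm z \<le> 1" "flatten x = z" "height x = 0"
  | (low) c z where "x = (Some c, z)" "c \<in> B" "\<bar>Re z\<bar> \<le> 1" "0 < Im z" "Im z < 1/2" "height x = Im z"
      "flatten x = of_real (1 + height x) * (first c * cis (w * Re z))"
  | (high) c z where "x = (Some c, z)" "c \<in> B" "\<bar>Re z\<bar> \<le> 1" "1/2 < Im z" "Im z < 1" "height x
      = 1 - Im z"
      "flatten x = of_real (1 + height x) * (last c * cis (- (w * Re z)))"
proof -
  obtain i z where iz: "x = (i, z)" by force
  show thesis
  proof (cases i)
    case None
    then show thesis using disk[of z] x iz by auto
  next
    case (Some c)
    then have c: "c \<in> B" "\<bar>Re z\<bar> \<le> 1" "0 < Im z" "Im z < 1" using x iz by auto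
    from flatten_band[OF c] x iz Some have "Im z < 1/2 \<and> flatten x
        = of_real (1 + height x) * (first c * cis (w * Re z)) \<or>
      Im z > 1/2 \<and> flatten x = of_real (1 + height x) * (last c * cis (- (w * Re z)))" by simp
    then show thesis using low[of c z] high[of c z] c iz Some by (auto simp: min_def)
  qed
qed

lemma norm_arc: "p \<in> \<Union>B \<Longrightarrow> norm (of_real r * (p * cis s)) = \<bar>r\<bar>"
  using norm_endpoint by (simp add: norm_mult)

lemma radial_arc_inj:
  assumes p: "p \<in> \<Union>B" "p' \<in> \<Union>B" and st: "\<bar>s\<bar> \<le> w" "\<bar>t\<bar> \<le> w" and r: "r > 0" "r' > 0"
    and eq: "of_real r * (p * cis s) = of_real r' * (p' * cis t)"
  shows "r = r' \<and> p = p' \<and> s = t"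
proof -
  have "r = r'" using norm_arc[OF p(1), of r s] norm_arc[OF p(2), of r' t] eq r by simp
  then have "p * cis s = p' * cis t" using eq r by simp
  then show ?thesis using arc_inj[OF p st] \<open>r = r'\<close> by auto
qed

lemma abs_w_mult: "\<bar>u\<bar> \<le> 1 \<Longrightarrow> \<bar>w * u\<bar> \<le> w" "\<bar>u\<bar> \<le> 1 \<Longrightarrow> \<bar>- (w * u)\<bar> \<le> w"
  using w_pos by (auto simp: abs_mult mult_left_le)

text \<open>
  The modulus of the image gives the height. A point outside the unit disk lies radially above only
  one attaching arc, which gives the band, the end and the position across the band.
\<close>

lemma inj_flatten: "inj_on flatten {x \<in> topspace surface. height x \<le> 1/3}"
proof (rule inj_onI)
  fix x y assume "x \<in> {x \<in> topspace surface. height x \<le> 1/3}" "y \<in> {x \<in> topspace surface. height x \<le>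
      1/3}"
    and eq: "flatten x = flatten y"
  then have x: "x \<in> topspace surface" "height x \<le> 1/3"
      and y: "y \<in> topspace surface" "height y \<le> 1/3" by auto
  note rai = radial_arc_inj[OF _ _ abs_w_mult(1) abs_w_mult(1)] radial_arc_inj[OF _ _ abs_w_mult(1)
      abs_w_mult(2)]
    radial_arc_inj[OF _ _ abs_w_mult(2) abs_w_mult(1)] radial_arc_inj[OF _ _ abs_w_mult(2)
        abs_w_mult(2)]
  show "x = y"
    using x
  proof (cases rule: flatten_cases)
    case X: (disk z)
    show ?thesis
      using y
    proof (cases rule: flatten_cases)
      case (disk z') then show ?thesis using X eq by simp
    next
      case (low c z')
      then have "norm (flatten y) = 1 + height y" unfolding low(7) norm_arc[OF first_in[OF low(2)]]
          using low(4-6) by simp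
      then show ?thesis using X eq low by simp
    next
      case (high c z')
      then have "norm (flatten y) = 1 + height y" unfolding high(7) norm_arc[OF last_in[OF high(2)]]
          using high(4-6) by simp
      then show ?thesis using X eq high by simp
    qed
  next
    case X: (low c z)
    then have nx: "norm (flatten x) = 1 + height x" unfolding X(7) norm_arc[OF first_in[OF X(2)]]
        using X(4-6) by simp
    show ?thesis
      using y
    proof (cases rule: flatten_cases)
      case (disk z') then show ?thesis using X eq nx by simp
    next
      case (low c' z')
      then have "1 + height x = 1 + height y \<and> first c = first c' \<and> w * Re z = w * Re z'"
        using X eq by (intro rai(1) first_in) auto
      then show ?thesis using X low first_inj w_pos by (auto simp: complex_eq_iff)
    next
      case (high c' z')
      then have "1 + height x = 1 + height y \<and> first c = last c' \<and> w * Re z = - (w * Re z')"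
        using X eq by (intro rai(2) first_in last_in) auto
      then show ?thesis using first_neq_last X high by blast
    qed
  next
    case X: (high c z)
    then have nx: "norm (flatten x) = 1 + height x" unfolding X(7) norm_arc[OF last_in[OF X(2)]]
        using X(4-6) by simp
    show ?thesis
      using y
    proof (cases rule: flatten_cases)
      case (disk z') then show ?thesis using X eq nx by simp
    next
      case (low c' z')
      then have "1 + height x = 1 + height y \<and> last c = first c' \<and> - (w * Re z) = w * Re z'"
        using X eq by (intro rai(3) first_in last_in) auto
      then show ?thesis using first_neq_last X low by metis
    next
      case (high c' z')
      then have "1 + height x = 1 + height y \<and> last c = last c' \<and> - (w * Re z) = - (w * Re z')"
        using X eq by (intro rai(4) last_in) auto
      then show ?thesis using X high last_inj w_pos by (auto simp: complex_eq_iff)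
    qed
  qed
qed

lemma flatten_image_eq: "flatten ` {x \<in> topspace surface. height x < 1/3} = flattened"
proof
  show "flatten ` {x \<in> topspace surface. height x < 1/3} \<subseteq> flattened"
  proof (clarify)
    fix i z assume x: "(i, z) \<in> topspace surface" "height (i, z) < 1/3"
    then have "height (i, z) \<le> 1/3" by simp
    with x(1) show "flatten (i, z) \<in> flattened"
    proof (cases rule: flatten_cases)
      case (disk z') then show ?thesis by (simp add: flattened_def)
    next
      case (low c z')
      then have "1 \<le> 1 + height (i, z) \<and> 1 + height (i, z) < 4/3 \<and> first c \<in> \<Union>B \<and> \<bar>w * Re z'\<bar> \<le> w"
        using x first_in abs_w_mult by auto
      then show ?thesis unfolding flattened_def low(7) by blast
    next
      case (high c z')
      then have "1 \<le> 1 + height (i, z) \<and> 1 + height (i, z) < 4/3 \<and> last c \<in> \<Union>B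
          \<and> \<bar>- (w * Re z')\<bar> \<le> w"
        using x last_in abs_w_mult by auto
      then show ?thesis unfolding flattened_def high(7) by blast
    qed
  qed
  show "flattened \<subseteq> flatten ` {x \<in> topspace surface. height x < 1/3}"
  proof
    fix z assume z: "z \<in> flattened"
    show "z \<in> flatten ` {x \<in> topspace surface. height x < 1/3}"
    proof (cases "norm z \<le> 1")
      case True
      then show ?thesis by (intro image_eqI[of _ _ "(None, z)"]) auto
    next
      case False
      then obtain r p s where rps: "z = of_real r * (p * cis s)" "1 \<le> r" "r < 4/3" "p \<in> \<Union>B" "\<bar>s\<bar> \<le>
          w"
        using z by (auto simp: flattened_def)
      have r: "1 < r" using False rps norm_arc[OF rps(4), of r s] by simp
      have u: "\<bar>s / w\<bar> \<le> 1" "w * (s / w) = s" using rps(5) w_pos by (auto simp: field_simps)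
      show ?thesis using rps(4)
      proof (cases rule: endpoint_cases)
        case (1 c)
        have "flatten (Some c, Complex (s / w) (r - 1)) = z" 
          using u r rps 1 by (simp add: min_def max_def flatten.simps(2))
        then show ?thesis
          by (intro image_eqI[of _ _ "(Some c, Complex (s / w) (r - 1))"]) (use u r rps 1 in auto)
      next
        case (2 c)
        have "flatten (Some c, Complex (- (s / w)) (2 - r)) = z" 
          using u r rps 2 by (simp add: min_def max_def flatten.simps(2))
        then show ?thesis
          by (intro image_eqI[of _ _ "(Some c, Complex (- (s / w)) (2 - r))"])
              (use u r rps 2 in auto)
      qed
    qed
  qed
qed


text \<open>
  The open sector over an attaching arc consists of the points whose direction makes an angle less
  than \<open>w\<close> with \<open>p\<close>, expressed by cosines; within the modulus \<open>4/3\<close> it belongs to the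
  image, as the disk covers its lower part and the band its upper part.
\<close>

lemma flattened_interior_arc:
  assumes p: "p \<in> \<Union>B" and r: "1 \<le> r" "r < 4/3" and s: "\<bar>s\<bar> < w"
  shows "of_real r * (p * cis s) \<in> interior flattened"
proof (rule interiorI)
  let ?O = "{z. norm z < 4/3} \<inter> {z. norm z * cos w < Re (z / p)}"
  have p1: "norm p = 1" "p \<noteq> 0" using norm_endpoint[OF p] by auto
  have wpi: "w < pi" by (rule w_less_pi[OF p])
  show "open ?O" by (intro open_Int open_Collect_less continuous_intros) (use p1 in auto)
  have "cos w < cos s"
    using cos_monotone_0_pi[of "\<bar>s\<bar>" w] s wpi by simp
  then show "of_real r * (p * cis s) \<in> ?O"
    using p1 r by (simp add: norm_mult)
  show "?O \<subseteq> flattened"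
  proof
    fix z assume z: "z \<in> ?O"
    show "z \<in> flattened"
    proof (cases "norm z \<le> 1")
      case False
      define t where "t = Arg (z / p)"
      have "z / p \<noteq> 0" using False p1 by auto
      then have zt: "z = of_real (norm z) * (p * cis t)"
        using cis_Arg[of "z / p"] p1 by (simp add: t_def sgn_div_norm norm_divide
            scaleR_conv_of_real)
      have "\<bar>t\<bar> \<le> pi" using Arg_bounded[of "z / p"] by (auto simp: t_def)
      have "Re (z / p) = norm z * cos t"
        by (subst zt) (use p1 in simp)
      then have "norm z * cos w < norm z * cos t" using z by auto
      moreover have "0 < norm z" using False by linarith
      ultimately have "cos w < cos t" by (simp only: mult_less_cancel_left_pos)
      then have "\<bar>t\<bar> \<le> w"
        using cos_monotone_0_pi_le[of w "\<bar>t\<bar>"] \<open>\<bar>t\<bar> \<le> pi\<close> w_pos by (cases "w \<le> \<bar>t\<bar>") auto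
      moreover have "1 \<le> norm z" "norm z < 4/3" using z False by auto
      ultimately show ?thesis unfolding flattened_def using zt p by blast
    qed (simp add: flattened_def)
  qed
qed

text \<open>
  The sign \<open>e\<close> tells in which direction to turn: if \<open>z\<close> is a corner of the arc of \<open>p\<close>, turning
  by \<open>e * \<delta>\<close> leads away from it. Otherwise \<open>z\<close> has positive distance from the arc.
\<close>

lemma eventually_not_in_closed_arc:
  assumes p: "p \<in> \<Union>B" and z: "norm z = 1" "z \<notin> open_arcs"
    and e: "z \<in> (\<lambda>s. p * cis s) ` {-w..w} \<Longrightarrow> z = p * cis (e * w)" "\<bar>e\<bar> = 1"
  shows "\<forall>\<^sub>F \<delta> in at_right 0. z * cis (e * \<delta>) \<notin> (\<lambda>s. p * cis s) ` {-w..w}"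
proof (cases "z \<in> (\<lambda>s. p * cis s) ` {-w..w}")
  case True
  then have zp: "z = p * cis (e * w)" by (rule e)
  have "0 < 2 * pi - 2 * w" using w_less_pi[OF p] by simp
  then have "\<forall>\<^sub>F \<delta> in at_right 0. \<delta> \<in> {0<..<2 * pi - 2 * w}" by (rule eventually_at_right_real)
  then show ?thesis
  proof eventually_elim
    case (elim \<delta>)
    show ?case
    proof
      assume "z * cis (e * \<delta>) \<in> (\<lambda>s. p * cis s) ` {-w..w}"
      then obtain s where s: "- w \<le> s" "s \<le> w" "z * cis (e * \<delta>) = p * cis s" by auto
      then have "cis (e * w + e * \<delta>) = cis s" using norm_endpoint[OF p] zp
          by (auto simp: cis_mult mult.assoc)
      moreover have "\<bar>e * w + e * \<delta> - s\<bar> < 2 * pi" using elim s e(2)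
          by (auto simp: abs_if split: if_splits)
      ultimately have "e * w + e * \<delta> = s" by (rule cis_eq_imp_eq)
      then show False using elim s e(2) by (auto simp: abs_if split: if_splits)
    qed
  qed
next
  case False
  have "closed ((\<lambda>s. p * cis s) ` {-w..w})"
    by (intro compact_imp_closed compact_continuous_image continuous_intros) auto
  then have "open (- (\<lambda>s. p * cis s) ` {-w..w})" by (rule open_Compl)
  moreover have "((\<lambda>\<delta>. z * cis (e * \<delta>)) \<longlongrightarrow> z * cis (e * 0)) (at_right 0)"
    unfolding cis_conv_exp by (intro tendsto_intros)
  ultimately show ?thesis using False topological_tendstoD by fastforce
qed

text \<open>
  Turning \<open>z\<close> slightly away from the arc that it may bound, and at the same time moving outwards,
  leads to points outside the unit disk that are above no attaching arc, arbitrarily close to the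
  given point.
\<close>

lemma flattened_not_interior:
  assumes z: "norm z = 1" "z \<notin> open_arcs" and r: "1 \<le> r"
  shows "of_real r * z \<notin> interior flattened"
proof
  assume int: "of_real r * z \<in> interior flattened"
  \<comment> \<open>As the arcs are disjoint, z bounds at most one of them, and one direction suits all.\<close>
  have "\<exists>e. \<bar>e\<bar> = 1 \<and> (\<forall>p\<in>\<Union>B. z \<in> (\<lambda>s. p * cis s) ` {-w..w} \<longrightarrow> z = p * cis (e * w))"
  proof (cases "\<exists>p\<in>\<Union>B. \<exists>s. \<bar>s\<bar> \<le> w \<and> z = p * cis s")
    case True
    then obtain p s where ps: "p \<in> \<Union>B" "\<bar>s\<bar> \<le> w" "z = p * cis s" by blast
    then have "\<not> \<bar>s\<bar> < w" using z(2) unfolding open_arcs_def by blast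
    then have sw: "\<bar>s\<bar> = w" using ps by simp
    have "z = q * cis (sgn s * w)" if q: "q \<in> \<Union>B" "z \<in> (\<lambda>s. q * cis s) ` {-w..w}" for q
    proof -
      obtain t where t: "- w \<le> t" "t \<le> w" "z = q * cis t" using q(2) by auto
      then have "p = q" "s = t" using arc_inj[OF ps(1) q(1) ps(2), of t] ps(3) by auto
      moreover have "sgn s * w = s" using sw by (auto simp: sgn_if)
      ultimately show ?thesis using t(3) by simp
    qed
    moreover have "\<bar>sgn s\<bar> = 1" using sw w_pos by (auto simp: sgn_if)
    ultimately show ?thesis by blast
  next
    case False
    then show ?thesis by (intro exI[of _ 1]) (auto simp: abs_le_iff image_iff)
  qed
  then obtain e :: real where e: "\<bar>e\<bar> = 1" "\<And>p. p \<in> \<Union>B \<Longrightarrow> z \<in> (\<lambda>s. p * cis s) ` {-w..w} \<Longrightarrow> z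
      = p * cis (e * w)" by blast
  have "\<forall>\<^sub>F \<delta> in at_right 0. \<forall>p\<in>\<Union>B. z * cis (e * \<delta>) \<notin> (\<lambda>s. p * cis s) ` {-w..w}"
    using eventually_not_in_closed_arc[OF _ z e(2) e(1)]
    by (intro eventually_ball_finite finite_endpoints ballI)
  moreover have "\<forall>\<^sub>F \<delta> in at_right 0. of_real (r + \<delta>) * (z * cis (e * \<delta>)) \<in> interior flattened"
  proof -
    have "((\<lambda>\<delta>. of_real (r + \<delta>) * (z * cis (e * \<delta>))) \<longlongrightarrow> of_real (r + 0) * (z * cis (e * 0)))
        (at_right 0)"
      unfolding cis_conv_exp by (intro tendsto_intros)
    then show ?thesis by (rule topological_tendstoD[OF _ open_interior]) (use int in simp)
  qed
  moreover have "\<forall>\<^sub>F \<delta>::real in at_right 0. 0 < \<delta>" by (simp add: eventually_at_right_less)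
  ultimately have "\<forall>\<^sub>F \<delta>::real in at_right 0. False"
  proof eventually_elim
    case (elim \<delta>)
    let ?z = "of_real (r + \<delta>) * (z * cis (e * \<delta>))"
    have n: "norm ?z = r + \<delta>" using z(1) r elim by (simp add: norm_mult del: of_real_add)
    have "?z \<in> flattened" using elim(2) interior_subset by blast
    then obtain r' p s where rps: "?z = of_real r' * (p * cis s)" "1 \<le> r'" "p \<in> \<Union>B" "\<bar>s\<bar> \<le> w"
      using n r elim(3) by (auto simp: flattened_def)
    then have "r' = r + \<delta>" using n norm_arc[OF rps(3), of r' s] by simp
    then have "z * cis (e * \<delta>) = p * cis s" using rps(1) r elim(3) mult_left_cancel[of "of_real (r +
        \<delta>) :: complex"] by fastforce
    then have "z * cis (e * \<delta>) \<in> (\<lambda>s. p * cis s) ` {-w..w}" using rps(4) by (auto simp: abs_le_iff)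
    then show ?case using elim(1) rps(3) by blast
  qed
  then show False by simp
qed

lemma corner_not_in_open_arcs:
  assumes p: "p \<in> \<Union>B" and s: "\<bar>s\<bar> = w" shows "p * cis s \<notin> open_arcs"
proof
  assume "p * cis s \<in> open_arcs"
  then obtain q t where "q \<in> \<Union>B" "\<bar>t\<bar> < w" "p * cis s = q * cis t" by (auto simp: open_arcs_def)
  then show False using arc_inj[OF p, of q s t] s by auto
qed

text \<open>
  The expected boundary. The corners of the bands are points of the circle, since an attached point
  is represented in the disk.
\<close>

definition rim :: "(complex set option \<times> complex) set" where
  "rim = {(None, z) | z. norm z = 1 \<and> z \<notin> open_arcs} \<union>
         {(Some c, z) | c z. c \<in> B \<and> \<bar>Re z\<bar> = 1 \<and> 0 < Im z \<and> Im z < 1}"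

lemma rim_near_disk:
  assumes x: "x \<in> topspace surface" "height x < 1/3"
  shows "flatten x \<notin> interior flattened \<longleftrightarrow> x \<in> rim"
proof -
  have "height x \<le> 1/3" using x(2) by simp
  with x(1) show ?thesis
  proof (cases rule: flatten_cases)
    case (disk z)
    show ?thesis
    proof (cases "norm z = 1")
      case True
      have "z \<in> interior flattened" if zo: "z \<in> open_arcs"
      proof -
        obtain p s where "p \<in> \<Union>B" "\<bar>s\<bar> < w" "z = p * cis s" using zo by (auto simp: open_arcs_def)
        then show ?thesis using flattened_interior_arc[of p 1 s] by simp
      qed
      then show ?thesis using disk True flattened_not_interior[of z 1] by (auto simp: rim_def)
    next
      case False
      then have "z \<in> ball 0 1" using disk by simp
      moreover have "ball 0 1 \<subseteq> flattened" by (auto simp: flattened_def)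
      ultimately have "z \<in> interior flattened" by (meson interiorI open_ball)
      then show ?thesis using disk False by (auto simp: rim_def)
    qed
  next
    case (low c z)
    have h: "0 < height x" using low by simp
    show ?thesis
    proof (cases "\<bar>Re z\<bar> = 1")
      case True
      then have "\<bar>w * Re z\<bar> = w" using w_pos by (simp add: abs_mult)
      then have "flatten x \<notin> interior flattened" unfolding low(7)
        using h by (intro flattened_not_interior corner_not_in_open_arcs first_in low)
          (use norm_endpoint[OF first_in[OF low(2)]] in \<open>auto simp: norm_mult\<close>)
      then show ?thesis using low True by (auto simp: rim_def)
    next
      case False
      then have "\<bar>w * Re z\<bar> < w" using w_pos low by (simp add: abs_mult)
      then have "flatten x \<in> interior flattened" unfolding low(7)
        using h x(2) by (intro flattened_interior_arc first_in low) auto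
      then show ?thesis using low False by (auto simp: rim_def)
    qed
  next
    case (high c z)
    have h: "0 < height x" using high by simp
    show ?thesis
    proof (cases "\<bar>Re z\<bar> = 1")
      case True
      then have "\<bar>- (w * Re z)\<bar> = w" using w_pos by (simp add: abs_mult)
      then have "flatten x \<notin> interior flattened" unfolding high(7)
        using h by (intro flattened_not_interior corner_not_in_open_arcs last_in high)
          (use norm_endpoint[OF last_in[OF high(2)]] in \<open>auto simp: norm_mult\<close>)
      then show ?thesis using high True by (auto simp: rim_def)
    next
      case False
      then have "\<bar>- (w * Re z)\<bar> < w" using w_pos high by (simp add: abs_mult)
      then have "flatten x \<in> interior flattened" unfolding high(7)
        using h x(2) by (intro flattened_interior_arc last_in high) auto
      then show ?thesis using high False by (auto simp: rim_def)
    qed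
  qed
qed

lemma band_chart_middle:
  assumes "(Some c, z) \<in> topspace surface" "1/4 \<le> height (Some c, z)"
  shows "band_chart c (Some c, z) = z"
  using assms by (auto simp: min_def)

lemma rim_in_band:
  assumes c: "c \<in> B" and x: "x \<in> topspace surface" "1/4 < band_height c x"
  shows "band_chart c x \<notin> interior (band_chart c ` {x \<in> topspace surface. 1/4 < band_height c x})
      \<longleftrightarrow> x \<in> rim"
proof -
  obtain z where xz: "x = (Some c, z)"
    using x(2) by (cases "(c, x)" rule: band_height.cases) (auto split: if_splits)
  have z: "\<bar>Re z\<bar> \<le> 1" "1/4 < Im z" "Im z < 3/4" using x xz by (auto simp: min_def split: if_splits)
  let ?M = "{z. \<bar>Re z\<bar> \<le> 1 \<and> 1/4 < Im z \<and> Im z < 3/4}"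
  have im: "band_chart c ` {x \<in> topspace surface. 1/4 < band_height c x} = ?M"
  proof
    show "band_chart c ` {x \<in> topspace surface. 1/4 < band_height c x} \<subseteq> ?M"
    proof (clarify)
      fix i y assume y: "(i, y) \<in> topspace surface" "1/4 < band_height c (i, y)"
      then have i: "i = Some c" by (cases i) (auto split: if_splits)
      then have "band_chart c (i, y) = y" using band_chart_middle[of c y] y by simp
      then show "\<bar>Re (band_chart c (i, y))\<bar> \<le> 1 \<and> 1/4 < Im (band_chart c (i, y))
          \<and> Im (band_chart c (i, y)) < 3/4"
        using y i by (auto simp: min_def split: if_splits)
    qed
    show "?M \<subseteq> band_chart c ` {x \<in> topspace surface. 1/4 < band_height c x}"
    proof
      fix y assume "y \<in> ?M"
      then show "y \<in> band_chart c ` {x \<in> topspace surface. 1/4 < band_height c x}"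
        by (intro image_eqI[of _ _ "(Some c, y)"]) (use c in \<open>auto simp: min_def\<close>)
    qed
  qed
  have bc: "band_chart c x = z" using band_chart_middle[of c z] x xz by simp
  have "z \<in> interior ?M \<longleftrightarrow> \<bar>Re z\<bar> < 1"
  proof
    assume "\<bar>Re z\<bar> < 1"
    moreover have "open {z. \<bar>Re z\<bar> < 1 \<and> 1/4 < Im z \<and> Im z < 3/4}"
      by (intro open_Collect_conj open_Collect_less continuous_intros)
    ultimately show "z \<in> interior ?M" using z by (intro interiorI[of "{z. \<bar>Re z\<bar> < 1 \<and> 1/4 < Im z
        \<and> Im z < 3/4}"]) auto
  next
    assume "z \<in> interior ?M"
    then obtain e where e: "e > 0" "ball z e \<subseteq> ?M" by (auto simp: mem_interior)
    have "z + of_real (sgn (Re z) * (e / 2)) \<in> ball z e" using e(1)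
        by (auto simp: dist_norm norm_mult sgn_if)
    then have "\<bar>Re z + sgn (Re z) * (e / 2)\<bar> \<le> 1" using e(2) by auto
    then show "\<bar>Re z\<bar> < 1" using e(1) by (auto simp: sgn_if abs_if split: if_splits)
  qed
  then show ?thesis unfolding im bc using xz c z by (auto simp: rim_def)
qed

lemma inj_band_chart:
  "inj_on (band_chart c) {x \<in> topspace surface. 1/4 \<le> band_height c x}"
proof (rule inj_onI)
  fix x y assume xy: "x \<in> {x \<in> topspace surface. 1/4 \<le> band_height c x}" "y \<in> {x \<in> topspace surface.
      1/4 \<le> band_height c x}"
    and eq: "band_chart c x = band_chart c y"
  obtain z where "x = (Some c, z)" using xy(1)
      by (cases "(c, x)" rule: band_height.cases) (auto split: if_splits)
  moreover obtain z' where "y = (Some c, z')" using xy(2)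
      by (cases "(c, y)" rule: band_height.cases) (auto split: if_splits)
  ultimately show "x = y" using eq xy band_chart_middle[of c z] band_chart_middle[of c z'] by simp
qed

text \<open>
  The flat chart covers the points of height less than \<open>1/3\<close>, and the middle parts of the bands
  cover the rest.
\<close>

theorem topspace_surface_boundary: "topspace (surface_boundary surface) = rim"
proof -
  have "x \<in> topspace (surface_boundary surface) \<longleftrightarrow> x \<in> rim" if x: "x \<in> topspace surface" for x
  proof (cases "height x < 1/3")
    case True
    show ?thesis
      using surface_boundary_iff_injective_below[OF compact_surface continuous_flatten
          continuous_height inj_flatten x True]
        rim_near_disk[OF x True] unfolding flatten_image_eq by simp
  next
    case False
    then obtain c z where xz: "x = (Some c, z)" by (cases x rule: height.cases) auto
    then have c: "c \<in> B" and h: "1/4 < band_height c x" using x False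
        by (auto simp: min_def split: if_splits)
    have m: "continuous_map surface euclideanreal (\<lambda>x. - band_height c x)"
      using continuous_band_height[of c] by (rule continuous_map_minus)
    have e: "{x \<in> topspace surface. - band_height c x \<le> - (1/4)}
        = {x \<in> topspace surface. 1/4 \<le> band_height c x}"
      "{x \<in> topspace surface. - band_height c x < - (1/4)}
          = {x \<in> topspace surface. 1/4 < band_height c x}" by auto
    show ?thesis
      using surface_boundary_iff_injective_below[OF compact_surface continuous_band_chart m, of c "-
          (1/4)" x, unfolded e]
        inj_band_chart[of c] x h rim_in_band[OF c x h] by simp
  qed
  moreover have "topspace (surface_boundary surface) \<subseteq> topspace surface"
      by (auto simp: surface_boundary_def)
  moreover have "rim \<subseteq> topspace surface" by (auto simp: rim_def)
  ultimately show ?thesis by blast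
qed

corollary surface_boundary_eq: "surface_boundary surface = subtopology surface rim"
  using topspace_surface_boundary unfolding surface_boundary_def
      by (metis (no_types, lifting) Int_absorb1 mem_Collect_eq subsetI topspace_subtopology)

fun core :: "complex set option \<times> complex \<Rightarrow> complex" where
  "core (None, z) = z"
| "core (Some c, z) = of_real (1 - Im z) * (first c * cis (w * Re z)) + of_real (Im z) * (last c *
    cis (- (w * Re z)))"

fun band_coords :: "complex set \<Rightarrow> complex set option \<times> complex \<Rightarrow> complex \<times> real" where
  "band_coords c (None, z) = 0"
| "band_coords c (Some d, z) = (if d = c then (of_real (Im z * (1 - Im z)) * z, Im z * (1 - Im z))
    else 0)"

text \<open>
  Continuous functions separate the points: the disk is retained by extending its inclusion linearly
  over the bands, and the band coordinates, multiplied by a factor that vanishes at the ends, tell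
  apart the points of the bands.
\<close>

lemma Hausdorff_surface: "Hausdorff_space surface"
proof -
  have core: "continuous_map surface euclidean core"
    by (rule continuous_map_from_surface[where f
        = "\<lambda>c z. core (Some c, z)"]) (auto intro!: continuous_intros)
  have coords: "continuous_map surface euclidean (band_coords c)" for c
    by (rule continuous_map_from_surface[where f = "\<lambda>d. if d = c then
          (\<lambda>z. (of_real (Im z * (1 - Im z)) * z, Im z * (1 - Im z))) else (\<lambda>z. 0)"])
       (auto intro!: continuous_intros simp: zero_prod_def)
  have sep: "x = y" if x: "x \<in> topspace surface" and y: "y \<in> topspace surface"
    and "core x = core y" and bc: "\<And>c. band_coords c x = band_coords c y" for x y
  proof (cases "fst x")
    case None
    show ?thesis
    proof (cases "fst y")
      case (Some d)
      then show ?thesis using None bc[of d] y by (cases x; cases y) (auto simp: zero_prod_def)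
    qed (use None that(3) in \<open>cases x; cases y; auto\<close>)
  next
    case (Some c)
    then obtain z where z: "x = (Some c, z)" by (cases x) auto
    define k where "k = Im z * (1 - Im z)"
    have k: "k \<noteq> 0" using x z by (auto simp: k_def)
    then obtain z' where z': "y = (Some c, z')" "k = Im z' * (1 - Im z')"
      using bc[of c] z by (cases "(c, y)" rule: band_coords.cases) (auto simp: zero_prod_def k_def
          split: if_splits)
    then have "of_real k * z = of_real k * z'" using bc[of c] z by (simp add: k_def)
    then show ?thesis using k z z' by simp
  qed
  have separate: "\<exists>U V. openin surface U \<and> openin surface V \<and> x \<in> U \<and> y \<in> V \<and> disjnt U V"
    if f: "continuous_map surface euclidean f" and x: "x \<in> topspace surface"
        and y: "y \<in> topspace surface"
      and ne: "f x \<noteq> f y" for x y and f :: "complex set option \<times> complex \<Rightarrow> 'b :: t2_space"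
  proof -
    obtain U V where "open U" "open V" "f x \<in> U" "f y \<in> V" "U \<inter> V = {}" using hausdorff[OF ne]
        by blast
    then show ?thesis
      using openin_continuous_map_preimage[OF f, of U] openin_continuous_map_preimage[OF f, of V] x
          y
      by (intro exI[of _ "{x \<in> topspace surface. f x \<in> U}"] exI[of _ "{x \<in> topspace surface. f x \<in>
          V}"])
         (auto simp: disjnt_iff)
  qed
  show ?thesis
    unfolding Hausdorff_space_def
    using sep separate[OF core] separate[OF coords] by metis
qed

end

section \<open>Jumps along a Gauss diagram\<close>

text \<open>
  The combinatorics of a chord diagram: the endpoints are numbered \<open>0, \<dots>, N - 1\<close> in the
  order in which they are met from the base point, and each chord has a first and a last endpoint.
\<close>

locale gauss_diagram =
  fixes C :: "'c set" and N :: nat and first_pos last_pos :: "'c \<Rightarrow> nat"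
  assumes finite_C: "finite C"
    and positions: "first_pos ` C \<union> last_pos ` C = {..<N}"
    and inj_first_pos: "inj_on first_pos C" and inj_last_pos: "inj_on last_pos C"
    and first_pos_neq_last_pos: "\<And>c d. c \<in> C \<Longrightarrow> d \<in> C \<Longrightarrow> first_pos c \<noteq> last_pos d"
    and first_pos_less_last_pos: "\<And>c. c \<in> C \<Longrightarrow> first_pos c < last_pos c"
begin

definition pred :: "nat \<Rightarrow> nat" where "pred i = (if i = 0 then N - 1 else i - 1)"

definition crossing_sign :: "'c \<Rightarrow> 'c \<Rightarrow> rat" where
  "crossing_sign c d =
     (if first_pos c < first_pos d \<and> first_pos d < last_pos c \<and> last_pos c < last_pos d then 1
      else if first_pos d < first_pos c \<and> first_pos c < last_pos d
          \<and> last_pos d < last_pos c then -1 else 0)"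

text \<open>
  The value \<open>f i\<close> belongs to the gap after position \<open>i\<close>. The two equations for a chord express that
  the value is the same at both ends of each side of its band.
\<close>

definition compatible :: "(nat \<Rightarrow> 'v) \<Rightarrow> bool" where
  "compatible f \<longleftrightarrow> (\<forall>c\<in>C. f (last_pos c) = f (pred (first_pos c)) \<and> f (first_pos c)
      = f (pred (last_pos c)))"

lemma first_pos_bound: "c \<in> C \<Longrightarrow> first_pos c < N" and last_pos_bound: "c \<in> C \<Longrightarrow> last_pos c < N"
  using positions by auto

lemma position_cases:
  assumes "i < N" obtains c where "c \<in> C" "i = first_pos c" | c where "c \<in> C" "i = last_pos c"
  using assms positions by blast

lemma sum_positions: "(\<Sum>i<N. g i) = (\<Sum>c\<in>C. g (first_pos c) + g (last_pos c))"
  for g :: "nat \<Rightarrow> rat"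
proof -
  have "(\<Sum>i<N. g i) = (\<Sum>i\<in>first_pos ` C. g i) + (\<Sum>i\<in>last_pos ` C. g i)"
    unfolding positions[symmetric] by (rule sum.union_disjoint)
        (use finite_C first_pos_neq_last_pos in auto)
  then show ?thesis by (simp add: sum.reindex[OF inj_first_pos] sum.reindex[OF inj_last_pos]
      sum.distrib)
qed

text \<open>
  If \<open>d\<close> has both ends strictly between those of \<open>c\<close>, its contributions \<open>x d\<close> and
  \<open>- x d\<close> cancel. If it has one, then the chords cross, and that end is the first one of \<open>d\<close>
  precisely if \<open>c\<close> comes first.
\<close>

lemma sum_between_ends:
  fixes X :: "nat \<Rightarrow> rat"
  assumes X: "\<And>d. d \<in> C \<Longrightarrow> X (first_pos d) = x d" "\<And>d. d \<in> C \<Longrightarrow> X (last_pos d) = - x d" and c: "c \<in> C"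
  shows "(\<Sum>i\<in>{first_pos c<..<last_pos c}. X i) = (\<Sum>d\<in>C. crossing_sign c d * x d)"
proof -
  have "(\<Sum>i\<in>{first_pos c<..<last_pos c}. X i) = (\<Sum>i<N. if first_pos c < i
      \<and> i < last_pos c then X i else 0)"
  proof -
    have "{i \<in> {..<N}. first_pos c < i \<and> i < last_pos c} = {first_pos c<..<last_pos c}"
        using last_pos_bound[OF c] by auto
    then show ?thesis by (simp add: sum.inter_filter[symmetric])
  qed
  also have "\<dots> = (\<Sum>d\<in>C. (if first_pos c < first_pos d
      \<and> first_pos d < last_pos c then X (first_pos d) else 0) + (if first_pos c < last_pos d
      \<and> last_pos d < last_pos c then X (last_pos d) else 0))"
    by (rule sum_positions)
  also have "\<dots> = (\<Sum>d\<in>C. crossing_sign c d * x d)"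
  proof (rule sum.cong[OF refl])
    fix d assume d: "d \<in> C"
    have "first_pos c = first_pos d \<longleftrightarrow> c = d" "last_pos c = last_pos d \<longleftrightarrow> c
        = d" "first_pos c \<noteq> last_pos d" "last_pos c \<noteq> first_pos d"
      using c d inj_first_pos inj_last_pos first_pos_neq_last_pos[OF c d] first_pos_neq_last_pos[OF
          d c] by (auto simp: inj_on_def)
    then show "(if first_pos c < first_pos d \<and> first_pos d < last_pos c then X (first_pos d) else 0)
        + (if first_pos c < last_pos d \<and> last_pos d < last_pos c then X (last_pos d) else 0)
       = crossing_sign c d * x d"
      using first_pos_less_last_pos[OF c] first_pos_less_last_pos[OF d]
          unfolding X[OF d] crossing_sign_def
      by (cases "c = d") (auto simp: not_less)
  qed
  finally show ?thesis .
qed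

lemma telescope:
  fixes f :: "nat \<Rightarrow> rat"
  assumes "i < j" "\<And>k. i < k \<Longrightarrow> k < j \<Longrightarrow> X k = f k - f (k - 1)"
  shows "(\<Sum>k\<in>{i<..<j}. X k) = f (j - 1) - f i"
proof -
  have "(\<Sum>k\<in>{i<..<j}. X k) = (\<Sum>k\<in>{Suc i..<j}. f k - f (k - 1))"
    using assms(2) by (intro sum.cong) auto
  also have "\<dots> = f (j - 1) - f i"
    using assms(1) by (induction j) (auto simp: less_Suc_eq atLeastLessThanSuc)
  finally show ?thesis .
qed

text \<open>
  The jumps strictly between the ends of \<open>c\<close> lead from the gap after its first end to the gap before
  its last end, and \<open>f\<close> takes the same value on both.
\<close>

lemma compatible_imp_kernel:
  fixes f :: "nat \<Rightarrow> rat"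
  assumes f: "compatible f" and c: "c \<in> C"
  shows "(\<Sum>d\<in>C. crossing_sign c d * (f (first_pos d) - f (last_pos d))) = 0"
proof -
  define X where "X = (\<lambda>i. f i - f (pred i))"
  have "(\<Sum>d\<in>C. crossing_sign c d * (f (first_pos d) - f (last_pos d)))
      = (\<Sum>i\<in>{first_pos c<..<last_pos c}. X i)"
    by (rule sum_between_ends[symmetric, OF _ _ c]) (use f in \<open>auto simp: X_def compatible_def\<close>)
  also have "\<dots> = f (last_pos c - 1) - f (first_pos c)"
    by (rule telescope[OF first_pos_less_last_pos[OF c]]) (auto simp: X_def pred_def)
  also have "\<dots> = 0"
    using f c first_pos_less_last_pos[OF c] by (auto simp: compatible_def pred_def)
  finally show ?thesis .
qed

lemma compatible_no_jumps:
  fixes f :: "nat \<Rightarrow> rat"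
  assumes f: "compatible f" and eq: "\<And>c. c \<in> C \<Longrightarrow> f (first_pos c) = f (last_pos c)" and i: "i < N"
  shows "f i = f 0"
  using i
proof (induction i)
  case (Suc i)
  have "f (Suc i) = f (pred (Suc i))"
    using Suc.prems
  proof (cases rule: position_cases)
    case (1 c) then show ?thesis using f eq by (auto simp: compatible_def)
  next
    case (2 c) then show ?thesis using f eq by (auto simp: compatible_def)
  qed
  then show ?case using Suc by (simp add: pred_def)
qed simp

text \<open>
  Prescribing the jump \<open>x c\<close> at the first and \<open>- x c\<close> at the last end of \<open>c\<close>, the jumps sum to
  \<open>0\<close> over the whole circle. So their partial sums are consistent also across the base point,
      and the
  kernel equation for \<open>c\<close> is the compatibility along one side of its band; the other side then
  follows from the prescribed jumps.
\<close>

lemma kernel_imp_compatible: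
  assumes x: "\<And>c. c \<in> C \<Longrightarrow> (\<Sum>d\<in>C. crossing_sign c d * x d) = 0"
  obtains f :: "nat \<Rightarrow> rat" where "compatible f" "\<And>c. c \<in> C \<Longrightarrow> f (first_pos c) - f (last_pos c) = x c"
proof -
  define X where "X = (\<lambda>i. if i \<in> first_pos ` C then x (inv_into C first_pos i) else - x (inv_into C
      last_pos i))"
  have X_first: "X (first_pos c) = x c" and X_last: "X (last_pos c) = - x c" if "c \<in> C" for c
  proof -
    have "last_pos c \<notin> first_pos ` C" by (metis first_pos_neq_last_pos imageE that)
    then show "X (first_pos c) = x c" "X (last_pos c) = - x c" using that inj_first_pos inj_last_pos
        by (simp_all add: X_def)
  qed
  define f where "f = (\<lambda>i. \<Sum>k\<le>i. X k)"
  have total: "(\<Sum>i<N. X i) = 0" by (simp add: sum_positions X_first X_last)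
  have jump: "f i - f (pred i) = X i" if "i < N" for i
  proof (cases i)
    case 0
    have "{..N - 1} = {..<N}" using that by auto
    then show ?thesis using 0 total by (simp add: f_def pred_def)
  next
    case (Suc j) then show ?thesis by (simp add: f_def pred_def)
  qed
  have across: "f (first_pos c) = f (pred (last_pos c))" if c: "c \<in> C" for c
  proof -
    have "0 = (\<Sum>i\<in>{first_pos c<..<last_pos c}. X i)"
        using sum_between_ends[OF X_first X_last c] x[OF c] by simp
    also have "\<dots> = f (last_pos c - 1) - f (first_pos c)"
    proof (rule telescope[OF first_pos_less_last_pos[OF c]])
      fix k assume "first_pos c < k" "k < last_pos c"
      then show "X k = f k - f (k - 1)" using jump[of k] last_pos_bound[OF c]
          by (simp add: pred_def)
    qed
    finally show ?thesis using first_pos_less_last_pos[OF c] by (auto simp: pred_def)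
  qed
  have "f (last_pos c) = f (pred (first_pos c))" if c: "c \<in> C" for c
    using jump[OF first_pos_bound[OF c]] jump[OF last_pos_bound[OF c]] X_first[OF c] X_last[OF c]
        across[OF c] by simp
  then have "compatible f" using across by (simp add: compatible_def)
  moreover have "f (first_pos c) - f (last_pos c) = x c" if c: "c \<in> C" for c
    using jump[OF last_pos_bound[OF c]] X_last[OF c] across[OF c] by simp
  ultimately show thesis by (rule that)
qed

text \<open>
  Assigning to a compatible function its jumps at the first ends maps the compatible functions onto
  the kernel, and only constants have no jumps. When the compatible functions are precisely the
  functions of the classes \<open>cc i\<close>, their dimension is the number of classes. Requiring the value
  \<open>0\<close> on one class removes the constants.
\<close>

theorem kernel_dim_crossing_matrix:
  fixes A :: "rat mat" and cc :: "nat \<Rightarrow> 'k"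
  assumes A: "A \<in> carrier_mat n n" and row_index: "bij_betw row_index C {..<n}"
    and entries: "\<And>c d. c \<in> C \<Longrightarrow> d \<in> C \<Longrightarrow> A $$ (row_index c, row_index d) = crossing_sign c d"
    and N: "N > 0" and cc: "compatible cc"
    and fibres: "\<And>f :: nat \<Rightarrow> rat. \<And>i j. compatible f \<Longrightarrow> i < N \<Longrightarrow> j < N \<Longrightarrow> cc i = cc j \<Longrightarrow> f i = f j"
  shows "kernel_dim A + 1 = card (cc ` {..<N})"
proof -
  define m where "m = card (cc ` {..<N})"
  have m: "m > 0" using N by (auto simp: m_def card_gt_0_iff)
  obtain \<rho> where \<rho>: "bij_betw \<rho> (cc ` {..<N}) {..<m}"
    using ex_bij_betw_finite_nat[of "cc ` {..<N}"] by (auto simp: m_def atLeast0LessThan)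
  define \<kappa> where "\<kappa> = (\<lambda>i. \<rho> (cc i))"
  have \<kappa>_less: "\<kappa> i < m" if "i < N" for i using \<rho> that by (auto simp: \<kappa>_def bij_betw_def)
  have \<kappa>_surj: "\<exists>i<N. \<kappa> i = j" if "j < m" for j
  proof -
    have "j \<in> \<rho> ` cc ` {..<N}" using \<rho> that by (simp add: bij_betw_def)
    then show ?thesis by (auto simp: \<kappa>_def)
  qed
  have \<kappa>_eq: "\<kappa> i = \<kappa> j \<longleftrightarrow> cc i = cc j" if "i < N" "j < N" for i j
    using \<rho> that by (auto simp: \<kappa>_def bij_betw_def inj_on_def)
  have \<kappa>_comp: "compatible (\<lambda>i. g (\<kappa> i))" for g :: "nat \<Rightarrow> rat"
    using cc by (simp add: compatible_def \<kappa>_def)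
  define ch where "ch = inv_into C row_index"
  have ch: "ch k \<in> C" "row_index (ch k) = k" if "k < n" for k
    using row_index that unfolding ch_def by (metis bij_betw_def inv_into_into lessThan_iff, metis
        bij_betw_inv_into_right lessThan_iff)
  have ch_row: "ch (row_index c) = c" "row_index c < n" if "c \<in> C" for c
    using row_index that by (auto simp: ch_def bij_betw_def)
  have mem: "y \<in> mat_kernel A \<longleftrightarrow> y \<in> carrier_vec n
      \<and> (\<forall>c\<in>C. (\<Sum>d\<in>C. crossing_sign c d * y $ row_index d) = 0)" for y
  proof -
    have "(A *\<^sub>v y) $ row_index c = (\<Sum>d\<in>C. crossing_sign c d * y $ row_index d)"
        if y: "y \<in> carrier_vec n" and c: "c \<in> C" for c
    proof -
      have "(A *\<^sub>v y) $ row_index c = (\<Sum>k<n. A $$ (row_index c, k) * y $ k)"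
        using y A ch_row[OF c] by (auto simp: scalar_prod_def atLeast0LessThan intro!: sum.cong)
      also have "\<dots> = (\<Sum>d\<in>C. A $$ (row_index c, row_index d) * y $ row_index d)"
        by (rule sum.reindex_bij_betw[OF row_index, symmetric])
      finally show ?thesis using entries c by simp
    qed
    moreover have "A *\<^sub>v y = 0\<^sub>v n \<longleftrightarrow> (\<forall>c\<in>C. (A *\<^sub>v y) $ row_index c = 0)"
    proof
      assume "\<forall>c\<in>C. (A *\<^sub>v y) $ row_index c = 0"
      then have "(A *\<^sub>v y) $ k = 0" if "k < n" for k using ch[OF that] by metis
      then show "A *\<^sub>v y = 0\<^sub>v n" using A by (intro eq_vecI) auto
    qed (use ch_row in auto)
    ultimately show ?thesis unfolding mat_kernel[OF A] by auto
  qed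
  \<comment> \<open>The class numbered m - 1 is the one on which functions are normalized to 0.\<close>
  define ext where "ext = (\<lambda>(v :: rat vec) j. if j < m - 1 then v $ j else 0)"
  define T where "T = (\<lambda>v. vec n (\<lambda>k. ext v (\<kappa> (first_pos (ch k))) - ext v (\<kappa> (last_pos (ch k)))))"
  have T_row: "T v $ row_index c = ext v (\<kappa> (first_pos c)) - ext v (\<kappa> (last_pos c))" if "c \<in> C"
      for v c
    using ch_row[OF that] by (simp add: T_def)
  interpret K: kernel n n A by unfold_locales (rule A)
  have bij: "bij_betw T (carrier_vec (m - 1)) (mat_kernel A)"
    unfolding bij_betw_def
  proof (intro conjI)
    show "inj_on T (carrier_vec (m - 1))"
    proof (rule inj_onI)
      fix u v assume uv: "u \<in> carrier_vec (m - 1)" "v \<in> carrier_vec (m - 1)" and eq: "T u = T v"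
      define f where "f = (\<lambda>i. ext u (\<kappa> i) - ext v (\<kappa> i))"
      have const: "f i = f 0" if "i < N" for i
      proof (rule compatible_no_jumps[OF _ _ that])
        show "compatible f" unfolding f_def by (rule \<kappa>_comp)
        fix c assume c: "c \<in> C"
        show "f (first_pos c) = f (last_pos c)" using T_row[OF c, of u] T_row[OF c, of v] eq
            by (simp add: f_def)
      qed
      have "ext u j = ext v j" if j: "j < m" for j
      proof -
        obtain i where i: "i < N" "\<kappa> i = j" using \<kappa>_surj[OF j] by blast
        obtain i' where i': "i' < N" "\<kappa> i' = m - 1" using \<kappa>_surj[of "m - 1"] m by auto
        have "f i = f i'" using const[OF i(1)] const[OF i'(1)] by simp
        then show ?thesis unfolding f_def i(2) i'(2) by (simp add: ext_def)
      qed
      note ext_eq = this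
      have "u $ j = v $ j" if "j < m - 1" for j using ext_eq[of j] that by (simp add: ext_def)
      then show "u = v" using uv by (intro eq_vecI) auto
    qed
    show "T ` carrier_vec (m - 1) = mat_kernel A"
    proof
      show "T ` carrier_vec (m - 1) \<subseteq> mat_kernel A"
        using compatible_imp_kernel[OF \<kappa>_comp] by (auto simp: mem T_row) (simp add: T_def)
      show "mat_kernel A \<subseteq> T ` carrier_vec (m - 1)"
      proof
        fix y assume "y \<in> mat_kernel A"
        then have y: "y \<in> carrier_vec n" and ker: "\<And>c. c \<in> C
            \<Longrightarrow> (\<Sum>d\<in>C. crossing_sign c d * y $ row_index d) = 0"
          by (auto simp: mem)
        obtain f :: "nat \<Rightarrow> rat" where f: "compatible f" "\<And>c. c \<in> C
            \<Longrightarrow> f (first_pos c) - f (last_pos c) = y $ row_index c"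
          using kernel_imp_compatible[of "\<lambda>c. y $ row_index c"] ker by blast
        define g where "g = (\<lambda>j. f (SOME i. i < N \<and> \<kappa> i = j))"
        have g: "g (\<kappa> i) = f i" if i: "i < N" for i
        proof -
          have "(SOME k. k < N \<and> \<kappa> k = \<kappa> i) < N \<and> \<kappa> (SOME k. k < N \<and> \<kappa> k = \<kappa> i) = \<kappa> i"
            by (rule someI[of _ i]) (use i in simp)
          then show ?thesis unfolding g_def using fibres[OF f(1)] \<kappa>_eq i by blast
        qed
        define v where "v = vec (m - 1) (\<lambda>j. g j - g (m - 1))"
        have ext_v: "ext v (\<kappa> i) = f i - g (m - 1)" if "i < N" for i
        proof (cases "\<kappa> i = m - 1")
          case False
          then have "\<kappa> i < m - 1" using \<kappa>_less[OF that] by simp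
          then show ?thesis using g[OF that] by (simp add: ext_def v_def)
        qed (use g[OF that] in \<open>simp add: ext_def\<close>)
        have "T v = y"
        proof (rule eq_vecI)
          fix k assume "k < dim_vec y"
          then have k: "k < n" using y by simp
          show "T v $ k = y $ k"
            using T_row[OF ch(1)[OF k], of v] f(2)[OF ch(1)[OF k]] first_pos_bound last_pos_bound
                ch[OF k] ext_v by simp
        qed (use y in \<open>simp add: T_def\<close>)
        then show "y \<in> T ` carrier_vec (m - 1)" by (intro image_eqI[of _ _ v]) (simp_all add: v_def)
      qed
    qed
  qed
  have "vectorspace.dim class_ring K.VK = m - 1"
  proof (rule bijective_coordinates_dim(2))
    show "vectorspace class_ring K.VK" by (rule K.Ker.vectorspace_axioms)
    show "bij_betw T (carrier_vec (m - 1)) (carrier K.VK)" using bij by simp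
    show "T (u + v) = T u \<oplus>\<^bsub>K.VK\<^esub> T v" if "u \<in> carrier_vec (m - 1)" "v \<in> carrier_vec (m - 1)"
        for u v
      using that by (auto simp: T_def ext_def module_vec_simps)
    show "T (r \<cdot>\<^sub>v v) = r \<odot>\<^bsub>K.VK\<^esub> T v" if "v \<in> carrier_vec (m - 1)" for r v
      using that by (auto simp: T_def ext_def module_vec_simps algebra_simps)
  qed
  then have "kernel_dim A = m - 1" using K.kernel_dim by simp
  then show ?thesis using m by (simp add: m_def)
qed

end

lemma kernel_dim_empty:
  assumes A: "(A :: rat mat) \<in> carrier_mat 0 0" shows "kernel_dim A = 0"
proof -
  interpret K: kernel 0 0 A by unfold_locales (rule A)
  have ker: "mat_kernel A = carrier_vec 0" unfolding mat_kernel[OF A] using A by auto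
  have "vectorspace.dim class_ring K.VK = 0"
    by (rule bijective_coordinates_dim(2)[OF K.Ker.vectorspace_axioms, of "\<lambda>v. v"])
       (auto simp: bij_betw_def ker module_vec_simps)
  then show ?thesis using K.kernel_dim by simp
qed

text \<open>
  The matrices \<open>A\<close> and \<open>- A\<close> have the same kernel.
\<close>

lemma kernel_dim_transpose_skew:
  fixes A :: "rat mat"
  assumes A: "A \<in> carrier_mat n n" and skew: "transpose_mat A = - A"
  shows "kernel_dim (transpose_mat A) = kernel_dim A"
proof -
  have "mat_kernel (- A) = mat_kernel A"
  proof -
    have "(- A) *\<^sub>v v = - (A *\<^sub>v v)" if "v \<in> carrier_vec n" for v
      using that A by (intro eq_vecI) (auto simp: scalar_prod_def sum_negf)
    moreover have "- u = 0\<^sub>v n \<longleftrightarrow> u = 0\<^sub>v n" if "u \<in> carrier_vec n" for u :: "rat vec"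
      using that by (auto simp: vec_eq_iff)
    ultimately show ?thesis
      unfolding mat_kernel[OF A] mat_kernel[OF uminus_carrier_mat[OF A]]
      using A by auto
  qed
  then show ?thesis unfolding skew kernel_dim_def using A by simp
qed

section \<open>The matrix of a chord diagram\<close>

lemma rank_less_iff:
  fixes g :: "'a \<Rightarrow> real"
  assumes S: "finite S" and xy: "x \<in> S" "y \<in> S"
  shows "card {z \<in> S. g z < g x} < card {z \<in> S. g z < g y} \<longleftrightarrow> g x < g y"
proof
  assume "g x < g y"
  then have "{z \<in> S. g z < g x} \<subseteq> {z \<in> S. g z < g y}" "x \<in> {z \<in> S. g z < g y}" using xy by auto
  moreover have "x \<notin> {z \<in> S. g z < g x}" by simp
  ultimately have "{z \<in> S. g z < g x} \<subset> {z \<in> S. g z < g y}" by blast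
  then show "card {z \<in> S. g z < g x} < card {z \<in> S. g z < g y}" using S
      by (intro psubset_card_mono) auto
next
  assume less: "card {z \<in> S. g z < g x} < card {z \<in> S. g z < g y}"
  show "g x < g y"
  proof (rule ccontr)
    assume "\<not> g x < g y"
    then have "{z \<in> S. g z < g y} \<subseteq> {z \<in> S. g z < g x}" by auto
    then have "card {z \<in> S. g z < g y} \<le> card {z \<in> S. g z < g x}" using S by (intro card_mono) auto
    then show False using less by simp
  qed
qed

lemma rank_bij_betw:
  fixes g :: "'a \<Rightarrow> real"
  assumes S: "finite S" and g: "inj_on g S"
  shows "bij_betw (\<lambda>x. card {y \<in> S. g y < g x}) S {..<card S}"
  unfolding bij_betw_def
proof
  show inj: "inj_on (\<lambda>x. card {y \<in> S. g y < g x}) S"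
  proof (rule inj_onI, rule ccontr)
    fix x y assume xy: "x \<in> S" "y \<in> S" and eq: "card {z \<in> S. g z < g x} = card {z \<in> S. g z < g y}"
        and "x \<noteq> y"
    then have "g x \<noteq> g y" using g by (auto simp: inj_on_def)
    then have "g x < g y \<or> g y < g x" by linarith
    then show False using rank_less_iff[OF S xy, of g] rank_less_iff[OF S xy(2,1), of g] eq by auto
  qed
  have "card {y \<in> S. g y < g x} < card S" if "x \<in> S" for x
    using that S by (intro psubset_card_mono) auto
  then have "(\<lambda>x. card {y \<in> S. g y < g x}) ` S \<subseteq> {..<card S}" by auto
  then show "(\<lambda>x. card {y \<in> S. g y < g x}) ` S = {..<card S}"
    using card_image[OF inj] by (intro card_subset_eq) auto
qed

context band_diagram begin

definition N :: nat where "N = card (\<Union>B)"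

definition pos :: "complex \<Rightarrow> nat" where "pos p = card {q \<in> \<Union>B. angle q < angle p}"

definition first_pos :: "complex set \<Rightarrow> nat" where "first_pos c = pos (first c)"
definition last_pos :: "complex set \<Rightarrow> nat" where "last_pos c = pos (last c)"

lemma pos_bij: "bij_betw pos (\<Union>B) {..<N}"
  unfolding pos_def N_def
  by (rule rank_bij_betw[OF finite_endpoints]) (use angle_inj norm_endpoint
      in \<open>blast intro: inj_onI\<close>)

lemma pos_less_iff: "p \<in> \<Union>B \<Longrightarrow> q \<in> \<Union>B \<Longrightarrow> pos p < pos q \<longleftrightarrow> angle p < angle q"
  unfolding pos_def by (rule rank_less_iff[OF finite_endpoints])

lemma pos_eq_iff: "p \<in> \<Union>B \<Longrightarrow> q \<in> \<Union>B \<Longrightarrow> pos p = pos q \<longleftrightarrow> p = q"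
  using pos_bij by (auto simp: bij_betw_def inj_on_def)

sublocale gauss: gauss_diagram B N first_pos last_pos
proof
  have "\<Union>B = first ` B \<union> last ` B" using chord_ends(1) by blast
  then have "pos ` (first ` B \<union> last ` B) = {..<N}" using pos_bij by (simp add: bij_betw_def)
  then show "first_pos ` B \<union> last_pos ` B = {..<N}"
      by (simp add: first_pos_def last_pos_def image_Un image_image)
  show "inj_on first_pos B" by (rule inj_onI) (simp add: first_pos_def pos_eq_iff[OF first_in
      first_in] first_inj)
  show "inj_on last_pos B" by (rule inj_onI) (simp add: last_pos_def pos_eq_iff[OF last_in last_in]
      last_inj)
  show "first_pos c \<noteq> last_pos d" if "c \<in> B" "d \<in> B" for c d
    using that by (simp add: first_pos_def last_pos_def pos_eq_iff[OF first_in last_in]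
        first_neq_last)
  show "first_pos c < last_pos c" if "c \<in> B" for c
    using that by (simp add: first_pos_def last_pos_def pos_less_iff[OF first_in last_in]
        chord_ends(2))
qed (rule finite_B)

lemma angle_first_eq_iff: "c \<in> B \<Longrightarrow> d \<in> B \<Longrightarrow> angle (first c) = angle (first d) \<longleftrightarrow> c = d"
  using angle_inj[OF norm_endpoint[OF first_in] norm_endpoint[OF first_in]] first_inj by blast

lemma chord_label_eq:
  assumes c: "c \<in> B"
  shows "chord_label b B c = Suc (card {d \<in> B. angle (first d) < angle (first c)})"
proof -
  have "{d \<in> B. angle (first d) \<le> angle (first c)}
      = insert c {d \<in> B. angle (first d) < angle (first c)}"
    using c angle_first_eq_iff by (auto simp: order_le_less)
  then show ?thesis using finite_B by (simp add: chord_label_def)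
qed

text \<open>
  Labels start at \<open>1\<close>, rows and columns at \<open>0\<close>.
\<close>

definition row_index :: "complex set \<Rightarrow> nat" where "row_index c = chord_label b B c - 1"

lemma Suc_row_index: "c \<in> B \<Longrightarrow> chord_label b B c = Suc (row_index c)"
  by (simp add: row_index_def chord_label_eq)

lemma row_index_bij: "bij_betw row_index B {..<card B}"
proof -
  have "inj_on (\<lambda>c. angle (first c)) B"
    by (rule inj_onI) (simp add: angle_first_eq_iff)
  from rank_bij_betw[OF finite_B this] show ?thesis
    by (rule bij_betw_cong[THEN iffD1, rotated]) (simp add: row_index_def chord_label_eq)
qed

lemma row_index_less_iff: "c \<in> B \<Longrightarrow> d \<in> B \<Longrightarrow> row_index c < row_index d \<longleftrightarrow> first_pos c < first_pos d"
  using rank_less_iff[OF finite_B, of c d "\<lambda>c. angle (first c)"]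
  by (simp add: row_index_def chord_label_eq first_pos_def pos_less_iff[OF first_in first_in])

abbreviation A :: "rat mat" where "A \<equiv> skew_adjacency (canonical_graph b B)"

lemma chord_label_inj: "c \<in> B \<Longrightarrow> d \<in> B \<Longrightarrow> chord_label b B c = chord_label b B d \<Longrightarrow> c = d"
  using row_index_bij by (auto simp: Suc_row_index bij_betw_def inj_on_def)

lemma card_vertices: "card (pverts (canonical_graph b B)) = card B"
proof -
  have "inj_on (chord_label b B) B" using chord_label_inj by (rule inj_onI)
  then show ?thesis by (simp add: canonical_graph_def card_image)
qed

lemma A_carrier: "A \<in> carrier_mat (card B) (card B)"
  by (simp add: skew_adjacency_def card_vertices Let_def)

lemma arcs_iff:
  "c \<in> B \<Longrightarrow> d \<in> B \<Longrightarrow>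
     (Suc (row_index c), Suc (row_index d)) \<in> parcs (canonical_graph b B) \<longleftrightarrow> chords_cross b c d
         \<and> row_index c < row_index d"
proof
  assume cd: "c \<in> B" "d \<in> B" and "(Suc (row_index c), Suc (row_index d)) \<in> parcs (canonical_graph b
      B)"
  then obtain c' d' where "c' \<in> B" "d' \<in> B" "chords_cross b c' d'" "chord_label b B c' < chord_label
      b B d'"
    "chord_label b B c = chord_label b B c'" "chord_label b B d = chord_label b B d'"
    by (auto simp: canonical_graph_def Suc_row_index)
  note cd' = this
  have "c = c'" by (rule chord_label_inj[OF cd(1) cd'(1,5)])
  moreover have "d = d'" by (rule chord_label_inj[OF cd(2) cd'(2,6)])
  ultimately show "chords_cross b c d \<and> row_index c < row_index d" using cd'(3,4) cd
      by (simp add: Suc_row_index)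
next
  assume cd: "c \<in> B" "d \<in> B" "chords_cross b c d \<and> row_index c < row_index d"
  then have "chord_label b B c < chord_label b B d" by (simp add: Suc_row_index)
  then have "(chord_label b B c, chord_label b B d) \<in> parcs (canonical_graph b B)"
    using cd unfolding canonical_graph_def pair_pre_digraph.simps mem_Collect_eq
    by (intro exI[of _ c] exI[of _ d]) simp
  then show "(Suc (row_index c), Suc (row_index d)) \<in> parcs (canonical_graph b B)" using cd
      by (simp only: Suc_row_index)
qed

lemma chords_cross_sym: "chords_cross b c d = chords_cross b d c"
  by (auto simp: chords_cross_def Let_def)

lemma chords_cross_iff:
  "c \<in> B \<Longrightarrow> d \<in> B \<Longrightarrow> chords_cross b c d \<longleftrightarrow>
     first_pos c < first_pos d \<and> first_pos d < last_pos c
         \<and> last_pos c < last_pos d \<or> first_pos d < first_pos c \<and> first_pos c < last_pos d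
         \<and> last_pos d < last_pos c"
  by (simp add: chords_cross_def Let_def first_pos_def last_pos_def pos_less_iff[OF first_in
      first_in]
      pos_less_iff[OF first_in last_in] pos_less_iff[OF last_in last_in])

text \<open>
  Both sides encode crossing and the order of the first ends, once by angles and labels and once by
  positions.
\<close>

lemma A_entry:
  assumes c: "c \<in> B" and d: "d \<in> B"
  shows "A $$ (row_index c, row_index d) = gauss.crossing_sign c d"
proof -
  have less: "row_index c < card B" "row_index d < card B" using row_index_bij c d
      by (auto simp: bij_betw_def)
  have "A $$ (row_index c, row_index d) = (if chords_cross b c d \<and> row_index c < row_index d then 1
     else if chords_cross b c d \<and> row_index d < row_index c then -1 else 0)"
    using less chords_cross_sym[of d c] by (simp add: skew_adjacency_def card_vertices Let_def
        arcs_iff[OF c d] arcs_iff[OF d c]) blast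
  then show ?thesis
    by (auto simp: gauss.crossing_sign_def chords_cross_iff[OF c d] chords_cross_iff[OF d c]
        row_index_less_iff[OF c d] row_index_less_iff[OF d c])
qed

lemma A_skew: "transpose_mat A = - A"
  by (rule eq_matI) (auto simp: skew_adjacency_def Let_def)

end

section \<open>Walking along the boundary\<close>

datatype boundary_edge = Gap nat | Left_Side "complex set" | Right_Side "complex set"

context band_diagram begin

definition angle_at :: "nat \<Rightarrow> real" where "angle_at i = angle (inv_into (\<Union>B) pos i)"

text \<open>
  After the last endpoint the walk passes the base point, hence the additional full turn.
\<close>

definition next_angle :: "nat \<Rightarrow> real" where "next_angle i
    = (if Suc i < N then angle_at (Suc i) else angle_at 0 + 2 * pi)"

definition succ :: "nat \<Rightarrow> nat" where "succ i = (if Suc i < N then Suc i else 0)"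

lemma endpoint_at:
  assumes "i < N" obtains p where "p \<in> \<Union>B" "pos p = i" "angle_at i = angle p" "p
      = b * cis (angle_at i)"
proof -
  have i: "i \<in> pos ` \<Union>B" using pos_bij assms by (simp add: bij_betw_def)
  show thesis
    by (rule that[of "inv_into (\<Union>B) pos i"])
      (use inv_into_into[OF i] f_inv_into_f[OF i] eq_cis_angle norm_endpoint
          in \<open>auto simp: angle_at_def\<close>)
qed

lemma angle_at_pos: "p \<in> \<Union>B \<Longrightarrow> angle_at (pos p) = angle p"
  using pos_bij by (simp add: angle_at_def bij_betw_def)

lemma cis_angle_at_pos: "p \<in> \<Union>B \<Longrightarrow> b * cis (angle_at (pos p)) = p"
  using angle_at_pos eq_cis_angle norm_endpoint by metis

lemma pos_bound: "p \<in> \<Union>B \<Longrightarrow> pos p < N"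
  using pos_bij by (auto simp: bij_betw_def)

lemma angle_at_mono: assumes "i < j" "j < N" shows "angle_at i < angle_at j"
proof -
  have "i < N" using assms by simp
  then obtain p where p: "p \<in> \<Union>B" "pos p = i" "angle_at i = angle p" by (rule endpoint_at)
  obtain q where q: "q \<in> \<Union>B" "pos q = j" "angle_at j = angle q" using assms(2) by (rule endpoint_at)
  show ?thesis using pos_less_iff[OF p(1) q(1)] p(2,3) q(2,3) assms(1) by simp
qed

lemma angle_at_mono_le: "i \<le> j \<Longrightarrow> j < N \<Longrightarrow> angle_at i \<le> angle_at j"
  using angle_at_mono[of i j] by (cases "i = j") auto

lemma angle_at_range: "i < N \<Longrightarrow> 0 \<le> angle_at i \<and> angle_at i < 2 * pi"
  using angle_range by (simp add: angle_at_def)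

lemma angle_at_window: "i < N \<Longrightarrow> angle_at 0 \<le> angle_at i \<and> next_angle i \<le> angle_at 0 + 2 * pi"
  using angle_at_mono_le[of 0 i] angle_at_range[of "Suc i"] angle_at_range[of 0]
      by (auto simp: next_angle_def)

lemma angle_at_less_next: "i < N \<Longrightarrow> angle_at i < next_angle i"
  using angle_at_mono[of i "Suc i"] angle_at_range[of i] angle_at_range[of 0]
      by (auto simp: next_angle_def)

lemma next_angle_le_angle_at: "i < j \<Longrightarrow> j < N \<Longrightarrow> next_angle i \<le> angle_at j"
  using angle_at_mono_le[of "Suc i" j] by (auto simp: next_angle_def)

lemma succ_less: "i < N \<Longrightarrow> succ i < N" by (simp add: succ_def)

lemma cis_next_angle: "cis (next_angle i) = cis (angle_at (succ i))"
  by (simp add: next_angle_def succ_def flip: cis_mult)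

lemma pred_succ: "i < N \<Longrightarrow> gauss.pred (succ i) = i"
  by (auto simp: succ_def gauss.pred_def)

lemma succ_pred: "i < N \<Longrightarrow> succ (gauss.pred i) = i"
  by (auto simp: succ_def gauss.pred_def)

lemma pred_less: "i < N \<Longrightarrow> gauss.pred i < N"
  by (auto simp: gauss.pred_def)

text \<open>
  The half-open intervals between consecutive endpoints subdivide a single turn that starts at the
  first endpoint.
\<close>

lemma angle_unique:
  assumes ij: "i < N" "j < N" and \<psi>: "angle_at i \<le> \<psi>" "\<psi> < next_angle i"
      and \<psi>': "angle_at j \<le> \<psi>'" "\<psi>' < next_angle j"
    and eq: "b * cis \<psi> = b * cis \<psi>'"
  shows "i = j \<and> \<psi> = \<psi>'"
proof -
  have "cis \<psi> = cis \<psi>'" using eq b_nonzero by simp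
  moreover have "\<bar>\<psi> - \<psi>'\<bar> < 2 * pi" using angle_at_window[OF ij(1)] angle_at_window[OF ij(2)] \<psi> \<psi>'
      by linarith
  ultimately have e: "\<psi> = \<psi>'" by (rule cis_eq_imp_eq)
  then show ?thesis using next_angle_le_angle_at[of i j] next_angle_le_angle_at[of j i] ij \<psi> \<psi>'
      by (cases i j rule: linorder_cases) auto
qed

lemma N_ge_2: assumes "N > 0" shows "N \<ge> 2"
proof -
  obtain c where c: "c \<in> B" using assms by (auto simp: N_def card_gt_0_iff)
  have "card {first c, last c} \<le> N" unfolding N_def
    by (rule card_mono[OF finite_endpoints]) (use first_in[OF c] last_in[OF c] in auto)
  then show ?thesis using first_neq_last[OF c c] by simp
qed

text \<open>
  If two consecutive endpoints were at most \<open>2 w\<close> apart, the midpoint between them would lie on both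
  attaching arcs.
\<close>

lemma gap_nonempty:
  assumes i: "i < N" shows "angle_at i + w < next_angle i - w"
proof (rule ccontr)
  assume no: "\<not> angle_at i + w < next_angle i - w"
  define s where "s = (next_angle i - angle_at i) / 2"
  have s: "\<bar>s\<bar> \<le> w" "\<bar>- s\<bar> \<le> w" using no angle_at_less_next[OF i] by (auto simp: s_def)
  obtain p where p: "p \<in> \<Union>B" "pos p = i" "p = b * cis (angle_at i)" using endpoint_at[OF i] by metis
  obtain q where q: "q \<in> \<Union>B" "pos q = succ i" "q = b * cis (angle_at (succ i))"
      using endpoint_at[OF succ_less[OF i]] by metis
  have "p * cis s = b * cis (angle_at i + s)" using p by (simp add: mult.assoc cis_mult)
  also have "\<dots> = b * cis (next_angle i + - s)" by (simp add: s_def field_simps)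
  also have "\<dots> = q * cis (- s)" unfolding q(3) cis_mult[symmetric] cis_next_angle by simp
  finally have "p = q" by (rule arcs_disjoint[OF p(1) q(1) s])
  then have "succ i = i" using p(2) q(2) by (metis (no_types))
  then show False using N_ge_2 i by (auto simp: succ_def split: if_splits)
qed

text \<open>
  A point of an open attaching arc is less than \<open>w\<close> after its endpoint or less than \<open>w\<close> before it;
      in
  the second case it belongs to the interval that precedes the endpoint.
\<close>

lemma gap_not_in_open_arcs:
  assumes i: "i < N" and \<psi>: "angle_at i + w \<le> \<psi>" "\<psi> \<le> next_angle i - w"
  shows "b * cis \<psi> \<notin> open_arcs"
proof
  assume "b * cis \<psi> \<in> open_arcs"
  then obtain p s where ps: "p \<in> \<Union>B" "\<bar>s\<bar> < w" "b * cis \<psi> = p * cis s" by (auto simp: open_arcs_def)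
  define j where "j = pos p"
  have j: "j < N" using pos_bound[OF ps(1)] by (simp add: j_def)
  have pj: "p = b * cis (angle_at j)" using cis_angle_at_pos[OF ps(1)] by (simp add: j_def)
  have wi: "angle_at i \<le> \<psi>" "\<psi> < next_angle i" using \<psi> w_pos by auto
  show False
  proof (cases "s \<ge> 0")
    case True
    have "b * cis \<psi> = b * cis (angle_at j + s)" using ps(3) pj by (simp add: mult.assoc cis_mult)
    then have "i = j \<and> \<psi> = angle_at j + s"
      using angle_unique[OF i j wi, of "angle_at j + s"] True ps(2) gap_nonempty[OF j] w_pos by simp
    then show False using \<psi> ps(2) by simp
  next
    case False
    define k where "k = gauss.pred j"
    have k: "k < N" using pred_less[OF j] by (simp add: k_def)
    have "cis (next_angle k) = cis (angle_at j)" using cis_next_angle[of k] succ_pred[OF j]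
        by (simp add: k_def)
    then have "b * cis \<psi> = b * cis (next_angle k + s)" using ps(3) pj
        by (simp add: mult.assoc flip: cis_mult)
    then have "i = k \<and> \<psi> = next_angle k + s"
      using angle_unique[OF i k wi, of "next_angle k + s"] False ps(2) gap_nonempty[OF k] w_pos
          by simp
    then show False using \<psi> ps(2) by simp
  qed
qed

lemma circle_minus_open_arcs:
  assumes N: "N > 0" and z: "norm z = 1" "z \<notin> open_arcs"
  obtains i \<psi> where "i < N" "angle_at i + w \<le> \<psi>" "\<psi> \<le> next_angle i - w" "z = b * cis \<psi>"
proof -
  have "\<exists>i \<psi>. i < N \<and> angle_at i \<le> \<psi> \<and> \<psi> < next_angle i \<and> z = b * cis \<psi>"
  proof (cases "angle_at 0 \<le> angle z")
    case True
    define i where "i = Max {i. i < N \<and> angle_at i \<le> angle z}"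
    have fin: "finite {i. i < N \<and> angle_at i \<le> angle z}" by simp
    have "i \<in> {i. i < N \<and> angle_at i \<le> angle z}"
      unfolding i_def by (rule Max_in[OF fin]) (use N True in auto)
    moreover have "angle z < next_angle i"
    proof (cases "Suc i < N")
      case True
      have "\<not> angle_at (Suc i) \<le> angle z" using Max_ge[OF fin, of "Suc i"] True
          by (auto simp: i_def[symmetric])
      then show ?thesis using True by (simp add: next_angle_def)
    next
      case False
      then show ?thesis using angle_range(2)[of z] angle_at_range[OF N]
          by (simp add: next_angle_def)
    qed
    ultimately show ?thesis using eq_cis_angle[OF z(1)] by blast
  next
    case False
    have "z = b * cis (angle z + 2 * pi)" using eq_cis_angle[OF z(1)] by (simp flip: cis_mult)
    moreover have "N - 1 < N" "angle_at (N - 1) \<le> angle z + 2 * pi" "angle z + 2 * pi < next_angle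
        (N - 1)"
      using N False angle_at_range[of "N - 1"] angle_range(1)[of z] by (auto simp: next_angle_def)
    ultimately show ?thesis by blast
  qed
  then obtain i \<psi> where i: "i < N" and \<psi>: "angle_at i \<le> \<psi>" "\<psi> < next_angle i" "z = b * cis \<psi>"
      by blast
  have "angle_at i + w \<le> \<psi>"
  proof (rule ccontr)
    assume "\<not> angle_at i + w \<le> \<psi>"
    obtain p where p: "p \<in> \<Union>B" "p = b * cis (angle_at i)" using endpoint_at[OF i] by metis
    have "z = p * cis (\<psi> - angle_at i)" using p \<psi>(3) by (simp add: mult.assoc cis_mult)
    moreover have "\<bar>\<psi> - angle_at i\<bar> < w" using \<open>\<not> angle_at i + w \<le> \<psi>\<close> \<psi> by simp
    ultimately show False using z(2) p(1) unfolding open_arcs_def by blast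
  qed
  moreover have "\<psi> \<le> next_angle i - w"
  proof (rule ccontr)
    assume "\<not> \<psi> \<le> next_angle i - w"
    obtain p where p: "p \<in> \<Union>B" "p = b * cis (angle_at (succ i))"
        using endpoint_at[OF succ_less[OF i]] by metis
    have "z = p * cis (\<psi> - next_angle i)"
      using \<psi>(3) unfolding p(2) cis_next_angle[symmetric] by (simp add: mult.assoc cis_mult)
    moreover have "\<bar>\<psi> - next_angle i\<bar> < w" using \<open>\<not> \<psi> \<le> next_angle i - w\<close> \<psi> by simp
    ultimately show False using z(2) p(1) unfolding open_arcs_def by blast
  qed
  ultimately show thesis using that i \<psi>(3) by blast
qed

definition edges :: "boundary_edge set" where
  "edges = Gap ` {..<N} \<union> Left_Side ` B \<union> Right_Side ` B"

text \<open>
  The gaps are traversed counter-clockwise, the left sides of the bands from the first to the last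
  end and the right sides from the last to the first.
\<close>

fun edge_point :: "boundary_edge \<Rightarrow> real \<Rightarrow> complex set option \<times> complex" where
  "edge_point (Gap i) t = (None, b * cis ((1 - t) * (angle_at i + w) + t * (next_angle i - w)))"
| "edge_point (Left_Side c) t = (Some c, Complex (-1) t)"
| "edge_point (Right_Side c) t = (Some c, Complex 1 (1 - t))"

definition edge_path :: "boundary_edge \<Rightarrow> real \<Rightarrow> complex set option \<times> complex" where
  "edge_path e t = glue b w B (edge_point e t)"

text \<open>
  At the end of a gap the walk turns into the side of the next band, and since the band is
  untwisted, it arrives after the other endpoint of the same chord. There the next gap begins.
\<close>

fun next_edge :: "boundary_edge \<Rightarrow> boundary_edge" where
  "next_edge (Gap i) = (if succ i \<in> first_pos ` B then Left_Side (inv_into B first_pos (succ i))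
      else Right_Side (inv_into B last_pos (succ i)))"
| "next_edge (Left_Side c) = Gap (last_pos c)"
| "next_edge (Right_Side c) = Gap (first_pos c)"

lemma next_Gap_first: "c \<in> B \<Longrightarrow> succ i = first_pos c \<Longrightarrow> next_edge (Gap i) = Left_Side c"
  using gauss.inj_first_pos by simp

lemma next_Gap_last: assumes c: "c \<in> B" and i: "succ i = last_pos c" shows "next_edge (Gap i)
    = Right_Side c"
proof -
  have "last_pos c \<notin> first_pos ` B" using gauss.first_pos_neq_last_pos[OF _ c] by force
  then show ?thesis using gauss.inj_last_pos c i by simp
qed

lemma next_edge_bij: "bij_betw next_edge edges edges"
proof -
  have into: "next_edge e \<in> edges" if "e \<in> edges" for e
  proof (cases e)
    case (Gap i)
    then have "succ i < N" using that by (auto simp: edges_def succ_less)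
    then show ?thesis
      by (rule gauss.position_cases) (use Gap next_Gap_first next_Gap_last
          in \<open>auto simp: edges_def\<close>)
  qed (use that in \<open>auto simp: edges_def gauss.first_pos_bound gauss.last_pos_bound\<close>)
  have onto: "e \<in> next_edge ` edges" if "e \<in> edges" for e
  proof (cases e)
    case (Gap i)
    then have "i < N" using that by (auto simp: edges_def)
    then show ?thesis
    proof (rule gauss.position_cases)
      fix c assume "c \<in> B" "i = first_pos c"
      then show ?thesis using Gap by (intro image_eqI[of _ _ "Right_Side c"]) (auto simp: edges_def)
    next
      fix c assume "c \<in> B" "i = last_pos c"
      then show ?thesis using Gap by (intro image_eqI[of _ _ "Left_Side c"]) (auto simp: edges_def)
    qed
  next
    case (Left_Side c)
    then have c: "c \<in> B" using that by (auto simp: edges_def)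
    have "e = next_edge (Gap (gauss.pred (first_pos c)))"
      using next_Gap_first[OF c succ_pred] gauss.first_pos_bound[OF c] Left_Side by simp
    then show ?thesis by (rule image_eqI) (use pred_less[OF gauss.first_pos_bound[OF c]]
        in \<open>simp add: edges_def\<close>)
  next
    case (Right_Side c)
    then have c: "c \<in> B" using that by (auto simp: edges_def)
    have "e = next_edge (Gap (gauss.pred (last_pos c)))"
      using next_Gap_last[OF c succ_pred] gauss.last_pos_bound[OF c] Right_Side by simp
    then show ?thesis by (rule image_eqI) (use pred_less[OF gauss.last_pos_bound[OF c]]
        in \<open>simp add: edges_def\<close>)
  qed
  have "finite edges" by (simp add: edges_def finite_B)
  moreover have "next_edge ` edges = edges" using into onto by blast
  ultimately show ?thesis by (simp add: bij_betw_def eq_card_imp_inj_on)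
qed


lemma edge_path_Gap [simp]: "edge_path (Gap i) t
    = (None, b * cis ((1 - t) * (angle_at i + w) + t * (next_angle i - w)))"
  by (simp add: edge_path_def)

lemma edge_path_Left:
  "edge_path (Left_Side c) t =
     (if t = 0 then (None, first c * cis (- w)) else if t = 1 then (None,
         if c \<in> B then last c * cis w else last c * cis (- w))
      else (Some c, Complex (-1) t))"
  by (auto simp: edge_path_def)

lemma edge_path_Right:
  "edge_path (Right_Side c) t =
     (if t = 1 then (None, first c * cis w) else if t = 0 then (None,
         if c \<in> B then last c * cis (- w) else last c * cis w)
      else (Some c, Complex 1 (1 - t)))"
  by (auto simp: edge_path_def)

lemma next_angle_point:
  assumes p: "p \<in> \<Union>B" and i: "succ i = pos p" shows "b * cis (next_angle i - w) = p * cis (- w)"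
proof -
  have "b * cis (next_angle i - w) = (b * cis (next_angle i)) * cis (- w)"
      by (simp add: mult.assoc cis_mult)
  then show ?thesis using cis_angle_at_pos[OF p] by (simp only: cis_next_angle i)
qed

lemma angle_at_point:
  assumes p: "p \<in> \<Union>B" shows "b * cis (angle_at (pos p) + w) = p * cis w"
  using cis_angle_at_pos[OF p] by (simp add: mult.assoc flip: cis_mult)

lemma edge_path_join:
  assumes e: "e \<in> edges" shows "edge_path e 1 = edge_path (next_edge e) 0"
proof (cases e)
  case (Gap i)
  then have "succ i < N" using e by (auto simp: edges_def succ_less)
  then show ?thesis
  proof (rule gauss.position_cases)
    fix c assume c: "c \<in> B" "succ i = first_pos c"
    then have "b * cis (next_angle i - w) = first c * cis (- w)"
      by (intro next_angle_point first_in) (simp_all add: first_pos_def)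
    then show ?thesis using Gap next_Gap_first[OF c]
        by (simp add: edge_path_Left del: next_edge.simps)
  next
    fix c assume c: "c \<in> B" "succ i = last_pos c"
    then have "b * cis (next_angle i - w) = last c * cis (- w)"
      by (intro next_angle_point last_in) (simp_all add: last_pos_def)
    then show ?thesis using Gap next_Gap_last[OF c] c(1)
        by (simp add: edge_path_Right del: next_edge.simps)
  qed
next
  case (Left_Side c)
  then have c: "c \<in> B" using e by (auto simp: edges_def)
  then show ?thesis using Left_Side angle_at_point[OF last_in[OF c]]
      by (simp add: edge_path_Left last_pos_def)
next
  case (Right_Side c)
  then have c: "c \<in> B" using e by (auto simp: edges_def)
  then show ?thesis using Right_Side angle_at_point[OF first_in[OF c]]
      by (simp add: edge_path_Right first_pos_def)
qed

lemma gap_parameter: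
  assumes i: "i < N" and t: "0 \<le> t" "t \<le> 1"
  defines "\<psi> \<equiv> (1 - t) * (angle_at i + w) + t * (next_angle i - w)"
  shows "angle_at i + w \<le> \<psi>" "\<psi> \<le> next_angle i - w" "t < 1
      \<Longrightarrow> \<psi> < next_angle i - w" "angle_at i \<le> \<psi>" "\<psi> < next_angle i"
proof -
  have \<psi>: "\<psi> = angle_at i + w + t * ((next_angle i - w) - (angle_at i + w))" "\<psi>
      = next_angle i - w - (1 - t) * ((next_angle i - w) - (angle_at i + w))"
    by (simp_all add: \<psi>_def algebra_simps)
  have g: "0 < (next_angle i - w) - (angle_at i + w)" using gap_nonempty[OF i] by simp
  show 1: "angle_at i + w \<le> \<psi>" unfolding \<psi>(1) using t g by simp
  show 2: "\<psi> \<le> next_angle i - w" unfolding \<psi>(2) using t g by simp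
  show "\<psi> < next_angle i - w" if "t < 1" unfolding \<psi>(2) using that g by simp
  show "angle_at i \<le> \<psi>" "\<psi> < next_angle i" using 1 2 w_pos by auto
qed

lemma edge_path_in_rim:
  assumes e: "e \<in> edges" and t: "t \<in> {0..1}" shows "edge_path e t \<in> rim"
proof (cases e)
  case (Gap i)
  then have i: "i < N" using e by (auto simp: edges_def)
  show ?thesis
    using Gap gap_not_in_open_arcs[OF i gap_parameter(1,2)[OF i, of t]] t norm_b
        by (auto simp: rim_def norm_mult)
next
  case (Left_Side c)
  then have c: "c \<in> B" using e by (auto simp: edges_def)
  have "first c * cis (- w) \<notin> open_arcs" "last c * cis w \<notin> open_arcs"
    using corner_not_in_open_arcs[OF first_in[OF c], of "- w"] corner_not_in_open_arcs[OF last_in[OF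
        c], of w] w_pos
    by simp_all
  then show ?thesis using Left_Side c t norm_endpoint[OF first_in[OF c]] norm_endpoint[OF last_in[OF
      c]]
    by (auto simp: edge_path_Left rim_def norm_mult)
next
  case (Right_Side c)
  then have c: "c \<in> B" using e by (auto simp: edges_def)
  have "first c * cis w \<notin> open_arcs" "last c * cis (- w) \<notin> open_arcs"
    using corner_not_in_open_arcs[OF first_in[OF c], of w] corner_not_in_open_arcs[OF last_in[OF c],
        of "- w"] w_pos
    by simp_all
  then show ?thesis using Right_Side c t norm_endpoint[OF first_in[OF c]] norm_endpoint[OF
      last_in[OF c]]
    by (auto simp: edge_path_Right rim_def norm_mult)
qed

lemma continuous_map_into_disk_and_bands:
  assumes "i \<in> insert None (Some ` B)"
  shows "continuous_map (case i of None \<Rightarrow> top_of_set (cball 0 1)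
      | Some c \<Rightarrow> top_of_set (cbox (Complex (- 1) 0) (Complex 1 1)))
      (disk_and_bands B) (Pair i)"
  unfolding disk_and_bands_def using continuous_map_component_injection[OF assms] .

lemma continuous_edge_path:
  assumes e: "e \<in> edges" shows "continuous_map (top_of_set {0..1}) (subtopology surface rim)
      (edge_path e)"
proof -
  note inj = continuous_map_into_disk_and_bands
  have "continuous_map (top_of_set {0..1}) (disk_and_bands B) (edge_point e)"
  proof (cases e)
    case (Gap i)
    have "continuous_map (top_of_set {0..1}) (top_of_set (cball 0 1)) (\<lambda>t. b * cis ((1 - t) *
        (angle_at i + w) + t * (next_angle i - w)))"
      by (auto simp: continuous_map_in_subtopology norm_mult norm_b intro!: continuous_intros)
    from continuous_map_compose[OF this, of "disk_and_bands B" "Pair None"] inj[of None]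
    moreover have "edge_point e = (\<lambda>t. (None, b * cis ((1 - t) * (angle_at i + w) + t * (next_angle
        i - w))))"
      using Gap by (simp add: fun_eq_iff)
    ultimately show ?thesis by (simp add: o_def)
  next
    case (Left_Side c)
    then have c: "c \<in> B" using e by (auto simp: edges_def)
    have "continuous_map (top_of_set {0..1}) (top_of_set (cbox (Complex (- 1) 0) (Complex 1 1)))
        (Complex (-1))"
      by (auto simp: continuous_map_in_subtopology in_cbox_complex_iff Complex_eq intro!:
          continuous_intros)
    from continuous_map_compose[OF this, of "disk_and_bands B" "Pair (Some c)"] inj[of "Some c"] c
    moreover have "edge_point e = (\<lambda>t. (Some c, Complex (-1) t))" using Left_Side
        by (simp add: fun_eq_iff)
    ultimately show ?thesis by (simp add: o_def)
  next
    case (Right_Side c)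
    then have c: "c \<in> B" using e by (auto simp: edges_def)
    have "continuous_map (top_of_set {0..1}) (top_of_set (cbox (Complex (- 1) 0) (Complex 1 1)))
        (\<lambda>t. Complex 1 (1 - t))"
      by (auto simp: continuous_map_in_subtopology in_cbox_complex_iff Complex_eq intro!:
          continuous_intros)
    from continuous_map_compose[OF this, of "disk_and_bands B" "Pair (Some c)"] inj[of "Some c"] c
    moreover have "edge_point e = (\<lambda>t. (Some c, Complex 1 (1 - t)))" using Right_Side
        by (simp add: fun_eq_iff)
    ultimately show ?thesis by (simp add: o_def)
  qed
  from continuous_map_compose[OF this continuous_map_glue]
  have "continuous_map (top_of_set {0..1}) surface (edge_path e)"
    by (simp add: o_def edge_path_def[abs_def])
  then show ?thesis using edge_path_in_rim[OF e] by (auto simp: continuous_map_in_subtopology)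
qed

lemma gap_not_corner:
  assumes i: "i < N" and p: "p \<in> \<Union>B" and \<psi>: "angle_at i + w \<le> \<psi>" "\<psi> < next_angle i - w"
  shows "b * cis \<psi> \<noteq> p * cis (- w)"
proof
  assume eq: "b * cis \<psi> = p * cis (- w)"
  define k where "k = gauss.pred (pos p)"
  have k: "k < N" "succ k = pos p" using pred_less succ_pred pos_bound[OF p]
      by (simp_all add: k_def)
  have "b * cis \<psi> = b * cis (next_angle k - w)" using next_angle_point[OF p k(2)] eq by simp
  then have "i = k \<and> \<psi> = next_angle k - w"
    using angle_unique[OF i k(1), of \<psi> "next_angle k - w"] \<psi> w_pos gap_nonempty[OF k(1)] by simp
  then show False using \<psi> by simp
qed

lemma edge_path_inj:
  assumes e: "e \<in> edges" and e': "e' \<in> edges" and s: "s \<in> {0..<1}" and t: "t \<in> {0..<1}"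
    and eq: "edge_path e s = edge_path e' t"
  shows "e = e' \<and> s = t"
proof -
  have gap_gap: "i = j \<and> s = t" if i: "i < N" and j: "j < N" and s: "s \<in> {0..<1}"
      and t: "t \<in> {0..<1}"
    and eq: "edge_path (Gap i) s = edge_path (Gap j) t" for i j s t
  proof -
    have "i = j \<and> (1 - s) * (angle_at i + w) + s * (next_angle i - w)
        = (1 - t) * (angle_at j + w) + t * (next_angle j - w)"
      by (rule angle_unique) (use i j s t eq gap_parameter(4,5)[OF i, of s] gap_parameter(4,5)[OF j,
          of t] in auto)
    moreover from this have "(s - t) * ((next_angle i - w) - (angle_at i + w)) = 0"
        by (auto simp: algebra_simps)
    ultimately show ?thesis using gap_nonempty[OF i] by auto
  qed
  have gap_side: "edge_path (Gap i) s \<noteq> edge_path (Left_Side c) t" "edge_path (Gap i) s \<noteq> edge_path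
      (Right_Side c) t"
    if i: "i < N" and c: "c \<in> B" and s: "s \<in> {0..<1}" and t: "t \<in> {0..<1}" for i c s t
    using gap_not_corner[OF i first_in[OF c] gap_parameter(1,3)[OF i, of s]]
      gap_not_corner[OF i last_in[OF c] gap_parameter(1,3)[OF i, of s]] s t c
    by (auto simp: edge_path_Left edge_path_Right)
  have left_right: "edge_path (Left_Side c) s \<noteq> edge_path (Right_Side d) t"
    if c: "c \<in> B" and d: "d \<in> B" and s: "s \<in> {0..<1}" and t: "t \<in> {0..<1}" for c d s t
    using s t first_neq_last[OF c d] d by (auto simp: edge_path_Left edge_path_Right)
  have left_left: "c = d \<and> s = t" if "c \<in> B" "d \<in> B" "s \<in> {0..<1}" "t \<in> {0..<1}"
      "edge_path (Left_Side c) s = edge_path (Left_Side d) t" for c d s t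
    using that first_inj[of c d] by (auto simp: edge_path_Left split: if_splits)
  have right_right: "c = d \<and> s = t" if "c \<in> B" "d \<in> B" "s \<in> {0..<1}" "t \<in> {0..<1}"
      "edge_path (Right_Side c) s = edge_path (Right_Side d) t" for c d s t
    using that last_inj[of c d] by (auto simp: edge_path_Right split: if_splits)
  have mem: "e = Gap i \<Longrightarrow> i < N" "e = Left_Side c \<Longrightarrow> c \<in> B" "e = Right_Side c \<Longrightarrow> c \<in> B"
    "e' = Gap i \<Longrightarrow> i < N" "e' = Left_Side c \<Longrightarrow> c \<in> B" "e' = Right_Side c \<Longrightarrow> c \<in> B" for i c
    using e e' by (auto simp: edges_def)
  show ?thesis
  proof (cases e)
    case E: (Gap i)
    show ?thesis
    proof (cases e')
      case (Gap j)
      show ?thesis using gap_gap[OF mem(1)[OF E] mem(4)[OF Gap] s t] eq E Gap by simp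
    next
      case (Left_Side c)
      show ?thesis using gap_side(1)[OF mem(1)[OF E] mem(5)[OF Left_Side] s t] eq E Left_Side
          by simp
    next
      case (Right_Side c)
      show ?thesis using gap_side(2)[OF mem(1)[OF E] mem(6)[OF Right_Side] s t] eq E Right_Side
          by simp
    qed
  next
    case E: (Left_Side d)
    show ?thesis
    proof (cases e')
      case (Gap j)
      show ?thesis using gap_side(1)[OF mem(4)[OF Gap] mem(2)[OF E] t s] eq E Gap by simp
    next
      case (Left_Side c)
      show ?thesis using left_left[OF mem(2)[OF E] mem(5)[OF Left_Side] s t] eq E Left_Side by simp
    next
      case (Right_Side c)
      show ?thesis using left_right[OF mem(2)[OF E] mem(6)[OF Right_Side] s t] eq E Right_Side
          by simp
    qed
  next
    case E: (Right_Side d)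
    show ?thesis
    proof (cases e')
      case (Gap j)
      show ?thesis using gap_side(2)[OF mem(4)[OF Gap] mem(3)[OF E] t s] eq E Gap by simp
    next
      case (Left_Side c)
      show ?thesis using left_right[OF mem(5)[OF Left_Side] mem(3)[OF E] t s] eq E Left_Side by simp
    next
      case (Right_Side c)
      show ?thesis using right_right[OF mem(3)[OF E] mem(6)[OF Right_Side] s t] eq E Right_Side
          by simp
    qed
  qed
qed

text \<open>
  A point of the circle belongs to its gap, except for the end of the gap: being excluded there, it
  is counted as the start of a side of a band.
\<close>

lemma edge_path_cover:
  assumes N: "N > 0" and x: "x \<in> rim" shows "\<exists>e\<in>edges. \<exists>t\<in>{0..<1}. x = edge_path e t"
proof -
  consider z where "x = (None, z)" "norm z = 1" "z \<notin> open_arcs"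
    | c z where "x = (Some c, z)" "c \<in> B" "\<bar>Re z\<bar> = 1" "0 < Im z" "Im z < 1"
    using x by (auto simp: rim_def)
  then show ?thesis
  proof cases
    case (1 z)
    obtain i \<psi> where i: "i < N" and \<psi>: "angle_at i + w \<le> \<psi>" "\<psi> \<le> next_angle i - w" "z = b * cis \<psi>"
      using circle_minus_open_arcs[OF N 1(2,3)] by blast
    show ?thesis
    proof (cases "\<psi> = next_angle i - w")
      case True
      show ?thesis using succ_less[OF i]
      proof (rule gauss.position_cases)
        fix c assume c: "c \<in> B" "succ i = first_pos c"
        then have "z = first c * cis (- w)" unfolding \<psi>(3) True
          by (intro next_angle_point first_in) (simp_all add: first_pos_def)
        then show ?thesis using 1 c by (intro bexI[of _ "Left_Side c"] bexI[of _ 0]) (auto simp: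
            edge_path_Left edges_def)
      next
        fix c assume c: "c \<in> B" "succ i = last_pos c"
        then have "z = last c * cis (- w)" unfolding \<psi>(3) True
          by (intro next_angle_point last_in) (simp_all add: last_pos_def)
        then show ?thesis using 1 c by (intro bexI[of _ "Right_Side c"] bexI[of _ 0]) (auto simp:
            edge_path_Right edges_def)
      qed
    next
      case False
      define t where "t = (\<psi> - (angle_at i + w)) / ((next_angle i - w) - (angle_at i + w))"
      have g: "0 < (next_angle i - w) - (angle_at i + w)" using gap_nonempty[OF i] by simp
      have t: "0 \<le> t" "t < 1" using \<psi> False g by (auto simp: t_def)
      have "(1 - t) * (angle_at i + w) + t * (next_angle i - w)
          = (angle_at i + w) + t * ((next_angle i - w) - (angle_at i + w))"
        by (simp add: algebra_simps)
      also have "\<dots> = \<psi>" using g by (simp add: t_def)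
      finally show ?thesis using 1 \<psi>(3) t i by (intro bexI[of _ "Gap i"] bexI[of _ t]) (auto simp:
          edges_def)
    qed
  next
    case (2 c z)
    then consider "z = Complex (-1) (Im z)" | "z = Complex 1 (Im z)"
        by (auto simp: complex_eq_iff abs_if split: if_splits)
    then show ?thesis
    proof cases
      case 1
      then show ?thesis using 2
        by (intro bexI[of _ "Left_Side c"] bexI[of _ "Im z"]) (auto simp: edge_path_Left edges_def)
    next
      case b: 2
      then show ?thesis using 2
        by (intro bexI[of _ "Right_Side c"] bexI[of _ "1 - Im z"]) (auto simp: edge_path_Right
            edges_def)
    qed
  qed
qed

lemma boundary_chain_of_arcs:
  assumes "N > 0"
  shows "closed_chain_of_arcs (subtopology surface rim) edges next_edge edge_path"
proof
  show "Hausdorff_space (subtopology surface rim)"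
      by (rule Hausdorff_space_subtopology[OF Hausdorff_surface])
  show "finite edges" by (simp add: edges_def finite_B)
  show "bij_betw next_edge edges edges" by (rule next_edge_bij)
  show "\<exists>e\<in>edges. \<exists>t\<in>{0..<1}. x = edge_path e t" if "x \<in> topspace (subtopology surface rim)" for x
    using edge_path_cover[OF assms] that by simp
qed (fact continuous_edge_path edge_path_join edge_path_inj)+

text \<open>
  With no band there are no endpoints to subdivide the circle, which is a single arc that ends where
  it starts.
\<close>

lemma boundary_circle_without_chords:
  assumes "B = {}"
  shows "closed_chain_of_arcs (subtopology surface rim) {()} id (\<lambda>_ t. (None, cis (2 * pi * t)))"
proof
  have rim: "rim = {(None, z) | z. norm z = 1}" unfolding rim_def open_arcs_def using assms by auto
  show "Hausdorff_space (subtopology surface rim)"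
      by (rule Hausdorff_space_subtopology[OF Hausdorff_surface])
  have "continuous_map (top_of_set {0..1}) (top_of_set (cball 0 1)) (\<lambda>t. cis (2 * pi * t))"
    by (auto simp: continuous_map_in_subtopology intro!: continuous_intros)
  moreover have "continuous_map (top_of_set (cball 0 1)) (disk_and_bands B) (Pair None)"
    using continuous_map_into_disk_and_bands[of None] by simp
  ultimately have "continuous_map (top_of_set {0..1}) surface (glue b w B \<circ> (Pair None \<circ> (\<lambda>t. cis (2
      * pi * t))))"
    by (intro continuous_map_compose[OF _ continuous_map_glue] continuous_map_compose)
  then show "continuous_map (top_of_set {0..1}) (subtopology surface rim) (\<lambda>t. (None, cis (2 * pi *
      t)))"
    by (auto simp: continuous_map_in_subtopology rim o_def)
  show "i = j \<and> s = t" if "s \<in> {0..<1}" "t \<in> {0..<1}"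
      and "(None :: complex set option, cis (2 * pi * s)) = (None, cis (2 * pi * t))"
    for i j :: unit and s t :: real
  proof -
    have "\<bar>2 * pi * s - 2 * pi * t\<bar> = 2 * pi * \<bar>s - t\<bar>"
        by (simp add: abs_mult flip: right_diff_distrib)
    also have "\<dots> < 2 * pi * 1" using that by (intro mult_strict_left_mono) auto
    finally show ?thesis using cis_eq_imp_eq[of "2 * pi * s" "2 * pi * t"] that(3) by simp
  qed
  fix x assume "x \<in> topspace (subtopology surface rim)"
  then obtain z where z: "x = (None, z)" "norm z = 1" by (auto simp: rim)
  have "z = cis (2 * pi * (Arg2pi z / (2 * pi)))" using Arg2pi_eq[of z] z(2)
      by (simp add: cis_conv_exp)
  moreover have "Arg2pi z / (2 * pi) \<in> {0..<1}" using Arg2pi[of z] by auto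
  ultimately show "\<exists>i\<in>{()}. \<exists>t\<in>{0..<1}. x = (None, cis (2 * pi * t))" using z by blast
qed auto

end

section \<open>Boundary components and nullity\<close>

context band_diagram begin

text \<open>
  Every side of a band leads into a gap, so the cycles of the walk are already met by the gaps. The
  two sides of a band give the two compatibility equations of its chord.
\<close>

lemma components_with_chords:
  assumes N: "N > 0"
  shows "card (connected_components_of (surface_boundary surface)) = kernel_dim A + 1"
    and "finite (connected_components_of (surface_boundary surface))"
    and "C \<in> connected_components_of (surface_boundary surface) \<Longrightarrow>
      subtopology (surface_boundary surface) C homeomorphic_space nsphere 1"
proof -
  interpret arcs: closed_chain_of_arcs "subtopology surface rim" edges next_edge edge_path
    by (rule boundary_chain_of_arcs[OF N])
  let ?cc = "\<lambda>i. arcs.cycle (Gap i)"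
  have mem: "i < N \<Longrightarrow> Gap i \<in> edges" "c \<in> B \<Longrightarrow> Left_Side c \<in> edges" "c \<in> B \<Longrightarrow> Right_Side c \<in> edges"
      for i c
    by (auto simp: edges_def)
  have comps: "connected_components_of (surface_boundary surface) = arcs.cycle ` edges"
    unfolding surface_boundary_eq by (rule arcs.connected_components_eq_cycles)
  then show "finite (connected_components_of (surface_boundary surface))" by (simp add: arcs.fin)
  show "subtopology (surface_boundary surface) C homeomorphic_space nsphere 1"
    if "C \<in> connected_components_of (surface_boundary surface)"
    using that arcs.cycle_homeomorphic_circle unfolding comps by (auto simp: surface_boundary_eq)
  have side: "arcs.cycle (Left_Side c) = ?cc (last_pos c)" "arcs.cycle (Right_Side c)
      = ?cc (first_pos c)" if "c \<in> B" for c
    using arcs.cycle_step[OF mem(2)[OF that]] arcs.cycle_step[OF mem(3)[OF that]] by simp_all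
  have pred_first: "next_edge (Gap (gauss.pred (first_pos c))) = Left_Side c"
    and pred_last: "next_edge (Gap (gauss.pred (last_pos c))) = Right_Side c" if "c \<in> B" for c
    using next_Gap_first[OF that succ_pred] next_Gap_last[OF that succ_pred]
        gauss.first_pos_bound[OF that] gauss.last_pos_bound[OF that]
    by simp_all
  have eq: "arcs.cycle ` edges = ?cc ` {..<N}"
  proof -
    have "arcs.cycle ` edges = ?cc ` {..<N} \<union> arcs.cycle ` Left_Side ` B \<union> arcs.cycle ` Right_Side `
        B"
      by (simp add: edges_def image_Un image_image)
    moreover have "arcs.cycle ` Left_Side ` B \<subseteq> ?cc ` {..<N}" "arcs.cycle ` Right_Side ` B \<subseteq> ?cc `
        {..<N}"
      using side gauss.last_pos_bound gauss.first_pos_bound by auto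
    ultimately show ?thesis by (simp only: Un_absorb2)
  qed
  have "gauss.compatible ?cc"
    unfolding gauss.compatible_def
  proof (intro ballI conjI)
    fix c assume c: "c \<in> B"
    show "?cc (last_pos c) = ?cc (gauss.pred (first_pos c))"
      using arcs.cycle_step[OF mem(1)[OF pred_less[OF gauss.first_pos_bound[OF c]]]] pred_first[OF
          c] side(1)[OF c] by simp
    show "?cc (first_pos c) = ?cc (gauss.pred (last_pos c))"
      using arcs.cycle_step[OF mem(1)[OF pred_less[OF gauss.last_pos_bound[OF c]]]] pred_last[OF c]
          side(2)[OF c] by simp
  qed
  moreover have "f i = f j" if f: "gauss.compatible f" and ij: "i < N" "j < N" "?cc i = ?cc j"
      for f :: "nat \<Rightarrow> rat" and i j
  proof -
    \<comment> \<open>A compatible function of the gaps extends to the sides by its value on the gap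
        where the side ends.\<close>
    define F where "F = (\<lambda>e. case e of Gap i \<Rightarrow> f i | Left_Side c \<Rightarrow> f (last_pos c)
        | Right_Side c \<Rightarrow> f (first_pos c))"
    have "F (next_edge e) = F e" if e: "e \<in> edges" for e
    proof (cases e)
      case (Gap k)
      then have k: "k < N" using e by (auto simp: edges_def)
      show ?thesis using succ_less[OF k]
      proof (rule gauss.position_cases)
        fix c assume c: "c \<in> B" "succ k = first_pos c"
        then have "gauss.pred (first_pos c) = k" using pred_succ[OF k] by simp
        then show ?thesis using Gap next_Gap_first[OF c] f c(1)
            by (simp add: F_def gauss.compatible_def del: next_edge.simps)
      next
        fix c assume c: "c \<in> B" "succ k = last_pos c"
        then have "gauss.pred (last_pos c) = k" using pred_succ[OF k] by simp
        then show ?thesis using Gap next_Gap_last[OF c] f c(1)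
            by (simp add: F_def gauss.compatible_def del: next_edge.simps)
      qed
    qed (simp_all add: F_def)
    then have "F (Gap i) = F (Gap j)"
      by (rule arcs.invariant_cycle[OF _ mem(1)[OF ij(1)] mem(1)[OF ij(2)] ij(3)])
    then show ?thesis by (simp add: F_def)
  qed
  ultimately have "kernel_dim A + 1 = card (?cc ` {..<N})"
    by (intro gauss.kernel_dim_crossing_matrix[OF A_carrier row_index_bij A_entry N])
  then show "card (connected_components_of (surface_boundary surface)) = kernel_dim A + 1"
    by (simp add: comps eq)
qed

lemma components_without_chords:
  assumes B: "B = {}"
  shows "card (connected_components_of (surface_boundary surface)) = kernel_dim A + 1"
    and "finite (connected_components_of (surface_boundary surface))"
    and "C \<in> connected_components_of (surface_boundary surface) \<Longrightarrow>
      subtopology (surface_boundary surface) C homeomorphic_space nsphere 1"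
proof -
  interpret arcs: closed_chain_of_arcs "subtopology surface rim" "{()}" id "\<lambda>_ t. (None, cis (2 * pi
      * t))"
    by (rule boundary_circle_without_chords[OF B])
  have comps: "connected_components_of (surface_boundary surface) = {arcs.cycle ()}"
    unfolding surface_boundary_eq arcs.connected_components_eq_cycles by simp
  have "kernel_dim A = 0" using kernel_dim_empty A_carrier B by simp
  then show "card (connected_components_of (surface_boundary surface)) = kernel_dim A + 1"
    "finite (connected_components_of (surface_boundary surface))" by (simp_all add: comps)
  show "subtopology (surface_boundary surface) C homeomorphic_space nsphere 1"
    if "C \<in> connected_components_of (surface_boundary surface)"
    using that arcs.cycle_homeomorphic_circle[of "()"] unfolding comps
        by (simp add: surface_boundary_eq)
qed

theorem boundary_components_and_homology:
  "num_boundary_components surface = kernel_dim A + 1"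
  "vectorspace.fin_dim class_ring (rat_homology 1 (surface_boundary surface))"
  "vectorspace.dim class_ring (rat_homology 1 (surface_boundary surface)) = kernel_dim A + 1"
proof -
  have "N > 0 \<or> B = {}"
  proof (rule disjCI)
    assume "B \<noteq> {}"
    then have "\<Union>B \<noteq> {}" using first_in by blast
    then show "N > 0" by (simp add: N_def card_gt_0_iff finite_endpoints)
  qed
  then have comps: "card (connected_components_of (surface_boundary surface)) = kernel_dim A + 1"
    "finite (connected_components_of (surface_boundary surface))"
    "\<And>C. C \<in> connected_components_of (surface_boundary surface) \<Longrightarrow>
      subtopology (surface_boundary surface) C homeomorphic_space nsphere 1"
    using components_with_chords components_without_chords by blast+
  show "num_boundary_components surface = kernel_dim A + 1"
    using comps(1) by (simp add: num_boundary_components_def)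
  show "vectorspace.fin_dim class_ring (rat_homology 1 (surface_boundary surface))"
    "vectorspace.dim class_ring (rat_homology 1 (surface_boundary surface)) = kernel_dim A + 1"
    using rat_homology_of_circles[OF comps(2,3)] comps(1) by simp_all
qed

end

theorem theorem2:
  fixes b :: complex and D So Su Se :: "complex set set" and w :: real
  assumes "chord_diagram b D"
    and "partial_state D (So, Su, Se)"
    and "Su = {}"
    and "admissible_width D w"
  shows "let \<Sigma> = state_surface b w (So, Su, Se);
             A = (skew_adjacency (canonical_graph b (D - Se)) :: rat mat);
             H\<^sub>1 = rat_homology 1 (surface_boundary \<Sigma>)
         in num_boundary_components \<Sigma> = kernel_dim (transpose_mat A) + 1 \<and>
            kernel_dim (transpose_mat A) + 1 = kernel_dim A + 1 \<and>
            vectorspace.fin_dim class_ring H\<^sub>1 \<and>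
            kernel_dim A + 1 = vectorspace.dim class_ring H\<^sub>1"
proof -
  have So: "So \<subseteq> D" "D - Se = So" using assms(2,3) by (auto simp: partial_state_def)
  have "chord_diagram b So"
    using assms(1) So(1) unfolding chord_diagram_def
        by (meson finite_subset pairwise_subset subsetD)
  moreover have "admissible_width So w"
    using assms(4) Union_mono[OF So(1)] unfolding admissible_width_def by blast
  ultimately interpret band_diagram b So w by unfold_locales
  have "state_surface b w (So, Su, Se) = surface"
    by (simp add: state_surface_def surface_def assms(3))
  then show ?thesis
    unfolding Let_def So(2)
    using boundary_components_and_homology kernel_dim_transpose_skew[OF A_carrier A_skew] by simp
qed

end
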